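(* Let $n\geq 1$ be an integer. For each $k\in\mathbb{N}$ let $(\alpha_1^k,\dots,\alpha_n^k)\in\mathbb{D}^n$, $(\theta_1^k,\dots,\theta_n^k)\in\mathbb{R}^n$ and $p_k\in S_n$ (the group of permutations of $\{1,\dots,n\}$), and let \[\phi_k(z_1,\dots,z_n):=\left(e^{i\theta^k_1}\frac{\alpha^k_1-z_{p_k(1)}}{1-\overline{\alpha^k_1}z_{p_k(1)}},\dots,e^{i\theta^k_n}\frac{\alpha^k_n-z_{p_k(n)}}{1-\overline{\alpha^k_n}z_{p_k(n)}}\right)\] be the corresponding sequence of automorphisms of the polydisk $\mathbb{D}^n\subset\mathbb{C}^n$. If $(\alpha_1^k,\dots,\alpha_n^k)\rightarrow(\alpha_1,\dots,\alpha_n)\in\mathbb{T}^n$ as $k\rightarrow\infty$, then there exists an inner function $x$ on $\mathbb{D}^n$ such that $\{x\circ\phi_k:k\in\mathbb{N}\}$ is dense in $\overline{\mathrm{Ball}}(H^{\infty}(\mathbb{D}^n))$ with respect to the compact-open topology. Furthermore, the universal element $x$ has the form \[x=\prod_{j=1}^{\infty}x_j\] for some sequence $\{x_j\}_{j\in\mathbb{N}}$ of inner functions on $\mathbb{D}^n$ that are continuous up to $\overline{\mathbb{D}^n}$.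
   Context: $\mathbb{D}^n=\{(z_1,\dots,z_n)\in\mathbb{C}^n:|z_j|<1,\ j=1,\dots,n\}$ is the unit polydisk and $\mathbb{T}^n=\{(z_1,\dots,z_n)\in\mathbb{C}^n:|z_j|=1,\ j=1,\dots,n\}$ is its distinguished boundary. $H^{\infty}(\mathbb{D}^n)$ is the space of bounded holomorphic functions on $\mathbb{D}^n$, equipped with the compact-open topology (uniform convergence on compact subsets of $\mathbb{D}^n$), and $\overline{\mathrm{Ball}}(H^{\infty}(\mathbb{D}^n))=\{h\in H^{\infty}(\mathbb{D}^n):\sup_{\mathbb{D}^n}|h|\leq 1\}$ with the same topology; it is a topological semigroup under pointwise multiplication, with identity the constant function $1$. A bounded holomorphic function $f:\mathbb{D}^n\to\mathbb{C}$ is an inner function if $\lim_{r\to1^-}|f(re^{i\theta_1},\dots,re^{i\theta_n})|=1$ for almost every $(e^{i\theta_1},\dots,e^{i\theta_n})\in\mathbb{T}^n$. A function on $\mathbb{D}^n$ is continuous up to $\overline{\mathbb{D}^n}$ if it extends continuously to $\overline{\mathbb{D}^n}$. The infinite product is understood as the limit of its partial products in the compact-open topology. An element $x$ is universal for the sequence of maps $f\mapsto f\circ\phi_k$ on $\overline{\mathrm{Ball}}(H^{\infty}(\mathbb{D}^n))$ if $\{x\circ\phi_k:k\in\mathbb{N}\}$ is dense in $\overline{\mathrm{Ball}}(H^{\infty}(\mathbb{D}^n))$. *)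

theory Defs
  imports "HOL-Analysis.Analysis"
begin

text \<open>
  The dimension \<open>n \<ge> 1\<close> is \<open>CARD('n)\<close>. Functions on the polydisk are total functions on
  \<open>complex ^ 'n\<close> whose values outside the polydisk are ignored by every notion below.
\<close>

definition polydisk :: "(complex ^ 'n) set" where
  "polydisk = {z. \<forall>j. norm (z $ j) < 1}"

definition torus :: "(complex ^ 'n) set" where
  "torus = {z. \<forall>j. norm (z $ j) = 1}"

text \<open>Holomorphy in several variables (on open sets): the derivative exists and is
  complex linear.\<close>

definition sv_holomorphic_on :: "(complex ^ 'n \<Rightarrow> complex) \<Rightarrow> (complex ^ 'n) set \<Rightarrow> bool" where
  "sv_holomorphic_on f S \<longleftrightarrow>
     (\<forall>z\<in>S. \<exists>c :: complex ^ 'n. (f has_derivative (\<lambda>h. \<Sum>j\<in>UNIV. c $ j * h $ j)) (at z))"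

definition Hinf :: "(complex ^ 'n \<Rightarrow> complex) set" where
  "Hinf = {f. sv_holomorphic_on f polydisk \<and> bounded (f ` polydisk)}"

definition Hinf_ball :: "(complex ^ 'n \<Rightarrow> complex) set" where
  "Hinf_ball = {h \<in> Hinf. \<forall>z\<in>polydisk. norm (h z) \<le> 1}"

text \<open>As values outside the polydisk are ignored, the topology does not separate functions
  that agree on the polydisk. Lemma \<open>limitin_Hinf_topology_iff\<close> below shows that its
  convergence is uniform convergence on compact subsets of the polydisk.\<close>

definition Hinf_topology :: "(complex ^ 'n \<Rightarrow> complex) topology" where
  "Hinf_topology = topology_generated_by
     {{f \<in> Hinf. f ` K \<subseteq> U} | K U. compact K \<and> K \<subseteq> polydisk \<and> open U}"

text \<open>Normalized arc-length (Haar) measure on the distinguished boundary.\<close>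

definition torus_measure :: "(complex ^ 'n) measure" where
  "torus_measure =
     distr (uniform_measure lborel (cbox 0 (\<chi> j. 2 * pi) :: (real ^ 'n) set))
       (restrict_space borel torus) (\<lambda>t. \<chi> j. cis (t $ j))"

definition inner_function :: "(complex ^ 'n \<Rightarrow> complex) \<Rightarrow> bool" where
  "inner_function f \<longleftrightarrow> f \<in> Hinf \<and>
     (AE \<zeta> in torus_measure. ((\<lambda>r. norm (f (r *\<^sub>R \<zeta>))) \<longlongrightarrow> 1) (at_left 1))"

definition continuous_up_to_closure :: "(complex ^ 'n \<Rightarrow> complex) \<Rightarrow> bool" where
  "continuous_up_to_closure f \<longleftrightarrow>
     (\<exists>g. continuous_on (closure polydisk) g \<and> (\<forall>z\<in>polydisk. g z = f z))"

definition polydisk_aut ::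
    "complex ^ 'n \<Rightarrow> real ^ 'n \<Rightarrow> ('n \<Rightarrow> 'n) \<Rightarrow> complex ^ 'n \<Rightarrow> complex ^ 'n" where
  "polydisk_aut \<alpha> \<theta> p z =
     (\<chi> j. cis (\<theta> $ j) * ((\<alpha> $ j - z $ p j) / (1 - cnj (\<alpha> $ j) * z $ p j)))"

lemma topspace_Hinf_topology [simp]: "topspace Hinf_topology = Hinf"
proof -
  have "Hinf \<subseteq> \<Union> {{f \<in> Hinf. f ` K \<subseteq> U} | K U. compact K \<and> K \<subseteq> polydisk \<and> open U}"
    by (rule Union_upper) (auto intro!: exI[of _ "{}"])
  then show ?thesis
    unfolding Hinf_topology_def by auto
qed

lemma Hinf_continuous_on:
  assumes "f \<in> Hinf"
  shows "continuous_on polydisk f"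
  using assms unfolding Hinf_def sv_holomorphic_on_def
  by (blast intro: continuous_at_imp_continuous_on has_derivative_continuous)

lemma Hinf_topology_uniform_nbhd:
  assumes "openin Hinf_topology U" "f \<in> U"
  shows "\<exists>K e. compact K \<and> K \<subseteq> polydisk \<and> e > 0 \<and>
           (\<forall>g\<in>Hinf. (\<forall>z\<in>K. dist (g z) (f z) < e) \<longrightarrow> g \<in> U)"
proof -
  have "generate_topology_on
     {{f \<in> Hinf. f ` K \<subseteq> U} | K U. compact K \<and> K \<subseteq> polydisk \<and> open U} U"
    using assms(1) unfolding Hinf_topology_def openin_topology_generated_by_iff .
  then show ?thesis using assms(2)
  proof (induction rule: generate_topology_on.induct)
    case Empty
    then show ?case by simp
  next
    case (Int a b)
    obtain K e where K: "compact K" "K \<subseteq> polydisk" "e > 0"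
        "\<And>g. g \<in> Hinf \<Longrightarrow> \<forall>z\<in>K. dist (g z) (f z) < e \<Longrightarrow> g \<in> a"
      using Int.IH(1) Int.prems by auto
    obtain L d where L: "compact L" "L \<subseteq> polydisk" "d > 0"
        "\<And>g. g \<in> Hinf \<Longrightarrow> \<forall>z\<in>L. dist (g z) (f z) < d \<Longrightarrow> g \<in> b"
      using Int.IH(2) Int.prems by auto
    show ?case
      by (rule exI[of _ "K \<union> L"], rule exI[of _ "min e d"]) (use K L in auto)
  next
    case (UN \<K>)
    then obtain k where "k \<in> \<K>" "f \<in> k" by blast
    then show ?case using UN.IH[of k] by (meson UnionI)
  next
    case (Basis s)
    then obtain K U where s: "s = {f \<in> Hinf. f ` K \<subseteq> U}" "compact K" "K \<subseteq> polydisk" "open U"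
      by blast
    have "compact (f ` K)"
      using s Basis.prems
      by (auto intro!: compact_continuous_image intro: continuous_on_subset[OF Hinf_continuous_on])
    moreover have "f ` K \<subseteq> U" using s Basis.prems by auto
    ultimately obtain e where e: "e > 0" "(\<Union>w\<in>f ` K. ball w e) \<subseteq> U"
      using compact_subset_open_imp_ball_epsilon_subset[of "f ` K" U] s(4) by blast
    show ?case
      by (rule exI[of _ K], rule exI[of _ e]) (use e s in \<open>auto simp: dist_commute subset_iff\<close>)
  qed
qed

lemma limitin_Hinf_topology_iff:
  assumes "\<And>k. F k \<in> Hinf"
  shows "limitin Hinf_topology F f sequentially \<longleftrightarrow>
     f \<in> Hinf \<and> (\<forall>K. compact K \<and> K \<subseteq> polydisk \<longrightarrow> uniform_limit K F f sequentially)"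
    (is "?L \<longleftrightarrow> ?R")
proof
  assume R: ?R
  show ?L
    unfolding limitin_def
  proof (intro conjI allI impI)
    show "f \<in> topspace Hinf_topology" using R by simp
    fix U assume "openin Hinf_topology U \<and> f \<in> U"
    then obtain K e where K: "compact K" "K \<subseteq> polydisk" "e > 0"
        "\<And>g. g \<in> Hinf \<Longrightarrow> \<forall>z\<in>K. dist (g z) (f z) < e \<Longrightarrow> g \<in> U"
      using Hinf_topology_uniform_nbhd by metis
    have "\<forall>\<^sub>F n in sequentially. \<forall>z\<in>K. dist (F n z) (f z) < e"
      using R K by (auto simp: uniform_limit_iff)
    then show "\<forall>\<^sub>F n in sequentially. F n \<in> U"
      by eventually_elim (use K assms in auto)
  qed
next
  assume L: ?L
  then have f: "f \<in> Hinf" by (auto simp: limitin_def)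
  have "uniform_limit K F f sequentially" if K: "compact K" "K \<subseteq> polydisk" for K
    unfolding uniform_limit_iff
  proof (intro allI impI)
    fix e :: real assume e: "e > 0"
    have "uniformly_continuous_on K f"
      by (rule compact_uniformly_continuous[OF continuous_on_subset[OF Hinf_continuous_on[OF f] K(2)] K(1)])
    then obtain d where d: "d > 0"
        "\<And>z w. z \<in> K \<Longrightarrow> w \<in> K \<Longrightarrow> dist w z < d \<Longrightarrow> dist (f w) (f z) < e / 2"
      unfolding uniformly_continuous_on_def using e by (metis half_gt_zero)
    have "seq_compact K" using K by (simp add: compact_eq_seq_compact_metric)
    then obtain C where C: "finite C" "C \<subseteq> K" "K \<subseteq> (\<Union>c\<in>C. ball c (d/2))"
      using seq_compact_imp_totally_bounded[of K] d(1) by (metis half_gt_zero)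
    define V where "V c = {g \<in> Hinf. g ` (K \<inter> cball c (d/2)) \<subseteq> ball (f c) (e/2)}" for c
    have "\<forall>\<^sub>F n in sequentially. F n \<in> V c" if c: "c \<in> C" for c
    proof -
      have "openin Hinf_topology (V c)"
        unfolding Hinf_topology_def V_def
        by (rule topology_generated_by_Basis)
           (use K in \<open>auto intro!: exI[of _ "K \<inter> cball c (d/2)"] exI[of _ "ball (f c) (e/2)"]
             compact_Int_closed\<close>)
      moreover have "f \<in> V c"
        using f d c C(2) unfolding V_def by (auto simp: dist_commute)
      ultimately show ?thesis using L by (auto simp: limitin_def)
    qed
    then have "\<forall>\<^sub>F n in sequentially. \<forall>c\<in>C. F n \<in> V c"
      using C(1) by (simp add: eventually_ball_finite)
    then show "\<forall>\<^sub>F n in sequentially. \<forall>z\<in>K. dist (F n z) (f z) < e"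
    proof eventually_elim
      case (elim n)
      show ?case
      proof
        fix z assume z: "z \<in> K"
        then obtain c where c: "c \<in> C" "dist c z < d/2" using C(3) by auto
        then have "dist (f c) (F n z) < e/2" using elim z unfolding V_def by fastforce
        moreover have "dist (f z) (f c) < e/2"
          using d c z C(2) by (auto simp: dist_commute subset_iff)
        ultimately show "dist (F n z) (f z) < e"
          by (metis dist_commute dist_triangle_half_r)
      qed
    qed
  qed
  with f show ?R by blast
qed

lemma torus_param_measurable:
  "(\<lambda>t :: real ^ 'n. \<chi> j. cis (t $ j)) \<in> measurable borel (restrict_space borel torus)"
  by (intro measurable_restrict_space2 borel_measurable_continuous_onI continuous_on_vec_lambda
        continuous_intros)
     (auto simp: torus_def cis_conv_exp intro!: continuous_intros)

end

theory Submission
  imports Defs "HOL-Complex_Analysis.Conformal_Mappings"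
begin

text \<open>
  The automorphisms \<open>\<phi>\<^sub>k\<close> push the polydisk to its distinguished boundary: along a subsequence
  they converge, uniformly on compact sets, to a single point \<open>\<beta>\<close> of the torus
  (\<open>polydisk_aut_limit_point\<close>). The universal function is an infinite product of factors
  \<open>x\<^sub>j\<close>, each inner and continuous on the closed polydisk with \<open>x\<^sub>j(\<beta>) = 1\<close>, and each in charge
  of one target \<open>v\<^sub>j\<close> from a countable dense set of polynomials. Given the product \<open>X\<^sub>j\<close> of the
  earlier factors, one picks an automorphism \<open>\<phi>\<close> of the sequence that carries a large compact set
  so close to \<open>\<beta>\<close> that \<open>X\<^sub>j \<circ> \<phi> \<approx> 1\<close> on it, and then a factor \<open>x\<^sub>j\<close> with \<open>x\<^sub>j \<circ> \<phi> \<approx> v\<^sub>j\<close> on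
  that set while \<open>x\<^sub>j \<approx> 1\<close> on a compact set that contains everything used earlier
  (\<open>universal_factor\<close>). The product of all factors, composed with this automorphism, is then
  close to \<open>v\<^sub>j\<close>.

  The factor comes from the right half-plane, where \<open>T \<mapsto> 1 - 2/T\<close> carries \<open>Re T \<ge> 1\<close> into the
  unit disk and \<open>\<infinity>\<close> to \<open>1\<close>. With \<open>w = v\<^sub>j \<circ> \<phi>\<inverse>\<close> and \<open>M\<close> the product of the coordinates,
  \<open>T = 2/(1 - w) + C (1 - cnj M(\<beta>) M)\<close> has \<open>Re T \<ge> 1\<close>. The last summand is large away from the zero
  set of \<open>M - M(\<beta>)\<close>, which makes \<open>h = 1 - 2/T\<close> close to \<open>1\<close>, and small near \<open>\<beta>\<close>, which makes \<open>h\<close>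
  close to \<open>w\<close>.

  To replace \<open>h\<close> by an inner function, approximate it by a polynomial \<open>P\<close> with \<open>\<bar>P\<bar> < 1\<close> and
  let \<open>Q = M^N\<^sub>0 cnj P\<close> on the torus, which is again a polynomial (\<open>reflected_polynomial\<close>).
  Then \<open>x = (P + \<gamma> M^N) / (1 + \<gamma> M^(N - N\<^sub>0) Q)\<close> has modulus one on the torus, is close to \<open>P\<close> on
  compact subsets of the polydisk for large \<open>N\<close>, and takes the value \<open>1\<close> at \<open>\<beta>\<close> for a suitable
  unimodular \<open>\<gamma>\<close>. Polynomial approximation rests on discrete Fourier interpolation in
  one variable at a time (\<open>poly_approximable_separately_holomorphic\<close>).

  The delicate point is that the infinite product has radial limits of modulus one almost everywhere.
  The explicit form of \<open>x\<close> gives this without Fatou's theorem or maximal functions: on a radius that ends at \<open>\<zeta>\<close> and along which \<open>h \<approx> 1\<close>, the factor \<open>x\<close> stays close to \<open>1\<close> up to the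
  boundary unless \<open>\<gamma> M(\<zeta>)^N\<close> is close to \<open>-1\<close> (\<open>inner_approximation\<close>). By orthogonality of
  characters this happens on a set of small measure, with a bound independent of \<open>N\<close>
  (\<open>measure_resonant_set\<close>). So, by Borel--Cantelli, almost every radius sees only finitely many
  factors that differ appreciably from \<open>1\<close>, the product converges uniformly along that radius, and
  its modulus tends to \<open>1\<close> because that of every partial product does
  (\<open>inner_function_infinite_product\<close>).
\<close>

section \<open>Holomorphic functions on polydisks\<close>

lemma norm_le_sum_norm_nth: "norm z \<le> (\<Sum>j\<in>UNIV. norm (z $ j))" for z :: "complex ^ 'n"
  unfolding norm_vec_def by (rule L2_set_le_sum) auto

definition closed_polydisk :: "real \<Rightarrow> (complex ^ 'n) set" where
  "closed_polydisk r = {z. \<forall>j. norm (z $ j) \<le> r}"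

lemma compact_closed_polydisk: "compact (closed_polydisk r :: (complex ^ 'n) set)"
proof -
  have "closed (closed_polydisk r :: (complex ^ 'n) set)"
    unfolding closed_polydisk_def by (intro closed_Collect_all closed_Collect_le continuous_intros)
  moreover have "bounded (closed_polydisk r :: (complex ^ 'n) set)"
  proof (rule boundedI)
    fix z :: "complex ^ 'n" assume z: "z \<in> closed_polydisk r"
    have "norm z \<le> (\<Sum>j\<in>UNIV. norm (z $ j))" by (rule norm_le_sum_norm_nth)
    also have "\<dots> \<le> (\<Sum>j\<in>(UNIV::'n set). r)"
      using z by (intro sum_mono) (auto simp: closed_polydisk_def)
    finally show "norm z \<le> (\<Sum>j\<in>(UNIV::'n set). r)" .
  qed
  ultimately show ?thesis by (simp add: compact_eq_bounded_closed)
qed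

lemma polydisk_subset_closed: "polydisk \<subseteq> closed_polydisk 1"
  by (auto simp: polydisk_def closed_polydisk_def less_imp_le)

lemma closure_polydisk_subset: "closure polydisk \<subseteq> closed_polydisk 1"
  by (rule closure_minimal[OF polydisk_subset_closed])
     (simp add: compact_imp_closed compact_closed_polydisk)

lemma closed_polydisk_mono: "r \<le> s \<Longrightarrow> closed_polydisk r \<subseteq> closed_polydisk s"
  by (auto simp: closed_polydisk_def intro: order_trans)

lemma closed_polydisk_subset_polydisk: "r < 1 \<Longrightarrow> closed_polydisk r \<subseteq> polydisk"
  by (auto simp: closed_polydisk_def polydisk_def intro: le_less_trans)

lemma torus_subset_closed: "torus \<subseteq> closed_polydisk 1"
  by (auto simp: torus_def closed_polydisk_def)

lemma compact_subset_polydisk: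
  fixes K :: "(complex ^ 'n) set"
  assumes "compact K" "K \<subseteq> polydisk"
  obtains r where "0 \<le> r" "r < 1" "K \<subseteq> closed_polydisk r"
proof -
  have "\<exists>r. 0 \<le> r \<and> r < 1 \<and> (\<forall>z\<in>K. norm (z $ j) \<le> r)" for j
  proof (cases "K = {}")
    case False
    have "continuous_on K (\<lambda>z. norm (z $ j))" by (intro continuous_intros)
    then obtain z0 where "z0 \<in> K" "\<And>z. z \<in> K \<Longrightarrow> norm (z $ j) \<le> norm (z0 $ j)"
      using continuous_attains_sup[OF assms(1) False] by blast
    then show ?thesis using assms(2)
      by (intro exI[of _ "norm (z0 $ j)"]) (auto simp: polydisk_def)
  qed (auto intro: exI[of _ 0])
  then obtain r where r: "\<And>j. 0 \<le> r j" "\<And>j. r j < 1" "\<And>j z. z \<in> K \<Longrightarrow> norm (z $ j) \<le> r j"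
    by metis
  show ?thesis
  proof
    show "0 \<le> Max (range r)" by (rule order_trans[OF r(1) Max_ge]) auto
    show "Max (range r) < 1" using r(2) by (subst Max_less_iff) auto
    show "K \<subseteq> closed_polydisk (Max (range r))"
      unfolding closed_polydisk_def
    proof (intro subsetI CollectI allI)
      fix z j assume "z \<in> K"
      then show "norm (z $ j) \<le> Max (range r)"
        by (rule order_trans[OF r(3) Max_ge]) auto
    qed
  qed
qed

text \<open>Complex linearity of the derivative is a homogeneity condition. In this form the rules for
  sums, products, quotients and compositions follow from the real ones, with no gradients to
  compute.\<close>

lemma sv_holomorphic_on_iff:
  fixes f :: "complex ^ 'n \<Rightarrow> complex"
  shows "sv_holomorphic_on f S \<longleftrightarrow>
    (\<forall>z\<in>S. \<exists>D. (f has_derivative D) (at z) \<and> (\<forall>l h. D (l *s h) = l * D h))"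
proof -
  have "(\<exists>c. (f has_derivative (\<lambda>h. \<Sum>j\<in>UNIV. c $ j * h $ j)) (at z)) \<longleftrightarrow>
        (\<exists>D. (f has_derivative D) (at z) \<and> (\<forall>l h. D (l *s h) = l * D h))" for z
  proof
    assume "\<exists>c. (f has_derivative (\<lambda>h. \<Sum>j\<in>UNIV. c $ j * h $ j)) (at z)"
    then obtain c where "(f has_derivative (\<lambda>h. \<Sum>j\<in>UNIV. c $ j * h $ j)) (at z)" by blast
    moreover have "(\<Sum>j\<in>UNIV. c $ j * (l *s h) $ j) = l * (\<Sum>j\<in>UNIV. c $ j * h $ j)" for l h
      by (simp add: sum_distrib_left mult_ac)
    ultimately show "\<exists>D. (f has_derivative D) (at z) \<and> (\<forall>l h. D (l *s h) = l * D h)" by blast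
  next
    assume "\<exists>D. (f has_derivative D) (at z) \<and> (\<forall>l h. D (l *s h) = l * D h)"
    then obtain D where D: "(f has_derivative D) (at z)" "\<And>l h. D (l *s h) = l * D h" by blast
    have "linear D" using D(1) has_derivative_linear by blast
    have "D h = (\<Sum>j\<in>UNIV. (\<chi> j. D (axis j 1)) $ j * h $ j)" for h
    proof -
      have "D h = D (\<Sum>j\<in>UNIV. h $ j *s axis j 1)" by (simp add: basis_expansion)
      also have "\<dots> = (\<Sum>j\<in>UNIV. D (h $ j *s axis j 1))"
        by (rule linear_sum[OF \<open>linear D\<close>])
      finally show ?thesis by (simp add: D(2) mult.commute)
    qed
    then have "D = (\<lambda>h. \<Sum>j\<in>UNIV. (\<chi> j. D (axis j 1)) $ j * h $ j)" by blast
    then show "\<exists>c. (f has_derivative (\<lambda>h. \<Sum>j\<in>UNIV. c $ j * h $ j)) (at z)" using D(1) by metis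
  qed
  then show ?thesis unfolding sv_holomorphic_on_def by blast
qed

lemma sv_holomorphic_onI:
  assumes "\<And>z. z \<in> S \<Longrightarrow> \<exists>D. (f has_derivative D) (at z) \<and> (\<forall>l h. D (l *s h) = l * D h)"
  shows "sv_holomorphic_on f S"
  using assms by (simp add: sv_holomorphic_on_iff)

lemma sv_holomorphic_onE:
  assumes "sv_holomorphic_on f S" "z \<in> S"
  obtains D where "(f has_derivative D) (at z)" "\<And>l h. D (l *s h) = l * D h"
  using assms by (auto simp: sv_holomorphic_on_iff)

lemma sv_holomorphic_on_subset:
  "sv_holomorphic_on f T \<Longrightarrow> S \<subseteq> T \<Longrightarrow> sv_holomorphic_on f S"
  by (auto simp: sv_holomorphic_on_def)

lemma sv_holomorphic_on_continuous:
  "sv_holomorphic_on f S \<Longrightarrow> continuous_on S f"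
  by (meson continuous_at_imp_continuous_on has_derivative_continuous sv_holomorphic_on_def)

lemma sv_holomorphic_on_const: "sv_holomorphic_on (\<lambda>z. c) S"
  by (rule sv_holomorphic_onI, rule exI[of _ "\<lambda>h. 0"]) auto

lemma sv_holomorphic_on_nth: "sv_holomorphic_on (\<lambda>z. z $ j) S"
proof (rule sv_holomorphic_onI, rule exI[of _ "\<lambda>h. h $ j"], intro conjI allI)
  show "((\<lambda>z. z $ j) has_derivative (\<lambda>h. h $ j)) (at z)" for z :: "complex ^ 'a"
    by (rule bounded_linear.has_derivative[OF bounded_linear_vec_nth has_derivative_ident])
qed auto

lemma sv_holomorphic_on_add:
  assumes "sv_holomorphic_on f S" "sv_holomorphic_on g S"
  shows "sv_holomorphic_on (\<lambda>z. f z + g z) S"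
proof (rule sv_holomorphic_onI)
  fix z assume z: "z \<in> S"
  obtain D where D: "(f has_derivative D) (at z)" "\<And>l h. D (l *s h) = l * D h"
    using sv_holomorphic_onE[OF assms(1) z] by blast
  obtain E where E: "(g has_derivative E) (at z)" "\<And>l h. E (l *s h) = l * E h"
    using sv_holomorphic_onE[OF assms(2) z] by blast
  show "\<exists>D. ((\<lambda>z. f z + g z) has_derivative D) (at z) \<and> (\<forall>l h. D (l *s h) = l * D h)"
    by (rule exI, rule conjI, rule has_derivative_add[OF D(1) E(1)]) (simp add: D E algebra_simps)
qed

lemma sv_holomorphic_on_mult:
  assumes "sv_holomorphic_on f S" "sv_holomorphic_on g S"
  shows "sv_holomorphic_on (\<lambda>z. f z * g z) S"
proof (rule sv_holomorphic_onI)
  fix z assume z: "z \<in> S"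
  obtain D where D: "(f has_derivative D) (at z)" "\<And>l h. D (l *s h) = l * D h"
    using sv_holomorphic_onE[OF assms(1) z] by blast
  obtain E where E: "(g has_derivative E) (at z)" "\<And>l h. E (l *s h) = l * E h"
    using sv_holomorphic_onE[OF assms(2) z] by blast
  show "\<exists>D. ((\<lambda>z. f z * g z) has_derivative D) (at z) \<and> (\<forall>l h. D (l *s h) = l * D h)"
    by (rule exI, rule conjI, rule has_derivative_mult[OF D(1) E(1)]) (simp add: D E algebra_simps)
qed

lemma sv_holomorphic_on_inverse:
  assumes "sv_holomorphic_on f S" "\<And>z. z \<in> S \<Longrightarrow> f z \<noteq> 0"
  shows "sv_holomorphic_on (\<lambda>z. inverse (f z)) S"
proof (rule sv_holomorphic_onI)
  fix z assume z: "z \<in> S"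
  obtain D where D: "(f has_derivative D) (at z)" "\<And>l h. D (l *s h) = l * D h"
    using sv_holomorphic_onE[OF assms(1) z] by blast
  show "\<exists>D. ((\<lambda>z. inverse (f z)) has_derivative D) (at z) \<and> (\<forall>l h. D (l *s h) = l * D h)"
    by (rule exI, rule conjI, rule Deriv.has_derivative_inverse[OF assms(2)[OF z] D(1)])
       (simp add: D algebra_simps)
qed

lemma sv_holomorphic_on_divide:
  assumes "sv_holomorphic_on f S" "sv_holomorphic_on g S" "\<And>z. z \<in> S \<Longrightarrow> g z \<noteq> 0"
  shows "sv_holomorphic_on (\<lambda>z. f z / g z) S"
  using sv_holomorphic_on_mult[OF assms(1) sv_holomorphic_on_inverse[OF assms(2,3)]]
  by (simp add: divide_inverse)

lemma sv_holomorphic_on_diff: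
  assumes "sv_holomorphic_on f S" "sv_holomorphic_on g S"
  shows "sv_holomorphic_on (\<lambda>z. f z - g z) S"
  using sv_holomorphic_on_add[OF assms(1) sv_holomorphic_on_mult[OF sv_holomorphic_on_const[of "-1"] assms(2)]]
  by simp

lemma sv_holomorphic_on_power:
  "sv_holomorphic_on f S \<Longrightarrow> sv_holomorphic_on (\<lambda>z. f z ^ n) S"
  by (induction n) (auto intro: sv_holomorphic_on_const sv_holomorphic_on_mult)

lemma sv_holomorphic_on_prod:
  "finite I \<Longrightarrow> (\<And>i. i \<in> I \<Longrightarrow> sv_holomorphic_on (f i) S) \<Longrightarrow>
     sv_holomorphic_on (\<lambda>z. \<Prod>i\<in>I. f i z) S"
  by (induction I rule: finite_induct)
     (auto intro: sv_holomorphic_on_const sv_holomorphic_on_mult)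

lemmas sv_intros = sv_holomorphic_on_const sv_holomorphic_on_nth sv_holomorphic_on_add
  sv_holomorphic_on_mult sv_holomorphic_on_divide sv_holomorphic_on_diff sv_holomorphic_on_power
  sv_holomorphic_on_prod

lemma sum_axis: "(\<Sum>j\<in>UNIV. axis j (z $ j)) = (z :: 'a :: comm_monoid_add ^ 'n)"
  by (simp add: vec_eq_iff axis_def if_distrib cong: if_cong)

lemma bounded_linear_axis: "bounded_linear (axis j :: complex \<Rightarrow> complex ^ 'n)"
  by (rule linear_conv_bounded_linear[THEN iffD1], rule linearI) (auto simp: vec_eq_iff axis_def)

lemma sv_holomorphic_on_compose:
  fixes g :: "complex ^ 'm \<Rightarrow> complex ^ 'n"
  assumes "sv_holomorphic_on f T" "\<And>z. z \<in> S \<Longrightarrow> g z \<in> T"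
    and "\<And>j. sv_holomorphic_on (\<lambda>z. g z $ j) S"
  shows "sv_holomorphic_on (\<lambda>z. f (g z)) S"
proof (rule sv_holomorphic_onI)
  fix z assume z: "z \<in> S"
  have "\<exists>D. ((\<lambda>z. g z $ j) has_derivative D) (at z) \<and> (\<forall>l h. D (l *s h) = l * D h)" for j
    using assms(3)[of j] z by (auto simp: sv_holomorphic_on_iff)
  then obtain G where G: "\<And>j. ((\<lambda>z. g z $ j) has_derivative G j) (at z)"
      "\<And>j l h. G j (l *s h) = l * G j h" by metis
  obtain D where D: "(f has_derivative D) (at (g z))" "\<And>l h. D (l *s h) = l * D h"
    using sv_holomorphic_onE[OF assms(1) assms(2)[OF z]] by blast
  have "((\<lambda>z. \<Sum>j\<in>UNIV. axis j (g z $ j)) has_derivative (\<lambda>h. \<Sum>j\<in>UNIV. axis j (G j h))) (at z)"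
    by (rule has_derivative_sum, rule bounded_linear.has_derivative[OF bounded_linear_axis G(1)])
  then have "(g has_derivative (\<lambda>h. \<chi> j. G j h)) (at z)"
    using sum_axis[of "\<chi> j. G j h" for h] by (simp add: sum_axis)
  from has_derivative_compose[OF this D(1)]
  have "((\<lambda>z. f (g z)) has_derivative (\<lambda>h. D (\<chi> j. G j h))) (at z)" .
  moreover have "(\<chi> j. G j (l *s h)) = l *s (\<chi> j. G j h)" for l h by (simp add: vec_eq_iff G)
  ultimately show "\<exists>D. ((\<lambda>z. f (g z)) has_derivative D) (at z) \<and> (\<forall>l h. D (l *s h) = l * D h)"
    by (intro exI[of _ "\<lambda>h. D (\<chi> j. G j h)"]) (simp add: D(2))
qed

definition slice :: "complex ^ 'n \<Rightarrow> 'n \<Rightarrow> complex \<Rightarrow> complex ^ 'n" where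
  "slice z j w = (\<chi> i. if i = j then w else z $ i)"

lemma slice_nth: "slice z j w $ i = (if i = j then w else z $ i)"
  by (simp add: slice_def)

lemma slice_self [simp]: "slice z j (z $ j) = z"
  by (simp add: slice_def vec_eq_iff)

lemma slice_has_derivative: "(slice z j has_derivative axis j) (at w within A)"
proof -
  have "slice z j = (\<lambda>w. slice z j 0 + axis j w)"
    by (auto simp: slice_def axis_def vec_eq_iff fun_eq_iff)
  moreover have "((\<lambda>w. slice z j 0 + axis j w) has_derivative (\<lambda>h. 0 + axis j h)) (at w within A)"
    by (intro has_derivative_add has_derivative_const
        bounded_linear.has_derivative[OF bounded_linear_axis has_derivative_ident])
  ultimately show ?thesis by simp
qed

lemma sv_slice_field_derivative:
  assumes "(f has_derivative (\<lambda>h. \<Sum>j\<in>UNIV. c $ j * h $ j)) (at (slice z j w))"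
  shows "((\<lambda>w. f (slice z j w)) has_field_derivative c $ j) (at w)"
proof -
  have "((\<lambda>w. f (slice z j w)) has_derivative (\<lambda>h. \<Sum>i\<in>UNIV. c $ i * axis j h $ i)) (at w)"
    by (rule has_derivative_compose[OF slice_has_derivative assms])
  moreover have "(\<Sum>i\<in>UNIV. c $ i * axis j h $ i) = c $ j * h" for h
    by (simp add: axis_def if_distrib cong: if_cong)
  ultimately show ?thesis by (simp add: has_field_derivative_def)
qed

lemma sv_slice_holomorphic:
  assumes "sv_holomorphic_on f S" "\<And>w. w \<in> A \<Longrightarrow> slice z j w \<in> S"
  shows "(\<lambda>w. f (slice z j w)) holomorphic_on A"
  unfolding holomorphic_on_def
proof
  fix w assume "w \<in> A"
  then obtain c where "(f has_derivative (\<lambda>h. \<Sum>i\<in>UNIV. c $ i * h $ i)) (at (slice z j w))"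
    using assms unfolding sv_holomorphic_on_def by blast
  then show "(\<lambda>w. f (slice z j w)) field_differentiable at w within A"
    using sv_slice_field_derivative field_differentiable_def field_differentiable_at_within by blast
qed

text \<open>The one-variable maximum principle moves one coordinate at a time to the unit circle; the
  induction is over the set of coordinates that may still lie inside the disk.\<close>

lemma maximum_modulus_closed_polydisk:
  fixes f :: "complex ^ 'n \<Rightarrow> complex"
  assumes f: "sv_holomorphic_on f (closed_polydisk 1)"
    and B: "\<And>z. z \<in> torus \<Longrightarrow> norm (f z) \<le> B"
    and z: "z \<in> closed_polydisk 1"
  shows "norm (f z) \<le> B"
proof -
  have "\<forall>z\<in>closed_polydisk 1. (\<forall>j. j \<notin> J \<longrightarrow> norm (z $ j) = 1) \<longrightarrow> norm (f z) \<le> B"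
    if "finite J" for J
    using that
  proof (induction J)
    case empty
    then show ?case using B by (auto simp: torus_def)
  next
    case (insert j J)
    show ?case
    proof (intro ballI impI)
      fix z :: "complex ^ 'n"
      assume z: "z \<in> closed_polydisk 1" "\<forall>i. i \<notin> insert j J \<longrightarrow> norm (z $ i) = 1"
      have hol: "(\<lambda>w. f (slice z j w)) holomorphic_on cball 0 1"
        by (rule sv_slice_holomorphic[OF f]) (use z in \<open>auto simp: closed_polydisk_def slice_nth\<close>)
      have "norm (f (slice z j (z $ j))) \<le> B"
      proof (rule maximum_modulus_frontier[where S = "cball 0 1" and f = "\<lambda>w. f (slice z j w)"])
        show "(\<lambda>w. f (slice z j w)) holomorphic_on interior (cball 0 1)"
          using hol by (rule holomorphic_on_subset) auto
        show "continuous_on (closure (cball 0 1)) (\<lambda>w. f (slice z j w))"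
          using holomorphic_on_imp_continuous_on[OF hol] by simp
        show "norm (f (slice z j w)) \<le> B" if "w \<in> frontier (cball 0 1)" for w
          using insert.IH z that by (auto simp: closed_polydisk_def slice_nth)
      qed (use z in \<open>auto simp: closed_polydisk_def\<close>)
      then show "norm (f z) \<le> B" by simp
    qed
  qed
  from this[of UNIV] z show ?thesis by auto
qed

section \<open>Locally uniform limits\<close>

text \<open>Cauchy's estimate on one-variable slices turns locally uniform convergence of the functions
  into locally uniform convergence of their gradients, so differentiation passes to the limit.\<close>

lemma uniform_limit_sv_holomorphic:
  fixes F :: "nat \<Rightarrow> complex ^ 'n \<Rightarrow> complex"
  assumes F: "\<And>n. sv_holomorphic_on (F n) polydisk"
    and lim: "\<And>r. r < 1 \<Longrightarrow> uniform_limit (closed_polydisk r) F f sequentially"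
  shows "sv_holomorphic_on f polydisk"
  unfolding sv_holomorphic_on_def
proof
  fix z0 :: "complex ^ 'n" assume "z0 \<in> polydisk"
  then obtain r0 where r0: "0 \<le> r0" "r0 < 1" "{z0} \<subseteq> closed_polydisk r0"
    by (metis compact_sing compact_subset_polydisk empty_subsetI insert_subset)
  \<comment> \<open>The gradients converge on radius \<open>r\<close>; the slack \<open>s - r\<close> is the radius of the Cauchy estimate.\<close>
  define r where "r = (r0 + 1) / 2"
  define s where "s = (r + 1) / 2"
  have r: "r0 < r" "r < s" "s < 1" using r0 by (auto simp: r_def s_def)
  define S :: "(complex ^ 'n) set" where "S = {z. \<forall>j. norm (z $ j) < r}"
  have z0S: "z0 \<in> S" using r0 r by (auto simp: S_def closed_polydisk_def intro: le_less_trans)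
  have S_sub: "S \<subseteq> polydisk" using r by (auto simp: S_def polydisk_def intro: less_trans)
  have S_eq: "S = (\<Inter>j. {z. norm (z $ j) < r})" by (auto simp: S_def)
  have "open S"
  proof -
    have "open {z :: complex ^ 'n. norm (z $ j) < r}" for j
      by (intro open_Collect_less continuous_intros)
    then show ?thesis using S_eq by (metis open_INT finite_class.finite_UNIV)
  qed
  have "convex S"
  proof -
    have "convex {z :: complex ^ 'n. norm (z $ j) < r}" for j
    proof -
      have "{z :: complex ^ 'n. norm (z $ j) < r} = (\<lambda>z. z $ j) -` ball 0 r" by auto
      then show ?thesis
        by (simp add: convex_linear_vimage bounded_linear.linear[OF bounded_linear_vec_nth])
    qed
    then show ?thesis unfolding S_eq by (rule convex_INT)
  qed
  have "\<forall>n z. \<exists>c. z \<in> polydisk \<longrightarrow>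
      (F n has_derivative (\<lambda>h. \<Sum>j\<in>UNIV. c $ j * h $ j)) (at z)"
    using F unfolding sv_holomorphic_on_def by blast
  then obtain c :: "nat \<Rightarrow> complex ^ 'n \<Rightarrow> complex ^ 'n" where c:
    "\<And>n z. z \<in> polydisk \<Longrightarrow> (F n has_derivative (\<lambda>h. \<Sum>j\<in>UNIV. c n z $ j * h $ j)) (at z)"
    by metis
  have Cauchy_bound: "norm (c m z $ j - c n z $ j) \<le> e / (s - r)"
    if z: "z \<in> S" and e: "\<And>z. z \<in> closed_polydisk s \<Longrightarrow> norm (F m z - F n z) \<le> e" for m n z j e
  proof -
    define g where "g = (\<lambda>w. F m (slice z j w) - F n (slice z j w))"
    have in_s: "slice z j w \<in> closed_polydisk s" if w: "w \<in> cball (z $ j) (s - r)" for w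
    proof -
      have "norm w \<le> norm (z $ j) + dist (z $ j) w"
        by (metis dist_commute dist_norm norm_triangle_sub)
      then have "norm w \<le> s" using w z by (auto simp: S_def dest!: spec[of _ j])
      then show ?thesis using z r by (auto simp: closed_polydisk_def slice_nth S_def intro: less_imp_le less_trans)
    qed
    have in_p: "slice z j w \<in> polydisk" if w: "w \<in> cball (z $ j) (s - r)" for w
      using in_s[OF w] closed_polydisk_subset_polydisk r(3) by blast
    have hol: "g holomorphic_on cball (z $ j) (s - r)"
      unfolding g_def
      by (intro holomorphic_on_diff sv_slice_holomorphic[OF F] in_p)
    have "norm ((deriv ^^ 1) g (z $ j)) \<le> fact 1 * e / (s - r) ^ 1"
    proof (rule Cauchy_inequality)
      show "g holomorphic_on ball (z $ j) (s - r)"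
        using hol by (rule holomorphic_on_subset) auto
      show "continuous_on (cball (z $ j) (s - r)) g"
        using hol by (rule holomorphic_on_imp_continuous_on)
      show "0 < s - r" using r by simp
      show "norm (g w) \<le> e" if "norm (z $ j - w) = s - r" for w
        unfolding g_def using that by (intro e in_s) (auto simp: dist_norm)
    qed
    moreover have "(g has_field_derivative (c m z $ j - c n z $ j)) (at (z $ j))"
      unfolding g_def using z S_sub
      by (intro DERIV_diff sv_slice_field_derivative) (auto intro!: c)
    ultimately show ?thesis by (simp add: DERIV_imp_deriv)
  qed
  have "uniformly_Cauchy_on S (\<lambda>n z. c n z $ j)" for j
    unfolding uniformly_Cauchy_on_def
  proof (intro allI impI)
    fix e :: real assume e: "e > 0"
    have "uniformly_Cauchy_on (closed_polydisk s) F"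
      using lim[OF r(3)] uniformly_convergent_Cauchy uniformly_convergent_on_def by blast
    moreover have "e / 2 * (s - r) > 0" using e r by simp
    ultimately obtain M where M: "\<And>z m n. z \<in> closed_polydisk s \<Longrightarrow> m \<ge> M \<Longrightarrow> n \<ge> M \<Longrightarrow>
        dist (F m z) (F n z) < e / 2 * (s - r)"
      unfolding uniformly_Cauchy_on_def by blast
    have "dist (c m z $ j) (c n z $ j) < e" if "z \<in> S" "m \<ge> M" "n \<ge> M" for z m n
    proof -
      have "norm (c m z $ j - c n z $ j) \<le> e / 2 * (s - r) / (s - r)"
        by (rule Cauchy_bound[OF that(1)]) (use M that in \<open>auto simp: dist_norm less_imp_le\<close>)
      also have "\<dots> = e / 2" by (rule nonzero_mult_div_cancel_right) (use r in simp)
      also have "\<dots> < e" using e by simp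
      finally show ?thesis by (simp add: dist_norm)
    qed
    then show "\<exists>M. \<forall>x\<in>S. \<forall>m\<ge>M. \<forall>n\<ge>M. dist (c m x $ j) (c n x $ j) < e" by blast
  qed
  then have "\<exists>g. uniform_limit S (\<lambda>n z. c n z $ j) g sequentially" for j
    using Cauchy_uniformly_convergent uniformly_convergent_on_def by blast
  then obtain g where g: "\<And>j. uniform_limit S (\<lambda>n z. c n z $ j) (g j) sequentially" by metis
  have z0lim: "(\<lambda>n. F n z) \<longlonglongrightarrow> f z" if "z \<in> S" for z
    by (rule tendsto_uniform_limitI[OF lim[OF r(3)]])
       (use that r in \<open>auto simp: S_def closed_polydisk_def intro: less_imp_le less_trans\<close>)
  have "\<exists>G. \<forall>z\<in>S. (\<lambda>n. F n z) \<longlonglongrightarrow> G z \<and>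
      (G has_derivative (\<lambda>h. \<Sum>j\<in>UNIV. (\<chi> j. g j z) $ j * h $ j)) (at z within S)"
  proof (rule has_derivative_sequence[where f' = "\<lambda>n z h. \<Sum>j\<in>UNIV. c n z $ j * h $ j"])
    show "convex S" "z0 \<in> S" "(\<lambda>n. F n z0) \<longlonglongrightarrow> f z0" using \<open>convex S\<close> z0S z0lim[OF z0S] by auto
  next
    show "(F n has_derivative (\<lambda>h. \<Sum>j\<in>UNIV. c n z $ j * h $ j)) (at z within S)" if "z \<in> S" for n z
      using c that S_sub by (blast intro: has_derivative_at_withinI)
  next
    fix e :: real assume e: "e > 0"
    define d where "d = e / CARD('n)"
    have d: "d > 0" using e by (simp add: d_def)
    have "\<forall>\<^sub>F n in sequentially. \<forall>j. \<forall>z\<in>S. dist (c n z $ j) (g j z) < d"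
      using g d unfolding uniform_limit_iff by (simp add: eventually_all_finite)
    then show "\<forall>\<^sub>F n in sequentially. \<forall>z\<in>S. \<forall>h. norm ((\<Sum>j\<in>UNIV. c n z $ j * h $ j) -
        (\<Sum>j\<in>UNIV. (\<chi> j. g j z) $ j * h $ j)) \<le> e * norm h"
    proof eventually_elim
      case (elim n)
      show ?case
      proof (intro ballI allI)
        fix z h assume z: "z \<in> S"
        have "norm ((\<Sum>j\<in>UNIV. c n z $ j * h $ j) - (\<Sum>j\<in>UNIV. (\<chi> j. g j z) $ j * h $ j))
            = norm (\<Sum>j\<in>UNIV. (c n z $ j - g j z) * h $ j)"
          by (simp add: sum_subtractf left_diff_distrib)
        also have "\<dots> \<le> (\<Sum>j\<in>(UNIV :: 'n set). d * norm h)"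
        proof (rule sum_norm_le)
          fix j
          have "norm (c n z $ j - g j z) \<le> d" using elim z by (auto simp: dist_norm less_imp_le)
          then show "norm ((c n z $ j - g j z) * h $ j) \<le> d * norm h"
            unfolding norm_mult by (intro mult_mono) (use d in \<open>auto simp: Finite_Cartesian_Product.norm_nth_le\<close>)
        qed
        also have "\<dots> = e * norm h" by (simp add: d_def)
        finally show "norm ((\<Sum>j\<in>UNIV. c n z $ j * h $ j) -
            (\<Sum>j\<in>UNIV. (\<chi> j. g j z) $ j * h $ j)) \<le> e * norm h" .
      qed
    qed
  qed
  then obtain G where G: "\<And>z. z \<in> S \<Longrightarrow> (\<lambda>n. F n z) \<longlonglongrightarrow> G z"
    "\<And>z. z \<in> S \<Longrightarrow> (G has_derivative (\<lambda>h. \<Sum>j\<in>UNIV. (\<chi> j. g j z) $ j * h $ j)) (at z within S)"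
    by blast
  have eq: "G z = f z" if "z \<in> S" for z using G(1) z0lim that LIMSEQ_unique by blast
  have "(G has_derivative (\<lambda>h. \<Sum>j\<in>UNIV. (\<chi> j. g j z0) $ j * h $ j)) (at z0)"
    using G(2)[OF z0S] at_within_open[OF z0S \<open>open S\<close>] by simp
  then have "(f has_derivative (\<lambda>h. \<Sum>j\<in>UNIV. (\<chi> j. g j z0) $ j * h $ j)) (at z0)"
    by (rule has_derivative_transform_within_open[OF _ \<open>open S\<close> z0S eq])
  then show "\<exists>c. (f has_derivative (\<lambda>h. \<Sum>j\<in>UNIV. c $ j * h $ j)) (at z0)" by blast
qed

section \<open>Approximation by polynomials with rational coefficients\<close>

text \<open>Rational coefficients keep the set of polynomials countable, which supplies a countable dense set
  of targets.\<close>

datatype 'n poly_expr = Coeff rat rat | Coord 'n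
  | Plus "'n poly_expr" "'n poly_expr" | Times "'n poly_expr" "'n poly_expr"

instance poly_expr :: (countable) countable
  by countable_datatype

primrec eval_poly :: "'n poly_expr \<Rightarrow> complex ^ 'n \<Rightarrow> complex" where
  "eval_poly (Coeff a b) z = Complex (of_rat a) (of_rat b)"
| "eval_poly (Coord j) z = z $ j"
| "eval_poly (Plus p q) z = eval_poly p z + eval_poly q z"
| "eval_poly (Times p q) z = eval_poly p z * eval_poly q z"

lemma sv_holomorphic_on_eval_poly: "sv_holomorphic_on (eval_poly p) S"
  by (induction p) (auto simp: fun_eq_iff[symmetric] intro: sv_intros)

lemma eval_poly_bounded: "\<exists>B>0. \<forall>z\<in>closed_polydisk 1. norm (eval_poly p z) \<le> B"
proof -
  have "compact (eval_poly p ` closed_polydisk 1)"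
    by (intro compact_continuous_image compact_closed_polydisk sv_holomorphic_on_continuous
        sv_holomorphic_on_eval_poly)
  from compact_imp_bounded[OF this] show ?thesis by (auto simp: bounded_pos)
qed

text \<open>The class of functions that are uniform limits, on the closed polydisk, of rational polynomials.
  It is a uniformly closed algebra, so a function can be shown to lie in it without exhibiting any
  polynomial.\<close>

definition poly_approximable :: "(complex ^ 'n \<Rightarrow> complex) \<Rightarrow> bool" where
  "poly_approximable f \<longleftrightarrow>
     (\<forall>e>0. \<exists>p. \<forall>z\<in>closed_polydisk 1. norm (eval_poly p z - f z) < e)"

lemma poly_approximable_uniform_limit:
  assumes "\<And>e. e > 0 \<Longrightarrow> \<exists>g. poly_approximable g \<and> (\<forall>z\<in>closed_polydisk 1. norm (g z - f z) \<le> e)"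
  shows "poly_approximable f"
  unfolding poly_approximable_def
proof (intro allI impI)
  fix e :: real assume e: "e > 0"
  then obtain g where g: "poly_approximable g" "\<And>z. z \<in> closed_polydisk 1 \<Longrightarrow> norm (g z - f z) \<le> e / 2"
    using assms[of "e / 2"] by auto
  obtain p where p: "\<And>z. z \<in> closed_polydisk 1 \<Longrightarrow> norm (eval_poly p z - g z) < e / 2"
    using g(1) e unfolding poly_approximable_def by (meson half_gt_zero)
  have "norm (eval_poly p z - f z) < e" if "z \<in> closed_polydisk 1" for z
    using g(2)[OF that] p[OF that] norm_triangle_ineq[of "eval_poly p z - g z" "g z - f z"] by simp
  then show "\<exists>p. \<forall>z\<in>closed_polydisk 1. norm (eval_poly p z - f z) < e" by blast
qed

lemma poly_approximable_cong:
  "poly_approximable g \<Longrightarrow> (\<And>z. z \<in> closed_polydisk 1 \<Longrightarrow> g z = f z) \<Longrightarrow> poly_approximable f"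
  unfolding poly_approximable_def by simp

lemma poly_approximable_eval: "poly_approximable (eval_poly p)"
  unfolding poly_approximable_def by (auto intro!: exI[of _ p])

lemma poly_approximable_const: "poly_approximable (\<lambda>z. c)"
  unfolding poly_approximable_def
proof (intro allI impI)
  fix e :: real assume e: "e > 0"
  obtain a b where a: "\<bar>of_rat a - Re c\<bar> < e / 2" and b: "\<bar>of_rat b - Im c\<bar> < e / 2"
  proof -
    obtain a where "Re c - e/2 < of_rat a" "of_rat a < Re c + e/2"
      using of_rat_dense[of "Re c - e/2" "Re c + e/2"] e by auto
    moreover obtain b where "Im c - e/2 < of_rat b" "of_rat b < Im c + e/2"
      using of_rat_dense[of "Im c - e/2" "Im c + e/2"] e by auto
    ultimately show ?thesis by (intro that[of a b]) (auto simp: abs_if)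
  qed
  have "norm (Complex (of_rat a) (of_rat b) - c) < e"
    using cmod_le[of "Complex (of_rat a) (of_rat b) - c"] a b by simp
  then show "\<exists>p. \<forall>z\<in>closed_polydisk 1. norm (eval_poly p z - c) < e"
    by (intro exI[of _ "Coeff a b"]) auto
qed

lemma poly_approximable_add:
  assumes "poly_approximable f" "poly_approximable g"
  shows "poly_approximable (\<lambda>z. f z + g z)"
  unfolding poly_approximable_def
proof (intro allI impI)
  fix e :: real assume e: "e > 0"
  obtain p where p: "\<And>z. z \<in> closed_polydisk 1 \<Longrightarrow> norm (eval_poly p z - f z) < e / 2"
    using assms(1) e unfolding poly_approximable_def by (meson half_gt_zero)
  obtain q where q: "\<And>z. z \<in> closed_polydisk 1 \<Longrightarrow> norm (eval_poly q z - g z) < e / 2"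
    using assms(2) e unfolding poly_approximable_def by (meson half_gt_zero)
  have "norm (eval_poly (Plus p q) z - (f z + g z)) < e" if "z \<in> closed_polydisk 1" for z
    using p[OF that] q[OF that] norm_triangle_ineq[of "eval_poly p z - f z" "eval_poly q z - g z"]
    by (simp add: algebra_simps)
  then show "\<exists>p. \<forall>z\<in>closed_polydisk 1. norm (eval_poly p z - (f z + g z)) < e" by blast
qed

lemma poly_approximable_bounded:
  assumes "poly_approximable f"
  shows "\<exists>B>0. \<forall>z\<in>closed_polydisk 1. norm (f z) \<le> B"
proof -
  obtain p where p: "\<And>z. z \<in> closed_polydisk 1 \<Longrightarrow> norm (eval_poly p z - f z) < 1"
    using assms unfolding poly_approximable_def by (meson zero_less_one)
  obtain B where B: "B > 0" "\<And>z. z \<in> closed_polydisk 1 \<Longrightarrow> norm (eval_poly p z) \<le> B"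
    using eval_poly_bounded by metis
  have "norm (f z) \<le> B + 1" if "z \<in> closed_polydisk 1" for z
    using p[OF that] B(2)[OF that] norm_triangle_ineq4[of "eval_poly p z" "eval_poly p z - f z"] by simp
  then show ?thesis using B(1) by (intro exI[of _ "B + 1"]) auto
qed

lemma poly_approximable_mult:
  assumes "poly_approximable f" "poly_approximable g"
  shows "poly_approximable (\<lambda>z. f z * g z)"
proof -
  obtain B where B: "B > 0" "\<And>z. z \<in> closed_polydisk 1 \<Longrightarrow> norm (g z) \<le> B"
    using poly_approximable_bounded[OF assms(2)] by metis
  have poly_mult: "poly_approximable (\<lambda>z. eval_poly p z * g z)" for p
    unfolding poly_approximable_def
  proof (intro allI impI)
    fix e :: real assume e: "e > 0"
    obtain C where C: "C > 0" "\<And>z. z \<in> closed_polydisk 1 \<Longrightarrow> norm (eval_poly p z) \<le> C"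
      using eval_poly_bounded by metis
    have "e / C > 0" using e C by simp
    then obtain q where q: "\<And>z. z \<in> closed_polydisk 1 \<Longrightarrow> norm (eval_poly q z - g z) < e / C"
      using assms(2) unfolding poly_approximable_def by meson
    have "norm (eval_poly (Times p q) z - eval_poly p z * g z) < e" if z: "z \<in> closed_polydisk 1" for z
    proof -
      have "norm (eval_poly (Times p q) z - eval_poly p z * g z)
          = norm (eval_poly p z) * norm (eval_poly q z - g z)"
        by (simp add: norm_mult[symmetric] algebra_simps)
      also have "\<dots> \<le> C * norm (eval_poly q z - g z)"
        by (intro mult_right_mono C z) auto
      also have "\<dots> < C * (e / C)" by (intro mult_strict_left_mono q z C)
      also have "\<dots> = e" using C by simp
      finally show ?thesis .
    qed
    then show "\<exists>r. \<forall>z\<in>closed_polydisk 1. norm (eval_poly r z - eval_poly p z * g z) < e" by blast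
  qed
  show ?thesis
  proof (rule poly_approximable_uniform_limit)
    fix e :: real assume "e > 0"
    then have "e / B > 0" using B by simp
    then obtain p where p: "\<And>z. z \<in> closed_polydisk 1 \<Longrightarrow> norm (eval_poly p z - f z) < e / B"
      using assms(1) unfolding poly_approximable_def by meson
    have "norm (eval_poly p z * g z - f z * g z) \<le> e" if z: "z \<in> closed_polydisk 1" for z
    proof -
      have "norm (eval_poly p z * g z - f z * g z) = norm (eval_poly p z - f z) * norm (g z)"
        by (simp add: norm_mult[symmetric] algebra_simps)
      also have "\<dots> \<le> e / B * B"
        by (intro mult_mono B z less_imp_le[OF p]) (use \<open>e / B > 0\<close> in auto)
      finally show ?thesis using B by simp
    qed
    with poly_mult show "\<exists>h. poly_approximable h \<and>
        (\<forall>z\<in>closed_polydisk 1. norm (h z - f z * g z) \<le> e)" by blast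
  qed
qed

lemma poly_approximable_power: "poly_approximable f \<Longrightarrow> poly_approximable (\<lambda>z. f z ^ k)"
  by (induction k) (auto intro: poly_approximable_const poly_approximable_mult)

lemma poly_approximable_sum:
  "finite I \<Longrightarrow> (\<And>i. i \<in> I \<Longrightarrow> poly_approximable (f i)) \<Longrightarrow> poly_approximable (\<lambda>z. \<Sum>i\<in>I. f i z)"
  by (induction I rule: finite_induct)
     (auto intro: poly_approximable_const poly_approximable_add)

lemma poly_approximable_nth: "poly_approximable (\<lambda>z. z $ j)"
  by (rule poly_approximable_cong[OF poly_approximable_eval[of "Coord j"]]) simp

text \<open>The polynomial of degree below \<open>L\<close> that agrees with \<open>g\<close> at the \<open>L\<close>-th roots of unity. Its
  coefficients are Riemann sums for the Taylor coefficients. For a function of several variables,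
  interpolated in one of them, they are finite combinations of slices: they stay holomorphic in the
  remaining variables and no integral has to be differentiated.\<close>

definition root_interp :: "nat \<Rightarrow> (complex \<Rightarrow> complex) \<Rightarrow> complex \<Rightarrow> complex" where
  "root_interp L g z =
     (\<Sum>k<L. z ^ k * ((\<Sum>t<L. g (cis (2 * pi * real t / real L)) * cis (- (2 * pi * real t * real k / real L))) / L))"

lemma sum_roots_unity:
  assumes "0 < L" "m < L" "k < L"
  shows "(\<Sum>t<L. cis (2 * pi * real t / real L) ^ m * cis (- (2 * pi * real t * real k / real L))) = (if m = k then of_nat L else 0)"
proof -
  define w where "w = cis (2 * pi * (real m - real k) / real L)"
  have summand: "cis (2 * pi * real t / real L) ^ m * cis (- (2 * pi * real t * real k / real L)) = w ^ t" for t :: nat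
    by (simp add: w_def Complex.DeMoivre cis_mult algebra_simps diff_divide_distrib)
  show ?thesis
  proof (cases "m = k")
    case True
    then show ?thesis unfolding summand by (simp add: w_def)
  next
    case False
    have "w \<noteq> 1"
    proof
      assume "w = 1"
      then have "cos (2 * pi * (real m - real k) / real L) = 1"
        by (simp add: w_def complex_eq_iff)
      then obtain i :: int where i: "2 * pi * (real m - real k) / real L = of_int i * 2 * pi"
        by (auto simp: cos_one_2pi_int)
      then have "2 * pi * (real m - real k) = 2 * pi * (of_int i * real L)"
        using assms(1) by (simp add: field_simps)
      then have "real m - real k = of_int i * real L" by (subst (asm) mult_cancel_left) simp
      then have "of_int (int m - int k) = (of_int (i * int L) :: real)" by simp
      then have eq: "int m - int k = i * int L" using of_int_eq_iff by blast
      have "\<bar>int m - int k\<bar> < int L" using assms by auto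
      then have "\<bar>i\<bar> * int L < 1 * int L" using eq by (simp add: abs_mult)
      then have "i = 0" using assms(1) by (simp only: mult_less_cancel_right) auto
      then show False using eq False by simp
    qed
    moreover have "w ^ L = 1"
    proof -
      have "w ^ L = cis (2 * pi * (real m - real k))"
        using assms(1) by (simp add: w_def Complex.DeMoivre)
      also have "\<dots> = cis (2 * pi * m) / cis (2 * pi * k)"
        by (simp add: cis_divide algebra_simps)
      finally show ?thesis by (simp add: cis_multiple_2pi)
    qed
    ultimately show ?thesis unfolding summand using False by (simp add: geometric_sum)
  qed
qed

lemma root_interp_poly:
  assumes "0 < L"
  shows "root_interp L (\<lambda>w. \<Sum>m<L. a m * w ^ m) z = (\<Sum>m<L. a m * z ^ m)"
proof -
  have "(\<Sum>t<L. (\<Sum>m<L. a m * cis (2 * pi * real t / real L) ^ m) * cis (- (2 * pi * real t * real k / real L))) / L = a k"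
    if k: "k < L" for k
  proof -
    have "(\<Sum>t<L. (\<Sum>m<L. a m * cis (2 * pi * real t / real L) ^ m) * cis (- (2 * pi * real t * real k / real L)))
        = (\<Sum>t<L. \<Sum>m<L. a m * (cis (2 * pi * real t / real L) ^ m * cis (- (2 * pi * real t * real k / real L))))"
      by (simp add: sum_distrib_right mult.assoc)
    also have "\<dots> = (\<Sum>m<L. \<Sum>t<L. a m * (cis (2 * pi * real t / real L) ^ m * cis (- (2 * pi * real t * real k / real L))))"
      by (rule sum.swap)
    also have "\<dots> = (\<Sum>m<L. a m * (if m = k then of_nat L else 0))"
      by (simp only: sum_distrib_left[symmetric])
         (intro sum.cong refl, simp only: sum_roots_unity[OF assms _ k] lessThan_iff)
    also have "\<dots> = a k * of_nat L" using k by (simp add: if_distrib cong: if_cong)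
    finally show ?thesis using assms by simp
  qed
  then show ?thesis unfolding root_interp_def by (intro sum.cong) (auto simp: mult.commute)
qed

lemma root_interp_diff:
  "root_interp L (\<lambda>w. f w - g w) z = root_interp L f z - root_interp L g z"
  unfolding root_interp_def
  by (simp add: sum_subtractf[symmetric] diff_divide_distrib[symmetric] right_diff_distrib[symmetric]
      left_diff_distrib)

lemma root_interp_bound:
  assumes L: "0 < L" and g: "\<And>w. norm w = 1 \<Longrightarrow> norm (g w) \<le> B" and z: "norm z \<le> 1"
  shows "norm (root_interp L g z) \<le> L * B"
proof -
  have B: "B \<ge> 0" using g[of 1] norm_ge_zero order_trans by (metis norm_one)
  have "norm (root_interp L g z) \<le> (\<Sum>k<L. B)"
    unfolding root_interp_def
  proof (rule sum_norm_le)
    fix k assume "k \<in> {..<L}"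
    have "norm (\<Sum>t<L. g (cis (2 * pi * real t / real L)) * cis (- (2 * pi * real t * real k / real L))) \<le> (\<Sum>t<L. B)"
      by (rule sum_norm_le) (simp add: norm_mult g)
    then have "norm ((\<Sum>t<L. g (cis (2 * pi * real t / real L)) * cis (- (2 * pi * real t * real k / real L))) / L) \<le> B"
      using L by (simp add: norm_divide field_simps)
    then have "norm (z ^ k) * norm ((\<Sum>t<L. g (cis (2 * pi * real t / real L)) * cis (- (2 * pi * real t * real k / real L))) / L) \<le> 1 * B"
      by (intro mult_mono) (use z in \<open>auto simp: norm_power power_le_one\<close>)
    then show "norm (z ^ k * ((\<Sum>t<L. g (cis (2 * pi * real t / real L)) * cis (- (2 * pi * real t * real k / real L))) / of_nat L)) \<le> B"
      by (simp only: norm_mult mult_1)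
  qed
  then show ?thesis by simp
qed

text \<open>Interpolation reproduces the Taylor polynomial of degree below \<open>L\<close> and enlarges the remainder by
  a factor of at most \<open>L\<close>, whereas Cauchy's estimate makes that remainder geometrically small. The
  bound depends on \<open>g\<close> only through \<open>B\<close>, hence is uniform in the other variables.\<close>

lemma root_interp_error:
  fixes g :: "complex \<Rightarrow> complex"
  assumes L: "0 < L" and r: "1 < r" and hol: "g holomorphic_on cball 0 r"
    and B: "\<And>w. norm w = r \<Longrightarrow> norm (g w) \<le> B" and z: "norm z \<le> 1"
  shows "norm (root_interp L g z - g z) \<le> (real L + 1) * (B * (1 / r) ^ L / (1 - 1 / r))"
proof -
  define a where "a m = (deriv ^^ m) g 0 / fact m" for m
  define T where "T = (\<lambda>w. \<Sum>m<L. a m * w ^ m)"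
  define E where "E = B * (1 / r) ^ L / (1 - 1 / r)"
  have a: "norm (a m) \<le> B * (1 / r) ^ m" for m
  proof -
    have "norm ((deriv ^^ m) g 0) \<le> fact m * B / r ^ m"
    proof (rule Cauchy_inequality)
      show "g holomorphic_on ball 0 r" using hol by (rule holomorphic_on_subset) auto
      show "continuous_on (cball 0 r) g" using hol by (rule holomorphic_on_imp_continuous_on)
    qed (use r B in auto)
    then show ?thesis by (simp add: a_def norm_divide field_simps)
  qed
  have tail: "norm (g w - T w) \<le> E" if w: "norm w \<le> 1" for w
  proof -
    have "(\<lambda>m. a m * (w - 0) ^ m) sums g w" unfolding a_def
    proof (rule holomorphic_power_series)
      show "g holomorphic_on ball 0 r" using hol by (rule holomorphic_on_subset) auto
    qed (use w r in auto)
    then have "(\<lambda>m. a (m + L) * w ^ (m + L)) sums (g w - T w)"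
      unfolding T_def by (subst sums_iff_shift) simp
    moreover have "(\<lambda>m. B * (1 / r) ^ L * (1 / r) ^ m) sums (B * (1 / r) ^ L * (1 / (1 - 1 / r)))"
      by (intro sums_mult geometric_sums) (use r in auto)
    moreover have "norm (a (m + L) * w ^ (m + L)) \<le> B * (1 / r) ^ L * (1 / r) ^ m" for m
    proof -
      have "norm (a (m + L) * w ^ (m + L)) \<le> B * (1 / r) ^ (m + L) * 1"
        unfolding norm_mult
        by (intro mult_mono a) (use w a[of "m + L"] in \<open>auto simp: norm_power power_le_one intro: order_trans[OF norm_ge_zero]\<close>)
      then show ?thesis by (simp add: power_add mult_ac)
    qed
    ultimately have "norm (g w - T w) \<le> B * (1 / r) ^ L * (1 / (1 - 1 / r))"
      by (metis (no_types, lifting) norm_suminf_le sums_unique sums_summable)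
    then show ?thesis by (simp add: E_def)
  qed
  have "root_interp L g z - g z = root_interp L (\<lambda>w. g w - T w) z - (g z - T z)"
    unfolding root_interp_diff using root_interp_poly[OF L, of a z] by (simp add: T_def)
  also have "norm \<dots> \<le> norm (root_interp L (\<lambda>w. g w - T w) z) + norm (g z - T z)"
    by (rule norm_triangle_ineq4)
  also have "\<dots> \<le> L * E + E"
    by (intro add_mono root_interp_bound L tail z) auto
  finally show ?thesis unfolding E_def[symmetric] by (simp add: algebra_simps)
qed

lemma slice_slice_same: "slice (slice z j w) j v = slice z j v"
  by (simp add: slice_def vec_eq_iff)

lemma slice_slice_swap: "i \<noteq> j \<Longrightarrow> slice (slice z i w) j v = slice (slice z j v) i w"
  by (simp add: slice_def vec_eq_iff)

lemma slice_in_closed_polydisk: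
  "z \<in> closed_polydisk r \<Longrightarrow> norm w \<le> r \<Longrightarrow> slice z j w \<in> closed_polydisk r"
  by (auto simp: closed_polydisk_def slice_nth)

text \<open>Induction over the set \<open>J\<close> of variables on which \<open>f\<close> depends: interpolating in one of them writes
  \<open>f\<close>, up to a small error, as a polynomial in that variable whose coefficients depend on the
  other variables only.\<close>

lemma poly_approximable_separately_holomorphic:
  fixes f :: "complex ^ 'n \<Rightarrow> complex"
  assumes R: "1 < R" and "finite J"
    and "\<And>z j. z \<in> closed_polydisk R \<Longrightarrow> (\<lambda>w. f (slice z j w)) holomorphic_on cball 0 R"
    and "\<And>z. z \<in> closed_polydisk R \<Longrightarrow> norm (f z) \<le> B"
    and "\<And>z w. z \<in> closed_polydisk R \<Longrightarrow> w \<in> closed_polydisk R \<Longrightarrow> \<forall>j\<in>J. z $ j = w $ j \<Longrightarrow> f z = f w"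
  shows "poly_approximable f"
  using assms(2-)
proof (induction J arbitrary: f)
  case empty
  have "f 0 = f z" if "z \<in> closed_polydisk 1" for z
    using R closed_polydisk_mono[of 1 R] that
    by (intro empty.prems(3)) (auto simp: closed_polydisk_def)
  then show ?case by (rule poly_approximable_cong[OF poly_approximable_const])
next
  case (insert j J)
  note hol = insert.prems(1) and bound = insert.prems(2) and dep = insert.prems(3)
  have B: "B \<ge> 0"
  proof -
    have "norm (f 0) \<le> B" using R by (intro bound) (auto simp: closed_polydisk_def)
    then show ?thesis by (rule order_trans[OF norm_ge_zero])
  qed
  define node where "node L t = cis (2 * pi * real t / real L)" for L t :: nat
  define c where "c L k z = (\<Sum>t<L. f (slice z j (node L t)) *
      cis (- (2 * pi * real t * real k / real L))) / of_nat L" for L k :: nat and z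
  have node: "norm (node L t) \<le> R" for L t using R by (simp add: node_def)
  have c: "poly_approximable (c L k)" if L: "L > 0" for L k
  proof (rule insert.IH)
    fix z :: "complex ^ 'n" and i assume z: "z \<in> closed_polydisk R"
    have "(\<lambda>w. f (slice (slice z i w) j (node L t))) holomorphic_on cball 0 R" for t
    proof (cases "i = j")
      case True
      then show ?thesis by (simp add: slice_slice_same)
    next
      case False
      have eq: "(\<lambda>w. f (slice (slice z i w) j (node L t))) = (\<lambda>w. f (slice (slice z j (node L t)) i w))"
        by (rule ext, rule arg_cong[of _ _ f], rule slice_slice_swap[OF False])
      show ?thesis unfolding eq by (rule hol[OF slice_in_closed_polydisk[OF z node]])
    qed
    then show "(\<lambda>w. c L k (slice z i w)) holomorphic_on cball 0 R"
      unfolding c_def by (intro holomorphic_intros) (use L in auto)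
  next
    fix z :: "complex ^ 'n" assume z: "z \<in> closed_polydisk R"
    have "norm (\<Sum>t<L. f (slice z j (node L t)) *
        cis (- (2 * pi * real t * real k / real L))) \<le> (\<Sum>t<L. B)"
      by (rule sum_norm_le) (simp add: norm_mult bound slice_in_closed_polydisk[OF z node])
    then show "norm (c L k z) \<le> B" using L by (simp add: c_def norm_divide field_simps)
  next
    fix z w :: "complex ^ 'n"
    assume zw: "z \<in> closed_polydisk R" "w \<in> closed_polydisk R" "\<forall>i\<in>J. z $ i = w $ i"
    have "f (slice z j (node L t)) = f (slice w j (node L t))" for t
      by (intro dep slice_in_closed_polydisk zw node) (use zw(3) in \<open>auto simp: slice_nth\<close>)
    then show "c L k z = c L k w" by (simp add: c_def)
  qed
  show ?case
  proof (rule poly_approximable_uniform_limit)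
    fix e :: real assume e: "e > 0"
    have "(\<lambda>L. B / (1 - 1 / R) * (real L * (1 / R) ^ L + (1 / R) ^ L)) \<longlonglongrightarrow>
        B / (1 - 1 / R) * (0 + 0)"
      by (intro tendsto_intros powser_times_n_limit_0 LIMSEQ_power_zero) (use R in auto)
    then have "\<forall>\<^sub>F L in sequentially. B / (1 - 1 / R) * (real L * (1 / R) ^ L + (1 / R) ^ L) < e"
      using e by (intro order_tendstoD(2)[of _ "B / (1 - 1 / R) * (0 + 0)"]) auto
    then have "\<forall>\<^sub>F L in sequentially. L > 0 \<and> B / (1 - 1 / R) * (real L * (1 / R) ^ L + (1 / R) ^ L) < e"
      using eventually_gt_at_top[of "0::nat"] by eventually_elim auto
    then obtain L where L: "L > 0" "B / (1 - 1 / R) * (real L * (1 / R) ^ L + (1 / R) ^ L) < e"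
      unfolding eventually_sequentially by blast
    define g where "g z = (\<Sum>k<L. (z $ j) ^ k * c L k z)" for z
    have "poly_approximable g"
      unfolding g_def using c[OF L(1)]
      by (intro poly_approximable_sum poly_approximable_mult poly_approximable_power
          poly_approximable_nth) auto
    moreover have "norm (g z - f z) \<le> e" if z: "z \<in> closed_polydisk 1" for z
    proof -
      have zR: "z \<in> closed_polydisk R" using z R closed_polydisk_mono[of 1 R] by auto
      have "norm (root_interp L (\<lambda>w. f (slice z j w)) (z $ j) - f (slice z j (z $ j)))
          \<le> (real L + 1) * (B * (1 / R) ^ L / (1 - 1 / R))"
        by (rule root_interp_error[OF L(1) R hol[OF zR]])
           (use z slice_in_closed_polydisk[OF zR] in \<open>auto intro!: bound simp: closed_polydisk_def\<close>)
      moreover have "root_interp L (\<lambda>w. f (slice z j w)) (z $ j) = g z"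
        by (simp add: root_interp_def g_def c_def node_def)
      moreover have "(real L + 1) * (B * (1 / R) ^ L / (1 - 1 / R)) =
          B / (1 - 1 / R) * (real L * (1 / R) ^ L + (1 / R) ^ L)"
        by (simp add: algebra_simps add_divide_distrib)
      ultimately have "norm (g z - f z) \<le> B / (1 - 1 / R) * (real L * (1 / R) ^ L + (1 / R) ^ L)"
        by (simp only: slice_self)
      then show ?thesis using L(2) by linarith
    qed
    ultimately show "\<exists>g. poly_approximable g \<and> (\<forall>z\<in>closed_polydisk 1. norm (g z - f z) \<le> e)"
      by blast
  qed
qed

lemma sv_holomorphic_on_dilate:
  assumes "sv_holomorphic_on f T" "\<And>z. z \<in> S \<Longrightarrow> r *\<^sub>R z \<in> T"
  shows "sv_holomorphic_on (\<lambda>z. f (r *\<^sub>R z)) S"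
proof (rule sv_holomorphic_on_compose[OF assms])
  have "sv_holomorphic_on (\<lambda>z. of_real r * z $ j) S" for j by (intro sv_intros)
  then show "sv_holomorphic_on (\<lambda>z. (r *\<^sub>R z) $ j) S" for j
    by (simp only: vector_scaleR_component) (simp only: scaleR_conv_of_real)
qed

lemma scaleR_in_closed_polydisk:
  "z \<in> closed_polydisk s \<Longrightarrow> 0 \<le> r \<Longrightarrow> r *\<^sub>R z \<in> closed_polydisk (r * s)"
  by (auto simp: closed_polydisk_def mult_left_mono)

text \<open>Used for dilations of the whole polydisk and, with \<open>z\<close> on the torus, for behaviour along radii.\<close>

lemma uniform_dilation:
  fixes f :: "complex ^ 'n \<Rightarrow> complex"
  assumes f: "continuous_on (closed_polydisk 1) f" and e: "e > 0"
  obtains r0 where "0 < r0" "r0 < 1"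
    "\<And>z r. z \<in> closed_polydisk 1 \<Longrightarrow> r0 \<le> r \<Longrightarrow> r \<le> 1 \<Longrightarrow> norm (f (r *\<^sub>R z) - f z) < e"
proof -
  have "uniformly_continuous_on (closed_polydisk 1) f"
    by (rule compact_uniformly_continuous[OF f compact_closed_polydisk])
  then obtain d where d: "d > 0" "\<And>z w. z \<in> closed_polydisk 1 \<Longrightarrow> w \<in> closed_polydisk 1 \<Longrightarrow>
      dist w z < d \<Longrightarrow> dist (f w) (f z) < e"
    unfolding uniformly_continuous_on_def using e by metis
  obtain C where C: "C > 0" "\<And>z. z \<in> (closed_polydisk 1 :: (complex ^ 'n) set) \<Longrightarrow> norm z \<le> C"
    using compact_imp_bounded[OF compact_closed_polydisk[of 1]] bounded_pos by metis
  define r0 where "r0 = max (1 / 2) (1 - d / (2 * C))"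
  show ?thesis
  proof
    show "0 < r0" "r0 < 1" using d C by (auto simp: r0_def)
    fix z :: "complex ^ 'n" and r assume z: "z \<in> closed_polydisk 1" and r: "r0 \<le> r" "r \<le> 1"
    have "r *\<^sub>R z \<in> closed_polydisk (r * 1)"
      using z r \<open>0 < r0\<close> by (intro scaleR_in_closed_polydisk) auto
    then have rz: "r *\<^sub>R z \<in> closed_polydisk 1" using closed_polydisk_mono[of r 1] r by auto
    have "dist (r *\<^sub>R z) z = norm ((1 - r) *\<^sub>R z)"
      by (simp add: dist_norm norm_minus_commute scaleR_left_diff_distrib)
    also have "\<dots> \<le> (1 - r) * C" using r C(2)[OF z] by (simp add: mult_left_mono)
    also have "\<dots> \<le> d / (2 * C) * C" using r C by (intro mult_right_mono) (auto simp: r0_def)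
    also have "\<dots> < d" using C d by simp
    finally show "norm (f (r *\<^sub>R z) - f z) < e" using d(2)[OF z rz] by (simp add: dist_norm)
  qed
qed

text \<open>The dilates \<open>f(r z)\<close> with \<open>r < 1\<close> are holomorphic on the larger polydisk of radius \<open>1/r\<close>, and they
  converge to \<open>f\<close> uniformly.\<close>

theorem poly_approximable_if_holomorphic:
  fixes f :: "complex ^ 'n \<Rightarrow> complex"
  assumes f: "sv_holomorphic_on f (closed_polydisk 1)"
  shows "poly_approximable f"
proof (rule poly_approximable_uniform_limit)
  fix e :: real assume e: "e > 0"
  have cont: "continuous_on (closed_polydisk 1) f" using f by (rule sv_holomorphic_on_continuous)
  obtain r where r: "0 < r" "r < 1"
      "\<And>z. z \<in> closed_polydisk 1 \<Longrightarrow> norm (f (r *\<^sub>R z) - f z) < e"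
    using uniform_dilation[OF cont e] by (metis less_imp_le order_refl)
  have in1: "r *\<^sub>R z \<in> closed_polydisk 1" if "z \<in> closed_polydisk (1 / r)" for z :: "complex ^ 'n"
    using scaleR_in_closed_polydisk[OF that, of r] r by simp
  have hol: "sv_holomorphic_on (\<lambda>z. f (r *\<^sub>R z)) (closed_polydisk (1 / r))"
    by (rule sv_holomorphic_on_dilate[OF f in1])
  have "bounded ((\<lambda>z. f (r *\<^sub>R z)) ` closed_polydisk (1 / r))"
    by (intro compact_imp_bounded compact_continuous_image compact_closed_polydisk
        sv_holomorphic_on_continuous hol)
  then obtain B where B: "\<And>z. z \<in> closed_polydisk (1 / r) \<Longrightarrow> norm (f (r *\<^sub>R z)) \<le> B"
    by (auto simp: bounded_iff)
  have "poly_approximable (\<lambda>z. f (r *\<^sub>R z))"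
  proof (rule poly_approximable_separately_holomorphic[where R = "1 / r" and J = UNIV and B = B])
    show "(\<lambda>w. f (r *\<^sub>R slice z j w)) holomorphic_on cball 0 (1 / r)"
      if "z \<in> closed_polydisk (1 / r)" for z j
      by (rule sv_slice_holomorphic[OF hol]) (auto intro: slice_in_closed_polydisk that)
    show "f (r *\<^sub>R z) = f (r *\<^sub>R w)" if "\<forall>j\<in>UNIV. z $ j = w $ j" for z w
    proof -
      have "z = w" using that by (simp add: vec_eq_iff)
      then show ?thesis by simp
    qed
  qed (use r B in auto)
  with r(3) show "\<exists>g. poly_approximable g \<and> (\<forall>z\<in>closed_polydisk 1. norm (g z - f z) \<le> e)"
    by (intro exI[of _ "\<lambda>z. f (r *\<^sub>R z)"]) (auto intro: less_imp_le)
qed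

section \<open>Inner functions close to a given function\<close>

definition coord_prod :: "complex ^ 'n \<Rightarrow> complex" where
  "coord_prod z = (\<Prod>j\<in>UNIV. z $ j)"

lemma sv_holomorphic_on_coord_prod: "sv_holomorphic_on coord_prod S"
  unfolding coord_prod_def[abs_def] by (intro sv_intros) auto

lemma norm_coord_prod_torus: "z \<in> torus \<Longrightarrow> norm (coord_prod z) = 1"
  by (simp add: coord_prod_def torus_def prod_norm[symmetric])

lemma norm_coord_prod_le:
  fixes z :: "complex ^ 'n"
  assumes z: "z \<in> closed_polydisk s" and s: "s \<le> 1"
  shows "norm (coord_prod z) \<le> s"
proof -
  fix j :: 'n
  have "coord_prod z = z $ j * (\<Prod>i\<in>UNIV - {j}. z $ i)"
    by (simp add: coord_prod_def prod.remove[of UNIV j])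
  then have "norm (coord_prod z) = norm (z $ j) * (\<Prod>i\<in>UNIV - {j}. norm (z $ i))"
    by (simp add: norm_mult prod_norm)
  also have "\<dots> \<le> norm (z $ j) * 1"
    by (intro mult_left_mono prod_le_1) (use z s in \<open>auto simp: closed_polydisk_def intro: order_trans\<close>)
  also have "\<dots> \<le> s" using z by (simp add: closed_polydisk_def)
  finally show ?thesis .
qed

text \<open>On each radius of the polydisk the argument of the product of the coordinates is constant. This is
  what makes the behaviour of the inner functions below explicit along radii.\<close>

lemma coord_prod_scaleR:
  "coord_prod (r *\<^sub>R z :: complex ^ 'n) = of_real (r ^ CARD('n)) * coord_prod z"
  unfolding coord_prod_def vector_scaleR_component by (simp add: scaleR_conv_of_real prod.distrib)

lemma unimodular_mult_cnj: "norm u = 1 \<Longrightarrow> u * cnj u = 1"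
  by (simp add: complex_norm_square[symmetric])

text \<open>On the torus conjugation inverts each coordinate, so a power of the product of all coordinates
  clears the denominators of the conjugate of a polynomial.\<close>

lemma reflected_polynomial:
  fixes p :: "'n::finite poly_expr"
  shows "\<exists>N Q. sv_holomorphic_on Q (closed_polydisk 1) \<and>
    (\<forall>z\<in>torus. Q z = coord_prod z ^ N * cnj (eval_poly p z))"
proof (induction p)
  case (Coeff a b)
  show ?case
    by (rule exI[of _ 0], rule exI[of _ "\<lambda>z. cnj (Complex (of_rat a) (of_rat b))"])
       (auto intro: sv_intros)
next
  case (Coord j)
  define Q where "Q = (\<lambda>z :: complex ^ 'n. \<Prod>i\<in>UNIV - {j}. z $ i)"
  have "Q z = coord_prod z ^ 1 * cnj (eval_poly (Coord j) z)" if "z \<in> torus" for z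
  proof -
    have "coord_prod z ^ 1 * cnj (eval_poly (Coord j) z) = (z $ j * cnj (z $ j)) * Q z"
      by (simp add: coord_prod_def Q_def prod.remove[of UNIV j])
    also have "z $ j * cnj (z $ j) = 1" using that by (intro unimodular_mult_cnj) (simp add: torus_def)
    finally show ?thesis by simp
  qed
  moreover have "sv_holomorphic_on Q (closed_polydisk 1)"
    unfolding Q_def by (intro sv_intros) auto
  ultimately show ?case by blast
next
  case (Plus p q)
  then obtain N Q M R where NQ: "sv_holomorphic_on Q (closed_polydisk 1)"
      "\<And>z. z \<in> torus \<Longrightarrow> Q z = coord_prod z ^ N * cnj (eval_poly p z)"
    and MR: "sv_holomorphic_on R (closed_polydisk 1)"
      "\<And>z. z \<in> torus \<Longrightarrow> R z = coord_prod z ^ M * cnj (eval_poly q z)" by metis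
  show ?case
    by (rule exI[of _ "N + M"], rule exI[of _ "\<lambda>z. coord_prod z ^ M * Q z + coord_prod z ^ N * R z"])
       (auto simp: NQ MR power_add algebra_simps intro!: sv_intros sv_holomorphic_on_coord_prod)
next
  case (Times p q)
  then obtain N Q M R where NQ: "sv_holomorphic_on Q (closed_polydisk 1)"
      "\<And>z. z \<in> torus \<Longrightarrow> Q z = coord_prod z ^ N * cnj (eval_poly p z)"
    and MR: "sv_holomorphic_on R (closed_polydisk 1)"
      "\<And>z. z \<in> torus \<Longrightarrow> R z = coord_prod z ^ M * cnj (eval_poly q z)" by metis
  show ?case
    by (rule exI[of _ "N + M"], rule exI[of _ "\<lambda>z. Q z * R z"])
       (auto simp: NQ MR power_add algebra_simps intro!: sv_intros)
qed

text \<open>The derivative at a boundary point is taken in the whole space, not within the polydisk, so this is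
  stronger than being inner and continuous up to the closure. The functions constructed here are
  rational, with denominators that do not vanish on the closed polydisk.\<close>

definition closed_inner :: "(complex ^ 'n \<Rightarrow> complex) \<Rightarrow> bool" where
  "closed_inner x \<longleftrightarrow> sv_holomorphic_on x (closed_polydisk 1) \<and> (\<forall>z\<in>torus. norm (x z) = 1)"

lemma closed_inner_norm_le: "closed_inner x \<Longrightarrow> z \<in> closed_polydisk 1 \<Longrightarrow> norm (x z) \<le> 1"
  unfolding closed_inner_def by (blast intro: maximum_modulus_closed_polydisk order_eq_refl)

text \<open>If the end point \<open>u\<close> of a segment from the origin is far from \<open>-1\<close>, then the whole segment is.\<close>

lemma norm_one_plus_scaled_unimodular:
  fixes u :: complex
  assumes "norm u = 1" "0 \<le> s" "s \<le> 1"
  shows "norm (1 + u) / 2 \<le> norm (1 + of_real s * u)"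
proof -
  have a: "1 - s \<le> norm (1 + of_real s * u)"
    using norm_diff_ineq[of 1 "of_real s * u"] assms by (simp add: norm_mult)
  have "norm (1 + u) \<le> norm (1 + of_real s * u) + norm (of_real (1 - s) * u)"
    using norm_triangle_ineq[of "1 + of_real s * u" "of_real (1 - s) * u"]
    by (simp add: algebra_simps)
  also have "norm (of_real (1 - s) * u) = 1 - s"
    unfolding norm_mult norm_of_real using assms by simp
  finally show ?thesis using a by simp
qed

text \<open>Besides approximating \<open>h\<close> on compact sets, the inner function \<open>x\<close> is controlled on entire radii.
  Near the end of a radius with \<open>h \<approx> 1\<close>, both \<open>P\<close> and \<open>Q / M^N\<^sub>0\<close> are close to \<open>1\<close>, where \<open>M\<close> is the
  product of the coordinates and \<open>Q\<close> the reflection of \<open>P\<close>, so \<open>x - 1\<close> is a small quantity divided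
  by roughly \<open>1 + \<gamma> M^N\<close>. The tolerance \<open>e / (64 q)\<close> for \<open>h\<close> is chosen so that dividing by a
  number of size \<open>1 / (8 q)\<close> still leaves at most \<open>e\<close>.\<close>

lemma inner_approximation:
  fixes h :: "complex ^ 'n \<Rightarrow> complex" and \<beta> :: "complex ^ 'n" and q :: real
  assumes h: "sv_holomorphic_on h (closed_polydisk 1)"
    and h1: "\<And>z. z \<in> closed_polydisk 1 \<Longrightarrow> norm (h z) \<le> 1"
    and \<beta>: "\<beta> \<in> torus" and \<rho>: "\<rho> < 1" and e: "0 < e" "e \<le> 1" and q: "1 \<le> q"
  obtains x \<gamma> N where "closed_inner x" "x \<beta> = 1"
    "\<And>z. z \<in> closed_polydisk \<rho> \<Longrightarrow> norm (x z - h z) \<le> e"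
    "norm \<gamma> = 1" "0 < N"
    "\<And>\<zeta> r. \<lbrakk>\<zeta> \<in> torus; 1 / (2 * q) < norm (1 + \<gamma> * coord_prod \<zeta> ^ N);
       \<And>r. 0 \<le> r \<Longrightarrow> r \<le> 1 \<Longrightarrow> norm (h (r *\<^sub>R \<zeta>) - 1) \<le> e / (64 * q); 0 \<le> r; r \<le> 1\<rbrakk>
       \<Longrightarrow> norm (x (r *\<^sub>R \<zeta>) - 1) \<le> e"
proof -
  define \<eta> where "\<eta> = e / (64 * q)"
  have \<eta>: "0 < \<eta>" "\<eta> \<le> 1 / (64 * q)" "\<eta> \<le> 1 / 64" "64 * q * \<eta> = e"
  proof -
    show "0 < \<eta>" "\<eta> \<le> 1 / (64 * q)" "64 * q * \<eta> = e"
      using e q by (auto simp: \<eta>_def divide_right_mono)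
    have "1 / (64 * q) \<le> 1 / 64" using q by (intro divide_left_mono) auto
    then show "\<eta> \<le> 1 / 64" using \<open>\<eta> \<le> 1 / (64 * q)\<close> by simp
  qed
  have \<eta>e: "64 * \<eta> \<le> e" using \<eta>(1,4) q mult_right_mono[of 1 q "64 * \<eta>"] by (simp add: mult_ac)
  obtain p where p: "\<And>z. z \<in> closed_polydisk 1 \<Longrightarrow> norm (eval_poly p z - h z) < \<eta>"
    using poly_approximable_if_holomorphic[OF h] \<eta>(1) unfolding poly_approximable_def by metis
  obtain N0 Q' where Q': "sv_holomorphic_on Q' (closed_polydisk 1)"
      "\<And>z. z \<in> torus \<Longrightarrow> Q' z = coord_prod z ^ N0 * cnj (eval_poly p z)"
    using reflected_polynomial by metis
  \<comment> \<open>Scaling by \<open>1 - \<eta>\<close> makes the modulus strictly less than one, by at least \<open>\<eta>\<^sup>2\<close>.\<close>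
  define P where "P = (\<lambda>z. of_real (1 - \<eta>) * eval_poly p z)"
  define Q where "Q = (\<lambda>z. of_real (1 - \<eta>) * Q' z)"
  have P_hol: "sv_holomorphic_on P (closed_polydisk 1)"
    unfolding P_def by (intro sv_intros sv_holomorphic_on_eval_poly)
  have Q_hol: "sv_holomorphic_on Q (closed_polydisk 1)"
    unfolding Q_def by (intro sv_intros Q')
  have Q_torus: "Q z = coord_prod z ^ N0 * cnj (P z)" if "z \<in> torus" for z
    using Q'(2)[OF that] by (simp add: P_def Q_def)
  define c where "c = 1 - \<eta>\<^sup>2"
  have c: "c < 1" using \<eta> by (simp add: c_def)
  have P_le: "norm (P z) \<le> c" if z: "z \<in> closed_polydisk 1" for z
  proof -
    have "norm (eval_poly p z) \<le> 1 + \<eta>"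
      using p[OF z] h1[OF z] norm_triangle_ineq[of "eval_poly p z - h z" "h z"] by simp
    then have "(1 - \<eta>) * norm (eval_poly p z) \<le> (1 - \<eta>) * (1 + \<eta>)"
      using \<eta> by (intro mult_left_mono) auto
    moreover have "norm (P z) = (1 - \<eta>) * norm (eval_poly p z)"
      unfolding P_def norm_mult norm_of_real using \<eta> by simp
    ultimately show ?thesis by (simp add: c_def power2_eq_square algebra_simps)
  qed
  have P_h: "norm (P z - h z) \<le> 2 * \<eta>" if z: "z \<in> closed_polydisk 1" for z
  proof -
    have "P z - h z = of_real (1 - \<eta>) * (eval_poly p z - h z) - of_real \<eta> * h z"
      by (simp add: P_def algebra_simps)
    also have "norm \<dots> \<le> (1 - \<eta>) * norm (eval_poly p z - h z) + \<eta> * norm (h z)"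
      by (rule order_trans[OF norm_triangle_ineq4]) (unfold norm_mult norm_of_real, use \<eta> in simp)
    also have "\<dots> \<le> 1 * \<eta> + \<eta> * 1"
      using \<eta> p[OF z] h1[OF z] by (intro add_mono mult_mono) auto
    finally show ?thesis by simp
  qed
  have Q_le: "norm (Q z) \<le> c" if z: "z \<in> closed_polydisk 1" for z
  proof (rule maximum_modulus_closed_polydisk[OF Q_hol _ z])
    fix z :: "complex ^ 'n" assume "z \<in> torus"
    then show "norm (Q z) \<le> c"
      using P_le[of z] torus_subset_closed
      by (auto simp: Q_torus norm_mult norm_power norm_coord_prod_torus)
  qed
  \<comment> \<open>Inside the polydisk \<open>Q\<close> differs from \<open>coord_prod ^ N0 * cnj P\<close>, but only slightly for \<open>r0 \<le> r \<le> 1\<close>.\<close>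
  define F where "F = (\<lambda>z. Q z - coord_prod z ^ N0 * cnj (P z))"
  have F_torus: "F z = 0" if "z \<in> torus" for z using Q_torus[OF that] by (simp add: F_def)
  have "continuous_on (closed_polydisk 1) F"
    unfolding F_def
    by (intro continuous_intros sv_holomorphic_on_continuous Q_hol P_hol sv_holomorphic_on_coord_prod)
  then obtain r0 where r0: "0 < r0" "r0 < 1" "\<And>z r. z \<in> closed_polydisk 1 \<Longrightarrow> r0 \<le> r \<Longrightarrow> r \<le> 1 \<Longrightarrow>
      norm (F (r *\<^sub>R z) - F z) < \<eta>"
    using uniform_dilation \<eta>(1) by metis
  define s where "s = max \<rho> r0"
  have s: "0 < s" "s < 1" "\<rho> \<le> s" "r0 \<le> s" using r0 \<rho> by (auto simp: s_def)
  obtain N' where N': "s ^ N' < \<eta> / 4" using real_arch_pow_inv[of "\<eta> / 4" s] \<eta> s by auto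
  define N1 where "N1 = Suc N'"
  have "s ^ N1 \<le> s ^ N'" using s by (simp add: N1_def mult_left_le_one_le)
  then have sN1: "s ^ N1 < \<eta> / 4" using N' by simp
  define N where "N = N0 + N1"
  define b where "b = P \<beta>"
  have b: "norm b < 1" using P_le[of \<beta>] c \<beta> torus_subset_closed by (auto simp: b_def)
  have "b \<noteq> 1" using b by auto
  moreover from this have "cnj b \<noteq> 1" by simp
  ultimately have nb: "1 - b \<noteq> 0" "1 - cnj b \<noteq> 0" by (metis eq_iff_diff_eq_0)+
  \<comment> \<open>The Moebius map \<open>t \<mapsto> (b + t) / (1 + cnj b t)\<close> sends \<open>(1 - b) / (1 - cnj b)\<close> to \<open>1\<close>; this gives \<open>x \<beta> = 1\<close>.\<close>
  define \<gamma> where "\<gamma> = (1 - b) / (1 - cnj b) * cnj (coord_prod \<beta> ^ N)"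
  have "norm (1 - cnj b) = norm (1 - b)" 
    using complex_mod_cnj[of "1 - b"] by simp
  then have \<gamma>1: "norm \<gamma> = 1"
    using \<beta> nb by (simp add: \<gamma>_def norm_mult norm_divide norm_power norm_coord_prod_torus)
  define D where "D = (\<lambda>z. \<gamma> * coord_prod z ^ N1 * Q z)"
  define x where "x = (\<lambda>z. (P z + \<gamma> * coord_prod z ^ N) / (1 + D z))"
  have D_le: "norm (D z) \<le> t ^ N1" if "z \<in> closed_polydisk t" "0 \<le> t" "t \<le> 1" for z t
  proof -
    have z1: "z \<in> closed_polydisk 1" using that closed_polydisk_mono by blast
    have "norm (D z) = norm (coord_prod z) ^ N1 * norm (Q z)"
      by (simp add: D_def norm_mult norm_power \<gamma>1)
    also have "\<dots> \<le> t ^ N1 * 1"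
      using Q_le[OF z1] c that by (intro mult_mono power_mono norm_coord_prod_le) auto
    finally show ?thesis by simp
  qed
  have D_lt: "norm (D z) < 1" if z: "z \<in> closed_polydisk 1" for z
  proof -
    have "norm (D z) = norm (coord_prod z) ^ N1 * norm (Q z)"
      by (simp add: D_def norm_mult norm_power \<gamma>1)
    also have "\<dots> \<le> 1 * norm (Q z)"
      using norm_coord_prod_le[OF z] by (intro mult_right_mono power_le_one) auto
    finally show ?thesis using Q_le[OF z] c by simp
  qed
  have den: "1 + D z \<noteq> 0" if z: "z \<in> closed_polydisk 1" for z
    using D_lt[OF z] by (metis add_eq_0_iff norm_minus_cancel norm_one less_irrefl)
  have D_torus: "D z = \<gamma> * coord_prod z ^ N * cnj (P z)" if "z \<in> torus" for z
    by (simp add: D_def Q_torus[OF that] N_def power_add)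
  show ?thesis
  proof
    show "closed_inner x"
      unfolding closed_inner_def
    proof
      show "sv_holomorphic_on x (closed_polydisk 1)"
        unfolding x_def D_def
        by (intro sv_intros P_hol Q_hol sv_holomorphic_on_coord_prod) (use den in \<open>auto simp: D_def\<close>)
      show "\<forall>z\<in>torus. norm (x z) = 1"
      proof
        fix z :: "complex ^ 'n" assume z: "z \<in> torus"
        define u where "u = \<gamma> * coord_prod z ^ N"
        have u: "norm u = 1" by (simp add: u_def norm_mult norm_power \<gamma>1 norm_coord_prod_torus[OF z])
        have "D z = u * cnj (P z)" by (simp add: D_torus[OF z] u_def)
        then have "norm (1 + D z) = norm (cnj u * (1 + u * cnj (P z)))"
          unfolding norm_mult complex_mod_cnj u by simp
        also have "cnj u * (1 + u * cnj (P z)) = cnj (P z + u)"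
          using unimodular_mult_cnj[OF u] by (simp add: algebra_simps)
        also have "norm (cnj (P z + u)) = norm (P z + u)" by (rule complex_mod_cnj)
        finally have "norm (1 + D z) = norm (P z + u)" .
        moreover have "norm (1 + D z) \<noteq> 0" using den z torus_subset_closed by auto
        ultimately show "norm (x z) = 1"
          unfolding x_def u_def[symmetric] norm_divide by (metis divide_self)
      qed
    qed
    show "x \<beta> = 1"
    proof -
      have "\<gamma> * coord_prod \<beta> ^ N = (1 - b) / (1 - cnj b) * (coord_prod \<beta> ^ N * cnj (coord_prod \<beta> ^ N))"
        by (simp add: \<gamma>_def)
      also have "coord_prod \<beta> ^ N * cnj (coord_prod \<beta> ^ N) = 1"
        by (rule unimodular_mult_cnj) (simp add: norm_power norm_coord_prod_torus[OF \<beta>])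
      finally have g: "\<gamma> * coord_prod \<beta> ^ N = (1 - b) / (1 - cnj b)" by simp
      have "b + (1 - b) / (1 - cnj b) = 1 + (1 - b) / (1 - cnj b) * cnj b"
        using nb by (simp add: field_simps)
      moreover have "1 + D \<beta> \<noteq> 0" using den \<beta> torus_subset_closed by blast
      ultimately show ?thesis by (simp add: x_def D_torus[OF \<beta>] g b_def[symmetric])
    qed
    show "norm \<gamma> = 1" by fact
    show "0 < N" by (simp add: N_def N1_def)
    \<comment> \<open>On \<open>closed_polydisk s\<close> the powers of the coordinate product are negligible and \<open>x \<approx> P\<close>.\<close>
    have near: "norm (x z - h z) \<le> 3 * \<eta>" if z: "z \<in> closed_polydisk s" for z
    proof -
      have z1: "z \<in> closed_polydisk 1" using z s closed_polydisk_mono[of s 1] by auto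
      have "s ^ N1 \<le> 1 / 2" using sN1 \<eta> by simp
      then have D2: "norm (D z) \<le> s ^ N1" "norm (D z) \<le> 1 / 2" using D_le[OF z] s by auto
      have "x z - P z = (\<gamma> * coord_prod z ^ N - P z * D z) / (1 + D z)"
        using den[OF z1] by (simp add: x_def field_simps)
      then have "norm (x z - P z) = norm (\<gamma> * coord_prod z ^ N - P z * D z) / norm (1 + D z)"
        by (simp add: norm_divide)
      also have "\<dots> \<le> (2 * s ^ N1) / (1 / 2)"
      proof (rule frac_le)
        have "norm (\<gamma> * coord_prod z ^ N) \<le> s ^ N"
          using norm_coord_prod_le[OF z] s by (auto simp: norm_mult norm_power \<gamma>1 intro!: power_mono)
        also have "\<dots> \<le> s ^ N1" using s by (intro power_decreasing) (auto simp: N_def)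
        finally have "norm (\<gamma> * coord_prod z ^ N) \<le> s ^ N1" .
        moreover have "norm (P z * D z) \<le> 1 * s ^ N1"
          unfolding norm_mult using P_le[OF z1] c D2 by (intro mult_mono) auto
        ultimately show "norm (\<gamma> * coord_prod z ^ N - P z * D z) \<le> 2 * s ^ N1"
          using norm_triangle_ineq4[of "\<gamma> * coord_prod z ^ N" "P z * D z"] by simp
        show "1 / 2 \<le> norm (1 + D z)" using norm_diff_ineq[of 1 "D z"] D2 by simp
      qed (use s in auto)
      also have "\<dots> \<le> \<eta>" using sN1 by simp
      finally show ?thesis
        using P_h[OF z1] norm_triangle_ineq[of "x z - P z" "P z - h z"] by simp
    qed
    show "norm (x z - h z) \<le> e" if "z \<in> closed_polydisk \<rho>" for z
      using near[of z] that closed_polydisk_mono[OF s(3)] \<eta>e \<eta>(1) by force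
    fix \<zeta> :: "complex ^ 'n" and r :: real
    assume \<zeta>: "\<zeta> \<in> torus" and far: "1 / (2 * q) < norm (1 + \<gamma> * coord_prod \<zeta> ^ N)"
      and h_near: "\<And>r. 0 \<le> r \<Longrightarrow> r \<le> 1 \<Longrightarrow> norm (h (r *\<^sub>R \<zeta>) - 1) \<le> e / (64 * q)"
      and r: "0 \<le> r" "r \<le> 1"
    define z where "z = r *\<^sub>R \<zeta>"
    have zr: "z \<in> closed_polydisk r"
      using \<zeta> r by (auto simp: z_def torus_def closed_polydisk_def)
    then have z1: "z \<in> closed_polydisk 1" using closed_polydisk_mono r by blast
    have hz: "norm (h z - 1) \<le> \<eta>" using h_near[OF r] by (simp add: z_def \<eta>_def)
    have "norm (x z - 1) \<le> e"
    proof (cases "r \<le> s")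
      case True
      then have "norm (x z - h z) \<le> 3 * \<eta>" using near zr closed_polydisk_mono by blast
      then show ?thesis
        using hz norm_triangle_ineq[of "x z - h z" "h z - 1"] \<eta>e \<eta>(1) by simp
    next
      case False
      define u where "u = \<gamma> * coord_prod z ^ N"
      have "norm (F (r *\<^sub>R \<zeta>) - F \<zeta>) < \<eta>"
        using False s r \<zeta> torus_subset_closed by (intro r0) auto
      then have Fz: "norm (F z) < \<eta>" using F_torus[OF \<zeta>] by (simp add: z_def)
      have P1: "norm (P z - 1) \<le> 3 * \<eta>"
        using P_h[OF z1] hz norm_triangle_ineq[of "P z - h z" "h z - 1"] by simp
      have "D z - u = \<gamma> * coord_prod z ^ N1 * F z + u * cnj (P z - 1)"
        by (simp add: D_def u_def F_def N_def power_add algebra_simps)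
      also have "norm \<dots> \<le> 1 * \<eta> + 1 * (3 * \<eta>)"
      proof (rule order_trans[OF norm_triangle_ineq add_mono])
        have m: "norm (coord_prod z) \<le> 1" using norm_coord_prod_le[OF z1] by simp
        show "norm (\<gamma> * coord_prod z ^ N1 * F z) \<le> 1 * \<eta>"
          unfolding norm_mult norm_power \<gamma>1 using m Fz by (intro mult_mono) (auto simp: power_le_one)
        have "norm (u * cnj (P z - 1)) = norm u * norm (P z - 1)"
          by (simp only: norm_mult complex_mod_cnj)
        also have "\<dots> \<le> 1 * (3 * \<eta>)"
          using m P1 by (intro mult_mono) (auto simp: u_def norm_mult norm_power \<gamma>1 power_le_one)
        finally show "norm (u * cnj (P z - 1)) \<le> 1 * (3 * \<eta>)" .
      qed
      finally have Du: "norm (D z - u) \<le> 4 * \<eta>" by simp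
      have "u = of_real (r ^ (CARD('n) * N)) * (\<gamma> * coord_prod \<zeta> ^ N)"
        by (simp add: u_def z_def coord_prod_scaleR power_mult_distrib power_mult)
      then have "norm (1 + \<gamma> * coord_prod \<zeta> ^ N) / 2 \<le> norm (1 + u)"
        using norm_one_plus_scaled_unimodular[of "\<gamma> * coord_prod \<zeta> ^ N" "r ^ (CARD('n) * N)"] r \<zeta>
        by (simp add: norm_mult norm_power \<gamma>1 norm_coord_prod_torus power_le_one)
      then have "1 / (4 * q) < norm (1 + u)" using far by simp
      moreover have "4 * \<eta> \<le> 1 / (16 * q)" using \<eta>(2) by simp
      moreover have "norm (1 + u) \<le> norm (1 + D z) + norm (D z - u)"
        using norm_triangle_ineq4[of "1 + D z" "D z - u"] by simp
      moreover have "1 / (8 * q) \<le> 1 / (4 * q) - 1 / (16 * q)" using q by (simp add: field_simps)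
      ultimately have den_ge: "1 / (8 * q) \<le> norm (1 + D z)" using Du by linarith
      have "x z - 1 = ((P z - 1) - (D z - u)) / (1 + D z)"
        using den[OF z1] by (simp add: x_def u_def field_simps)
      then have "norm (x z - 1) = norm ((P z - 1) - (D z - u)) / norm (1 + D z)"
        by (simp add: norm_divide)
      also have "\<dots> \<le> (7 * \<eta>) / (1 / (8 * q))"
        using norm_triangle_ineq4[of "P z - 1" "D z - u"] P1 Du den_ge q \<eta>(1)
        by (intro frac_le) auto
      also have "\<dots> = 56 * (q * \<eta>)" by simp
      also have "\<dots> \<le> 64 * (q * \<eta>)" using \<eta>(1) q by simp
      also have "\<dots> = e" using \<eta>(4) by (simp only: mult.assoc)
      finally show ?thesis .
    qed
    then show "norm (x (r *\<^sub>R \<zeta>) - 1) \<le> e" by (simp add: z_def)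
  qed
qed

section \<open>Small measure of the resonant sets\<close>

lemma integral_character_interval:
  assumes "d \<noteq> 0"
  shows "(\<integral>s. indicator {0..2 * pi} s *\<^sub>R cis (of_int d * s) \<partial>lborel) = 0"
proof -
  define F where "F s = cis (of_int d * s) / (\<i> * of_int d)" for s :: real
  have "(F has_vector_derivative cis (of_int d * s)) (at s within {0..2 * pi})" for s
  proof -
    have "((\<lambda>s. cis (of_int d * s)) has_vector_derivative (of_int d *\<^sub>R (\<i> * cis (of_int d * s)))) (at s within {0..2 * pi})"
      unfolding cis_conv_exp
      by (auto intro!: derivative_eq_intros has_vector_derivative_real_field simp: scaleR_conv_of_real)
    then have "((\<lambda>s. cis (of_int d * s) / (\<i> * of_int d)) has_vector_derivative
        (of_int d *\<^sub>R (\<i> * cis (of_int d * s))) / (\<i> * of_int d)) (at s within {0..2 * pi})"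
      by (rule has_vector_derivative_divide)
    then show ?thesis using assms by (simp add: F_def[abs_def] scaleR_conv_of_real)
  qed
  then have "has_bochner_integral lborel (\<lambda>s. indicator {0..2 * pi} s *\<^sub>R cis (of_int d * s)) (F (2 * pi) - F 0)"
    by (intro has_bochner_integral_FTC_Icc) (auto simp: cis_conv_exp intro!: continuous_intros)
  moreover have "F (2 * pi) = F 0"
  proof -
    have "cis (of_int d * (2 * pi)) = 1"
      using cis_multiple_2pi[of "of_int d"] by (simp add: mult_ac)
    then show ?thesis by (simp add: F_def)
  qed
  ultimately show ?thesis by (simp add: has_bochner_integral_integral_eq)
qed

abbreviation param_box :: "(real ^ 'n) set" where
  "param_box \<equiv> cbox 0 (\<chi> j. 2 * pi)"

lemma param_box_measure_pos: "measure lborel (param_box :: (real ^ 'n) set) > 0"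
  by (rule content_pos_lt) (auto simp: Basis_vec_def inner_axis)

lemma integral_character_box:
  assumes "d \<noteq> 0"
  shows "(\<integral>t. indicator param_box (t :: real ^ 'n) *\<^sub>R cis (of_int d * (\<Sum>j\<in>UNIV. t $ j)) \<partial>lborel) = 0"
    (is "integral\<^sup>L lborel ?F = 0")
proof -
  interpret product_sigma_finite "\<lambda>_::real ^ 'n. lborel :: real measure" ..
  define g where "g s = indicator {0..2 * pi} s *\<^sub>R cis (of_int d * s)" for s :: real
  have F: "?F t = (\<Prod>b\<in>Basis. g (t \<bullet> b))" for t :: "real ^ 'n"
  proof -
    have B: "(\<Prod>b\<in>(Basis :: (real ^ 'n) set). g (t \<bullet> b)) = (\<Prod>j\<in>UNIV. g (t $ j))"
    proof -
      have "inj (\<lambda>j. axis j (1::real) :: real ^ 'n)" by (auto simp: inj_def axis_eq_axis)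
      moreover have "(Basis :: (real ^ 'n) set) = range (\<lambda>j. axis j 1)" by (auto simp: Basis_vec_def)
      moreover have "(\<Prod>b\<in>range (\<lambda>j. axis j 1 :: real ^ 'n). g (t \<bullet> b)) = (\<Prod>j\<in>UNIV. g (t \<bullet> axis j 1))"
        using prod.reindex[OF calculation(1)] by (simp only: comp_def)
      ultimately show ?thesis by (simp only: inner_axis) simp
    qed
    have "(\<Prod>j\<in>UNIV. g (t $ j)) = of_real (\<Prod>j\<in>UNIV. indicator {0..2 * pi} (t $ j)) * (\<Prod>j\<in>UNIV. cis (of_int d * t $ j))"
      by (simp add: g_def scaleR_conv_of_real prod.distrib)
    also have "(\<Prod>j\<in>UNIV. indicator {0..2 * pi} (t $ j)) = (indicator param_box t :: real)"
    proof (cases "t \<in> param_box")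
      case True
      then show ?thesis by (auto simp: mem_box_cart indicator_def)
    next
      case False
      then obtain j where "t $ j \<notin> {0..2 * pi}" by (auto simp: mem_box_cart)
      then have "indicator {0..2 * pi} (t $ j) = (0 :: real)" by (rule indicator_simps)
      then have "\<exists>j\<in>UNIV. indicator {0..2 * pi} (t $ j) = (0 :: real)" by blast
      then have "(\<Prod>j\<in>UNIV. indicator {0..2 * pi} (t $ j)) = (0 :: real)" by (simp add: prod_zero)
      with False show ?thesis by simp
    qed
    also have "(\<Prod>j\<in>UNIV. cis (of_int d * t $ j)) = cis (of_int d * (\<Sum>j\<in>UNIV. t $ j))"
      by (simp add: cis_conv_exp exp_sum[symmetric] sum_distrib_left)
    finally show ?thesis using B by (simp add: scaleR_conv_of_real)
  qed
  have "integrable lborel g"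
    unfolding g_def by (rule borel_integrable_compact) (auto simp: cis_conv_exp intro!: continuous_intros)
  have "integral\<^sup>L lborel ?F =
      integral\<^sup>L (distr (\<Pi>\<^sub>M b\<in>Basis. lborel) borel (\<lambda>f. \<Sum>b\<in>Basis. f b *\<^sub>R b)) ?F"
    by (subst lborel_eq) simp
  also have "\<dots> = (\<integral>f. ?F (\<Sum>b\<in>Basis. f b *\<^sub>R b) \<partial>(\<Pi>\<^sub>M b\<in>Basis. lborel))"
  proof (rule integral_distr)
    show "(\<lambda>f. \<Sum>b\<in>Basis. f b *\<^sub>R b) \<in> (\<Pi>\<^sub>M b\<in>Basis. lborel) \<rightarrow>\<^sub>M borel" by measurable
    have "integrable lborel ?F"
      by (rule borel_integrable_compact) (auto simp: cis_conv_exp intro!: continuous_intros)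
    then show "?F \<in> borel_measurable borel" by simp
  qed
  also have "\<dots> = (\<integral>f. (\<Prod>b\<in>(Basis :: (real ^ 'n) set). g (f b)) \<partial>(\<Pi>\<^sub>M b\<in>Basis. lborel))"
  proof (rule Bochner_Integration.integral_cong[OF refl])
    fix f :: "real ^ 'n \<Rightarrow> real"
    have "(\<Prod>b\<in>Basis. g ((\<Sum>b\<in>Basis. f b *\<^sub>R b) \<bullet> b)) = (\<Prod>b\<in>(Basis :: (real ^ 'n) set). g (f b))"
      by (intro prod.cong refl) (simp only: inner_sum_left_Basis)
    then show "?F (\<Sum>b\<in>Basis. f b *\<^sub>R b) = (\<Prod>b\<in>(Basis :: (real ^ 'n) set). g (f b))"
      by (simp only: F)
  qed
  also have "\<dots> = (\<Prod>b\<in>(Basis :: (real ^ 'n) set). integral\<^sup>L lborel g)"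
    by (rule product_integral_prod) (simp_all add: \<open>integrable lborel g\<close>)
  also have "\<dots> = 0"
    unfolding g_def using integral_character_interval[OF assms] by simp
  finally show ?thesis .
qed

lemma coord_prod_cis: "coord_prod (\<chi> j. cis (t $ j)) = cis (\<Sum>j\<in>UNIV. t $ j)"
  by (simp add: coord_prod_def cis_conv_exp exp_sum[symmetric] sum_distrib_left)

text \<open>The mean square of an average of \<open>m\<close> distinct characters is \<open>1/m\<close>, whichever characters they are.
  Hence the bound does not depend on \<open>N\<close>.\<close>

lemma integral_fejer_kernel:
  fixes c :: complex
  assumes c: "norm c = 1" and N: "0 < N" and m: "0 < m"
  shows "(\<integral>t. indicator (param_box :: (real ^ 'n) set) t *\<^sub>R
      (norm ((\<Sum>k<m. (c * cis (\<Sum>j\<in>UNIV. t $ j) ^ N) ^ k) / of_nat m))\<^sup>2 \<partial>lborel) =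
      measure lborel (param_box :: (real ^ 'n) set) / m"
    (is "(\<integral>t. ?f t \<partial>lborel) = _")
proof -
  define u where "u t = cis (\<Sum>j\<in>UNIV. t $ j) ^ N" for t :: "real ^ 'n"
  define G where "G k l t = indicator param_box t *\<^sub>R cis (of_int (int N * (int k - int l)) * (\<Sum>j\<in>UNIV. t $ j))"
    for k l and t :: "real ^ 'n"
  have int: "integrable lborel (G k l)" for k l
    unfolding G_def[abs_def] by (rule borel_integrable_compact) (auto simp: cis_conv_exp intro!: continuous_intros)
  have G: "integral\<^sup>L lborel (G k l) = (if k = l then of_real (measure lborel (param_box :: (real ^ 'n) set)) else 0)" for k l
  proof (cases "k = l")
    case True
    then have "integral\<^sup>L lborel (G k l) = (\<integral>t. indicator (param_box :: (real ^ 'n) set) t *\<^sub>R (1::complex) \<partial>lborel)"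
      by (simp add: G_def[abs_def])
    also have "\<dots> = of_real (measure lborel (param_box :: (real ^ 'n) set))"
      using emeasure_lborel_cbox_finite[of "0 :: real ^ 'n" "\<chi> j. 2 * pi"]
      by (simp add: scaleR_conv_of_real)
    finally show ?thesis using True by simp
  next
    case False
    then have "int N * (int k - int l) \<noteq> 0" using N by simp
    from integral_character_box[OF this] show ?thesis unfolding G_def[abs_def] using False by simp
  qed
  have expand: "of_real (?f t) = (\<Sum>k<m. \<Sum>l<m. c ^ k * cnj c ^ l / (of_nat m)\<^sup>2 * G k l t)" for t
  proof -
    have "of_real ((norm ((\<Sum>k<m. (c * u t) ^ k) / of_nat m))\<^sup>2)
        = ((\<Sum>k<m. (c * u t) ^ k) / of_nat m) * cnj ((\<Sum>k<m. (c * u t) ^ k) / of_nat m)"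
      by (rule complex_norm_square)
    also have "\<dots> = (\<Sum>k<m. (c * u t) ^ k) * (\<Sum>l<m. cnj ((c * u t) ^ l)) / (of_nat m)\<^sup>2"
      by (simp add: power2_eq_square)
    also have "\<dots> = (\<Sum>k<m. \<Sum>l<m. (c * u t) ^ k * cnj ((c * u t) ^ l) / (of_nat m)\<^sup>2)"
      by (simp only: sum_product sum_divide_distrib)
    also have "\<dots> = (\<Sum>k<m. \<Sum>l<m. c ^ k * cnj c ^ l / (of_nat m)\<^sup>2 *
        cis (of_int (int N * (int k - int l)) * (\<Sum>j\<in>UNIV. t $ j)))"
    proof (intro sum.cong refl)
      fix k l
      have "u t ^ k * cnj (u t) ^ l = cis (of_int (int N * (int k - int l)) * (\<Sum>j\<in>UNIV. t $ j))"
        by (simp add: u_def Complex.DeMoivre cis_cnj cis_mult algebra_simps)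
      then show "(c * u t) ^ k * cnj ((c * u t) ^ l) / (of_nat m)\<^sup>2 = c ^ k * cnj c ^ l / (of_nat m)\<^sup>2 *
        cis (of_int (int N * (int k - int l)) * (\<Sum>j\<in>UNIV. t $ j))"
        by (simp add: power_mult_distrib algebra_simps)
    qed
    finally have *: "of_real ((norm ((\<Sum>k<m. (c * u t) ^ k) / of_nat m))\<^sup>2) = \<dots>" .
    have "of_real (?f t) = (indicator param_box t :: complex) * of_real ((norm ((\<Sum>k<m. (c * u t) ^ k) / of_nat m))\<^sup>2)"
      by (simp add: u_def indicator_def)
    then show ?thesis
      unfolding * by (simp add: G_def scaleR_conv_of_real indicator_def)
  qed
  have "of_real (integral\<^sup>L lborel ?f) = (\<integral>t. (of_real (?f t) :: complex) \<partial>lborel)"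
    by (rule integral_of_real[symmetric], rule borel_integrable_compact)
       (use m in \<open>auto simp: cis_conv_exp intro!: continuous_intros\<close>)
  also have "\<dots> = (\<Sum>k<m. \<Sum>l<m. c ^ k * cnj c ^ l / (of_nat m)\<^sup>2 * integral\<^sup>L lborel (G k l))"
    unfolding expand using int by (simp add: Bochner_Integration.integral_sum)
  also have "\<dots> = (\<Sum>k<m. c ^ k * cnj c ^ k / (of_nat m)\<^sup>2 * of_real (measure lborel (param_box :: (real ^ 'n) set)))"
    unfolding G by (simp add: if_distrib cong: if_cong)
  also have "\<dots> = (\<Sum>k<m. 1 / (of_nat m)\<^sup>2 * of_real (measure lborel (param_box :: (real ^ 'n) set)))"
    by (simp add: power_mult_distrib[symmetric] unimodular_mult_cnj[OF c])
  also have "\<dots> = of_real (measure lborel (param_box :: (real ^ 'n) set) / m)"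
    using m by (simp add: power2_eq_square)
  finally show ?thesis by (simp only: of_real_eq_iff)
qed

lemma norm_average_near_one:
  fixes u :: complex
  assumes u: "norm u \<le> 1" and m: "0 < m" and near: "norm (1 - u) \<le> 1 / (2 * real m)"
  shows "1 / 2 \<le> norm ((\<Sum>k<m. u ^ k) / of_nat m)"
proof -
  have pow: "norm (1 - u ^ k) \<le> real k * norm (1 - u)" for k
    using norm_power_diff[of 1 u k] u by simp
  have "of_nat m - (\<Sum>k<m. u ^ k) = (\<Sum>k<m. 1 - u ^ k)" by (simp add: sum_subtractf)
  also have "norm \<dots> \<le> (\<Sum>k<m. 1 / 2)"
  proof (rule sum_norm_le)
    fix k assume "k \<in> {..<m}"
    then have "real k * norm (1 - u) \<le> real m * (1 / (2 * real m))"
      by (intro mult_mono near) auto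
    then show "norm (1 - u ^ k) \<le> 1 / 2" using pow[of k] m by simp
  qed
  finally have "norm (of_nat m - (\<Sum>k<m. u ^ k)) \<le> real m / 2" by simp
  moreover have "real m \<le> norm (of_nat m - (\<Sum>k<m. u ^ k)) + norm (\<Sum>k<m. u ^ k)"
    using norm_triangle_ineq[of "of_nat m - (\<Sum>k<m. u ^ k)" "\<Sum>k<m. u ^ k"] by simp
  ultimately have "real m / 2 \<le> norm (\<Sum>k<m. u ^ k)" by simp
  then show ?thesis using m by (simp add: norm_divide field_simps)
qed

text \<open>The end points of the radii along which an inner function of the preceding section is not
  controlled.\<close>

definition resonant_set :: "complex \<Rightarrow> nat \<Rightarrow> nat \<Rightarrow> (complex ^ 'n) set" where
  "resonant_set c N m = {\<zeta>\<in>torus. norm (1 + c * coord_prod \<zeta> ^ N) \<le> 1 / (2 * real m)}"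

lemma space_torus_measure: "space torus_measure = torus"
  by (simp add: torus_measure_def space_restrict_space)

lemma closed_torus: "closed torus"
  unfolding torus_def by (intro closed_Collect_all closed_Collect_eq continuous_intros)

lemma resonant_set_measurable: "resonant_set c N m \<in> sets torus_measure"
proof -
  have "continuous_on UNIV (coord_prod :: complex ^ 'a \<Rightarrow> complex)"
    by (intro sv_holomorphic_on_continuous sv_holomorphic_on_coord_prod)
  then have "closed {\<zeta> :: complex ^ 'a. norm (1 + c * coord_prod \<zeta> ^ N) \<le> 1 / (2 * real m)}"
    by (intro closed_Collect_le continuous_intros) auto
  moreover have "resonant_set c N m = torus \<inter> {\<zeta> :: complex ^ 'a. norm (1 + c * coord_prod \<zeta> ^ N) \<le> 1 / (2 * real m)}"
    by (auto simp: resonant_set_def)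
  ultimately show ?thesis
    by (simp add: torus_measure_def sets_restrict_space)
qed

lemma torus_param_measurable_uniform:
  "(\<lambda>t :: real ^ 'n. \<chi> j. cis (t $ j)) \<in> uniform_measure lborel param_box \<rightarrow>\<^sub>M restrict_space borel torus"
proof -
  have "sets (uniform_measure lborel (param_box :: (real ^ 'n) set)) = sets borel" by simp
  from measurable_cong_sets[OF this refl] torus_param_measurable show ?thesis by blast
qed

lemma emeasure_resonant_set_finite:
  "emeasure torus_measure (resonant_set c N m :: (complex ^ 'n) set) < \<infinity>"
proof -
  define T where "T = (\<lambda>t :: real ^ 'n. \<chi> j. cis (t $ j)) -` resonant_set c N m"
  have R: "(resonant_set c N m :: (complex ^ 'n) set) \<in> sets (restrict_space borel torus)"
    using resonant_set_measurable by (simp add: torus_measure_def)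
  have T: "T \<in> sets lborel"
    using measurable_sets[OF torus_param_measurable R] by (simp add: T_def)
  have "emeasure torus_measure (resonant_set c N m :: (complex ^ 'n) set) =
      emeasure (uniform_measure lborel param_box) T"
    unfolding torus_measure_def T_def
    using emeasure_distr[OF torus_param_measurable_uniform R] by simp
  also have "\<dots> = emeasure lborel (param_box \<inter> T) / emeasure lborel (param_box :: (real ^ 'n) set)"
    using T by simp
  also have "\<dots> < \<infinity>"
  proof -
    have "emeasure lborel (param_box \<inter> T) < \<infinity>"
      using emeasure_mono[of "param_box \<inter> T" param_box lborel] emeasure_lborel_cbox_finite
      by (auto intro: le_less_trans)
    moreover have "emeasure lborel (param_box :: (real ^ 'n) set) \<noteq> 0"
      using param_box_measure_pos[where 'n = 'n] by (auto simp: measure_def)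
    ultimately show ?thesis by (simp add: ennreal_divide_eq_top_iff less_top[symmetric])
  qed
  finally show ?thesis .
qed

text \<open>On the resonant set the first \<open>m\<close> powers of \<open>-c M(\<zeta>)^N\<close> are all within \<open>1/2\<close> of \<open>1\<close>, so the square of
  their average is at least \<open>1/4\<close> there; Chebyshev's inequality and the mean square \<open>1/m\<close> give the
  claim.\<close>

lemma measure_resonant_set:
  fixes c :: complex
  assumes c: "norm c = 1" and N: "0 < N" and m: "0 < m"
  shows "measure torus_measure (resonant_set c N m :: (complex ^ 'n) set) \<le> 4 / m"
proof -
  define box where "box = (param_box :: (real ^ 'n) set)"
  define A where "A = {t \<in> box. (\<chi> j. cis (t $ j)) \<in> (resonant_set c N m :: (complex ^ 'n) set)}"
  define f where "f t = indicator box t *\<^sub>R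
      (norm ((\<Sum>k<m. (- c * cis (\<Sum>j\<in>UNIV. t $ j) ^ N) ^ k) / of_nat m))\<^sup>2" for t :: "real ^ 'n"
  have meas: "(\<lambda>t :: real ^ 'n. \<chi> j. cis (t $ j)) \<in> uniform_measure lborel box \<rightarrow>\<^sub>M restrict_space borel torus"
    unfolding box_def by (rule torus_param_measurable_uniform)
  have R: "(resonant_set c N m :: (complex ^ 'n) set) \<in> sets (restrict_space borel torus)"
    using resonant_set_measurable by (simp add: torus_measure_def)
  have pre: "(\<lambda>t :: real ^ 'n. \<chi> j. cis (t $ j)) -` resonant_set c N m \<in> sets lborel"
    using measurable_sets[OF torus_param_measurable R] by simp
  have A_eq: "A = box \<inter> (\<lambda>t. \<chi> j. cis (t $ j)) -` resonant_set c N m" by (auto simp: A_def)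
  have A_sets: "A \<in> sets lborel" unfolding A_eq box_def using pre by auto
  have box_fin: "emeasure lborel box < \<infinity>" unfolding box_def by (rule emeasure_lborel_cbox_finite)
  have box_pos: "measure lborel box > 0" unfolding box_def by (rule param_box_measure_pos)
  have "measure torus_measure (resonant_set c N m :: (complex ^ 'n) set) = measure (uniform_measure lborel box) ((\<lambda>t. \<chi> j. cis (t $ j)) -` resonant_set c N m)"
    unfolding torus_measure_def box_def[symmetric] using measure_distr[OF meas R] by simp
  also have "\<dots> = measure lborel A / measure lborel box"
  proof -
    have "emeasure lborel box \<noteq> 0" "emeasure lborel box \<noteq> \<infinity>"
      using box_pos box_fin by (auto simp: measure_def)
    from measure_uniform_measure[OF this pre] show ?thesis by (simp only: A_eq)
  qed
  also have "measure lborel A = (\<integral>t. indicator A t \<partial>lborel)" by simp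
  also have "\<dots> \<le> (\<integral>t. 4 * f t \<partial>lborel)"
  proof (rule integral_mono)
    show "integrable lborel (indicator A :: _ \<Rightarrow> real)"
      using A_sets emeasure_mono[of A box lborel] box_fin
      by (intro integrable_real_indicator) (auto simp: A_def box_def intro: le_less_trans)
    show "integrable lborel (\<lambda>t. 4 * f t)"
      unfolding f_def box_def
      by (intro integrable_mult_right borel_integrable_compact)
         (use m in \<open>auto simp: cis_conv_exp intro!: continuous_intros\<close>)
    fix t :: "real ^ 'n"
    show "indicator A t \<le> 4 * f t"
    proof (cases "t \<in> A")
      case True
      have "1 / 2 \<le> norm ((\<Sum>k<m. (- c * cis (\<Sum>j\<in>UNIV. t $ j) ^ N) ^ k) / of_nat m)"
        by (rule norm_average_near_one)
           (use True m c in \<open>auto simp: A_def resonant_set_def coord_prod_cis norm_mult norm_power\<close>)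
      then have "(1 / 2)\<^sup>2 \<le> (norm ((\<Sum>k<m. (- c * cis (\<Sum>j\<in>UNIV. t $ j) ^ N) ^ k) / of_nat m))\<^sup>2"
        by (rule power_mono) simp
      then show ?thesis using True by (simp add: f_def A_def power2_eq_square)
    next
      case False
      then show ?thesis by (simp add: f_def)
    qed
  qed
  also have "\<dots> = 4 * (measure lborel box / m)"
  proof -
    have "integral\<^sup>L lborel f = measure lborel box / m"
      unfolding f_def box_def by (rule integral_fejer_kernel) (use c N m in auto)
    then show ?thesis by simp
  qed
  finally show ?thesis using box_pos by (simp add: divide_right_mono)
qed

section \<open>Automorphisms of the polydisk near the distinguished boundary\<close>

lemma polydisk_aut_nth:
  "polydisk_aut \<alpha> \<theta> p z $ j = cis (\<theta> $ j) * ((\<alpha> $ j - z $ p j) / (1 - cnj (\<alpha> $ j) * z $ p j))"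
  by (simp add: polydisk_aut_def)

lemma disc_aut_denominator:
  fixes a z :: complex
  assumes "norm a < 1" "norm z \<le> 1"
  shows "1 - cnj a * z \<noteq> 0"
proof
  assume "1 - cnj a * z = 0"
  then have "norm (cnj a * z) = 1" by (metis eq_iff_diff_eq_0 norm_one)
  moreover have "norm (cnj a * z) < 1"
    using assms mult_left_le[of "norm z" "norm a"] by (simp add: norm_mult)
  ultimately show False by simp
qed

lemma disc_aut_norm_identity:
  fixes a z :: complex
  shows "(norm (1 - cnj a * z))\<^sup>2 - (norm (a - z))\<^sup>2 = (1 - (norm a)\<^sup>2) * (1 - (norm z)\<^sup>2)"
  unfolding cmod_power2 by (simp add: power2_eq_square algebra_simps)

lemma norm_disc_aut:
  fixes a z :: complex
  assumes a: "norm a < 1"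
  shows "norm z \<le> 1 \<Longrightarrow> norm ((a - z) / (1 - cnj a * z)) \<le> 1"
    and "norm z < 1 \<Longrightarrow> norm ((a - z) / (1 - cnj a * z)) < 1"
proof -
  have a2: "1 - (norm a)\<^sup>2 > 0" using a by (simp add: abs_square_less_1)
  show "norm ((a - z) / (1 - cnj a * z)) \<le> 1" if z: "norm z \<le> 1"
  proof -
    have "0 \<le> (1 - (norm a)\<^sup>2) * (1 - (norm z)\<^sup>2)"
      using a z by (intro mult_nonneg_nonneg) (auto simp: abs_square_le_1)
    then have "(norm (a - z))\<^sup>2 \<le> (norm (1 - cnj a * z))\<^sup>2"
      using disc_aut_norm_identity[of a z] by linarith
    then have "norm (a - z) \<le> norm (1 - cnj a * z)" by (rule power2_le_imp_le) simp
    then show ?thesis using disc_aut_denominator[OF a z] by (simp add: norm_divide)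
  qed
  show "norm ((a - z) / (1 - cnj a * z)) < 1" if z: "norm z < 1"
  proof -
    have "0 < (1 - (norm a)\<^sup>2) * (1 - (norm z)\<^sup>2)"
      using a2 z by (intro mult_pos_pos) (auto simp: abs_square_less_1)
    then have "(norm (a - z))\<^sup>2 < (norm (1 - cnj a * z))\<^sup>2"
      using disc_aut_norm_identity[of a z] by linarith
    then have "norm (a - z) < norm (1 - cnj a * z)" by (rule power2_less_imp_less) simp
    then show ?thesis using disc_aut_denominator[OF a] z by (simp add: norm_divide)
  qed
qed

lemma polydisk_aut_closed:
  assumes "\<alpha> \<in> polydisk" "z \<in> closed_polydisk 1"
  shows "polydisk_aut \<alpha> \<theta> p z \<in> closed_polydisk 1"
  unfolding closed_polydisk_def polydisk_aut_nth norm_mult norm_cis mem_Collect_eq mult_1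
  using assms norm_disc_aut(1) by (simp add: polydisk_def closed_polydisk_def)

lemma polydisk_aut_open:
  assumes "\<alpha> \<in> polydisk" "z \<in> polydisk"
  shows "polydisk_aut \<alpha> \<theta> p z \<in> polydisk"
  unfolding polydisk_def polydisk_aut_nth norm_mult norm_cis mem_Collect_eq mult_1
  using assms norm_disc_aut(2) by (simp add: polydisk_def)

lemma polydisk_aut_holomorphic:
  assumes "\<alpha> \<in> polydisk"
  shows "sv_holomorphic_on (\<lambda>z. polydisk_aut \<alpha> \<theta> p z $ j) (closed_polydisk 1)"
  unfolding polydisk_aut_nth
  by (intro sv_intros)
     (use assms disc_aut_denominator in \<open>auto simp: polydisk_def closed_polydisk_def\<close>)

lemma polydisk_aut_continuous:
  assumes "\<alpha> \<in> polydisk"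
  shows "continuous_on (closed_polydisk 1) (polydisk_aut \<alpha> \<theta> p)"
proof -
  have "continuous_on (closed_polydisk 1) (\<lambda>z. \<chi> j. polydisk_aut \<alpha> \<theta> p z $ j)"
    by (intro continuous_on_vec_lambda sv_holomorphic_on_continuous polydisk_aut_holomorphic assms)
  then show ?thesis by simp
qed

lemma disc_aut_involution:
  fixes a z :: complex
  assumes "norm a < 1" "norm z \<le> 1"
  defines "m \<equiv> (a - z) / (1 - cnj a * z)"
  shows "(a - m) / (1 - cnj a * m) = z"
proof -
  have d: "1 - cnj a * z \<noteq> 0" by (rule disc_aut_denominator[OF assms(1,2)])
  have a: "1 - cnj a * a \<noteq> 0" by (rule disc_aut_denominator) (use assms in auto)
  have "a - m = z * (1 - cnj a * a) / (1 - cnj a * z)"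
    using d by (simp add: m_def field_simps)
  moreover have "1 - cnj a * m = (1 - cnj a * a) / (1 - cnj a * z)"
    using d by (simp add: m_def field_simps)
  ultimately show ?thesis using d a by simp
qed

text \<open>Each disk factor \<open>(a - z) / (1 - cnj a z)\<close> is an involution; moving the rotation to the other side
  gives the same kind of map with the parameter \<open>a\<close> rotated and the coordinates permuted back.\<close>

lemma polydisk_aut_inverse:
  fixes \<alpha> :: "complex ^ 'n"
  assumes \<alpha>: "\<alpha> \<in> polydisk" and p: "p permutes UNIV"
  obtains \<alpha>' \<theta>' p' where "\<alpha>' \<in> polydisk"
    "\<And>z. z \<in> closed_polydisk 1 \<Longrightarrow> polydisk_aut \<alpha>' \<theta>' p' (polydisk_aut \<alpha> \<theta> p z) = z"
proof
  define q where "q = inv p"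
  define \<alpha>' where "\<alpha>' = (\<chi> i. cis (\<theta> $ q i) * \<alpha> $ q i)"
  define \<theta>' where "\<theta>' = (\<chi> i. - \<theta> $ q i)"
  show "\<alpha>' \<in> polydisk" using \<alpha> by (simp add: polydisk_def \<alpha>'_def norm_mult)
  fix z :: "complex ^ 'n" assume z: "z \<in> closed_polydisk 1"
  show "polydisk_aut \<alpha>' \<theta>' q (polydisk_aut \<alpha> \<theta> p z) = z"
    unfolding vec_eq_iff
  proof
    fix i
    have pq: "p (q i) = i" using permutes_inverses[OF p] by (simp add: q_def)
    define a m u where "a = \<alpha> $ q i" and "m = (a - z $ i) / (1 - cnj a * z $ i)" and "u = cis (\<theta> $ q i)"
    have w: "polydisk_aut \<alpha> \<theta> p z $ q i = u * m"
      by (simp add: polydisk_aut_nth pq a_def m_def u_def)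
    have u: "u * cnj u = 1" by (rule unimodular_mult_cnj) (simp add: u_def)
    have "polydisk_aut \<alpha>' \<theta>' q (polydisk_aut \<alpha> \<theta> p z) $ i
        = cnj u * ((u * a - u * m) / (1 - cnj (u * a) * (u * m)))"
      unfolding polydisk_aut_nth[of \<alpha>'] w by (simp add: \<alpha>'_def \<theta>'_def a_def u_def cis_cnj)
    also have "cnj (u * a) * (u * m) = (u * cnj u) * (cnj a * m)" by (simp add: mult_ac)
    also have "cnj u * ((u * a - u * m) / (1 - (u * cnj u) * (cnj a * m)))
        = (u * cnj u) * (a - m) / (1 - (u * cnj u) * (cnj a * m))"
      by (simp add: algebra_simps)
    also have "\<dots> = (a - m) / (1 - cnj a * m)" unfolding u by simp
    also have "\<dots> = z $ i"
      unfolding m_def by (rule disc_aut_involution)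
        (use \<alpha> z in \<open>auto simp: a_def polydisk_def closed_polydisk_def\<close>)
    finally show "polydisk_aut \<alpha>' \<theta>' q (polydisk_aut \<alpha> \<theta> p z) $ i = z $ i" .
  qed
qed

text \<open>As \<open>\<bar>a\<bar> \<longrightarrow> 1\<close>, the involution collapses compact subsets of the disk to the point \<open>a\<close>.\<close>

lemma disc_aut_near_constant:
  fixes a z :: complex
  assumes a: "norm a < 1" and z: "norm z \<le> \<rho>" and \<rho>: "\<rho> < 1"
  shows "norm ((a - z) / (1 - cnj a * z) - a) \<le> (1 - (norm a)\<^sup>2) / (1 - \<rho>)"
proof -
  have d: "1 - cnj a * z \<noteq> 0" by (rule disc_aut_denominator) (use assms in auto)
  have "(a - z) / (1 - cnj a * z) - a = z * (a * cnj a - 1) / (1 - cnj a * z)"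
    using d by (simp add: field_simps)
  also have "a * cnj a - 1 = of_real ((norm a)\<^sup>2 - 1)"
    using complex_norm_square[of a] by simp
  finally have "norm ((a - z) / (1 - cnj a * z) - a) = norm z * \<bar>(norm a)\<^sup>2 - 1\<bar> / norm (1 - cnj a * z)"
    by (simp only: norm_mult norm_divide norm_of_real)
  also have "\<bar>(norm a)\<^sup>2 - 1\<bar> = 1 - (norm a)\<^sup>2"
    using a abs_square_less_1[of "norm a"] by simp
  also have "norm z * (1 - (norm a)\<^sup>2) / norm (1 - cnj a * z) \<le> 1 * (1 - (norm a)\<^sup>2) / (1 - \<rho>)"
  proof (rule frac_le)
    show "norm z * (1 - (norm a)\<^sup>2) \<le> 1 * (1 - (norm a)\<^sup>2)"
      using a z \<rho> abs_square_less_1[of "norm a"] by (intro mult_right_mono) auto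
    have "norm (cnj a * z) \<le> 1 * \<rho>" unfolding norm_mult using a z by (intro mult_mono) auto
    then show "1 - \<rho> \<le> norm (1 - cnj a * z)" using norm_triangle_ineq2[of 1 "cnj a * z"] by simp
    show "0 \<le> 1 * (1 - (norm a)\<^sup>2)" using a abs_square_less_1[of "norm a"] by simp
  qed (use \<rho> in simp)
  finally show ?thesis by simp
qed

text \<open>The rotations need not converge, but by compactness of the torus a subsequence of them does, and a
  subsequence is enough for the density of the orbit.\<close>

lemma polydisk_aut_limit_point:
  fixes \<alpha> :: "nat \<Rightarrow> complex ^ 'n"
  assumes \<alpha>: "\<And>k. \<alpha> k \<in> polydisk" and lim: "\<alpha> \<longlonglongrightarrow> a" and a: "a \<in> torus"
  obtains \<beta> where "\<beta> \<in> torus"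
    "\<And>\<rho> \<delta>. \<rho> < 1 \<Longrightarrow> 0 < \<delta> \<Longrightarrow>
       \<exists>k. \<forall>z\<in>closed_polydisk \<rho>. dist (polydisk_aut (\<alpha> k) (\<theta> k) (p k) z) \<beta> < \<delta>"
proof -
  define v where "v k = (\<chi> j. cis (\<theta> k $ j))" for k
  have "compact (torus :: (complex ^ 'n) set)"
    using compact_closed_polydisk[of 1] closed_torus torus_subset_closed
    by (metis closed_Int_compact inf.absorb_iff1)
  moreover have "\<And>k. v k \<in> torus" by (simp add: v_def torus_def)
  ultimately obtain u r where u: "u \<in> torus" "strict_mono r" "(v \<circ> r) \<longlonglongrightarrow> u"
    unfolding compact_def by metis
  define \<beta> where "\<beta> = (\<chi> j. u $ j * a $ j)"
  have "\<beta> \<in> torus" using u a by (simp add: \<beta>_def torus_def norm_mult)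
  moreover have "\<exists>k. \<forall>z\<in>closed_polydisk \<rho>. dist (polydisk_aut (\<alpha> k) (\<theta> k) (p k) z) \<beta> < \<delta>"
    if \<rho>: "\<rho> < 1" and \<delta>: "0 < \<delta>" for \<rho> \<delta> :: real
  proof -
    define b where "b k = (\<Sum>j\<in>UNIV. (1 - (norm (\<alpha> (r k) $ j))\<^sup>2) / (1 - \<rho>)
        + norm (v (r k) $ j * \<alpha> (r k) $ j - \<beta> $ j))" for k
    have \<alpha>r: "(\<lambda>k. \<alpha> (r k)) \<longlonglongrightarrow> a" using LIMSEQ_subseq_LIMSEQ[OF lim u(2)] by (simp add: comp_def)
    have vr: "(\<lambda>k. v (r k)) \<longlonglongrightarrow> u" using u(3) by (simp add: comp_def)
    have "b \<longlonglongrightarrow> (\<Sum>j\<in>UNIV. (1 - (norm (a $ j))\<^sup>2) / (1 - \<rho>) + norm (u $ j * a $ j - \<beta> $ j))"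
      unfolding b_def by (intro tendsto_intros \<alpha>r vr) (use \<rho> in auto)
    also have "(\<Sum>j\<in>UNIV. (1 - (norm (a $ j))\<^sup>2) / (1 - \<rho>) + norm (u $ j * a $ j - \<beta> $ j)) = 0"
      using a by (simp add: torus_def \<beta>_def)
    finally have "\<forall>\<^sub>F k in sequentially. b k < \<delta>" using \<delta> by (rule order_tendstoD)
    then obtain k where k: "b k < \<delta>" unfolding eventually_sequentially by blast
    have "dist (polydisk_aut (\<alpha> (r k)) (\<theta> (r k)) (p (r k)) z) \<beta> < \<delta>"
      if z: "z \<in> closed_polydisk \<rho>" for z
    proof -
      let ?w = "polydisk_aut (\<alpha> (r k)) (\<theta> (r k)) (p (r k)) z"
      have "dist ?w \<beta> \<le> (\<Sum>j\<in>UNIV. norm ((?w - \<beta>) $ j))"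
        unfolding dist_norm by (rule norm_le_sum_norm_nth)
      also have "\<dots> \<le> b k"
        unfolding b_def
      proof (rule sum_mono)
        fix j
        define m where "m = (\<alpha> (r k) $ j - z $ p (r k) j) / (1 - cnj (\<alpha> (r k) $ j) * z $ p (r k) j)"
        have "(?w - \<beta>) $ j = v (r k) $ j * (m - \<alpha> (r k) $ j) + (v (r k) $ j * \<alpha> (r k) $ j - \<beta> $ j)"
          by (simp add: polydisk_aut_nth m_def v_def algebra_simps)
        also have "norm \<dots> \<le> norm (v (r k) $ j * (m - \<alpha> (r k) $ j)) + norm (v (r k) $ j * \<alpha> (r k) $ j - \<beta> $ j)"
          by (rule norm_triangle_ineq)
        also have "norm (v (r k) $ j * (m - \<alpha> (r k) $ j)) = norm (m - \<alpha> (r k) $ j)"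
          by (simp add: norm_mult v_def)
        also have "\<dots> \<le> (1 - (norm (\<alpha> (r k) $ j))\<^sup>2) / (1 - \<rho>)"
          unfolding m_def by (rule disc_aut_near_constant)
            (use \<alpha> z \<rho> in \<open>auto simp: polydisk_def closed_polydisk_def\<close>)
        finally show "norm ((?w - \<beta>) $ j) \<le> (1 - (norm (\<alpha> (r k) $ j))\<^sup>2) / (1 - \<rho>)
            + norm (v (r k) $ j * \<alpha> (r k) $ j - \<beta> $ j)" by simp
      qed
      finally show ?thesis using k by simp
    qed
    then show ?thesis by blast
  qed
  ultimately show ?thesis using that by blast
qed

section \<open>A single factor\<close>

text \<open>This lemma and the next one pass between the unit disk and the half-plane \<open>Re T \<ge> 1\<close> by
  \<open>w = 1 - 2/T\<close>. The half-plane is stable under adding numbers of nonnegative real part.\<close>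

lemma Re_two_over_one_minus:
  assumes "norm w < 1"
  shows "1 \<le> Re (2 / (1 - w))"
proof -
  have ne: "1 - w \<noteq> 0" using assms by auto
  then have pos: "0 < (norm (1 - w))\<^sup>2" by simp
  have "(norm w)\<^sup>2 \<le> 1" using assms by (simp add: abs_square_le_1)
  then have "(norm (1 - w))\<^sup>2 \<le> 2 * Re (1 - w)"
    unfolding cmod_power2 by (simp add: power2_eq_square algebra_simps)
  moreover have "Re (2 / (1 - w)) = 2 * Re (1 - w) / (norm (1 - w))\<^sup>2"
    by (simp add: Re_divide cmod_power2)
  ultimately show ?thesis using pos by simp
qed

lemma norm_one_minus_two_over:
  assumes "1 \<le> Re T"
  shows "norm (1 - 2 / T) \<le> 1"
proof -
  have T: "T \<noteq> 0" using assms by auto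
  have "(norm (T - 2))\<^sup>2 \<le> (norm T)\<^sup>2"
    unfolding cmod_power2 using assms by (simp add: power2_eq_square algebra_simps)
  then have "norm (T - 2) \<le> norm T" by (rule power2_le_imp_le) simp
  moreover have "1 - 2 / T = (T - 2) / T" using T by (simp add: field_simps)
  ultimately show ?thesis using T by (simp add: norm_divide)
qed

text \<open>The factor \<open>x\<close> imitates \<open>v \<circ> \<phi>\<^sub>k\<inverse>\<close> near \<open>\<beta>\<close> and is close to \<open>1\<close> both on
  \<open>closed_polydisk \<sigma>\<close> and along every radius whose end point avoids the small set \<open>E\<close>. The
  constant \<open>C\<close> is fixed before \<open>k\<close>: it depends on \<open>\<sigma>\<close>, \<open>e\<close> and \<open>m\<close> only, whereas \<open>k\<close> has to bring \<open>W\<close>,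
  which contains \<open>C\<close>, close to zero on the image of \<open>closed_polydisk \<rho>\<close>.\<close>

lemma universal_factor:
  fixes \<phi> :: "nat \<Rightarrow> complex ^ 'n \<Rightarrow> complex ^ 'n" and Y v :: "complex ^ 'n \<Rightarrow> complex" and m :: nat
  assumes \<alpha>: "\<And>k. \<alpha> k \<in> polydisk" and p: "\<And>k. p k permutes UNIV"
    and \<phi>: "\<And>k. \<phi> k = polydisk_aut (\<alpha> k) (\<theta> k) (p k)"
    and \<beta>: "\<beta> \<in> torus"
    and conv: "\<And>\<rho> \<delta>. \<rho> < 1 \<Longrightarrow> 0 < \<delta> \<Longrightarrow> \<exists>k. \<forall>z\<in>closed_polydisk \<rho>. dist (\<phi> k z) \<beta> < \<delta>"
    and Y: "continuous_on (closed_polydisk 1) Y" "Y \<beta> = 1"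
    and v: "sv_holomorphic_on v (closed_polydisk 1)" "\<And>z. z \<in> closed_polydisk 1 \<Longrightarrow> norm (v z) < 1"
    and \<rho>: "\<rho> < 1" and \<sigma>: "\<sigma> < 1" and e: "0 < e" "e \<le> 1" and m: "0 < m"
  obtains x k E where "closed_inner x" "x \<beta> = 1"
    "\<And>z. z \<in> closed_polydisk \<sigma> \<Longrightarrow> norm (x z - 1) \<le> e"
    "\<And>z. z \<in> closed_polydisk \<rho> \<Longrightarrow> norm (x (\<phi> k z) - v z) \<le> e"
    "\<And>z. z \<in> closed_polydisk \<rho> \<Longrightarrow> norm (Y (\<phi> k z) - 1) \<le> e"
    "E \<in> sets torus_measure" "emeasure torus_measure E < \<infinity>" "measure torus_measure E \<le> 8 / m"
    "\<And>\<zeta> r. \<zeta> \<in> torus \<Longrightarrow> \<zeta> \<notin> E \<Longrightarrow> 0 \<le> r \<Longrightarrow> r \<le> 1 \<Longrightarrow> norm (x (r *\<^sub>R \<zeta>) - 1) \<le> e"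
proof -
  define q where "q = real m"
  have q: "1 \<le> q" using m by (simp add: q_def)
  define \<eta> where "\<eta> = (e / 2) / (64 * q)"
  have \<eta>: "0 < \<eta>" using e q by (simp add: \<eta>_def)
  have \<eta>e: "\<eta> \<le> e / 2"
  proof -
    have "e / 2 * 1 \<le> e / 2 * (64 * q)" using e q by (intro mult_left_mono) auto
    then show ?thesis using q by (simp add: \<eta>_def field_simps)
  qed
  \<comment> \<open>The first bound serves the compact set, the second one the radii outside the resonant set of \<open>- cnj \<mu>\<close>.\<close>
  define C where "C = max (2 / (\<eta> * (1 - \<sigma>))) (32 * q\<^sup>2 / \<eta>)"
  have C1: "2 \<le> \<eta> * (C * (1 - \<sigma>))"
  proof -
    have "2 / (\<eta> * (1 - \<sigma>)) \<le> C" by (simp add: C_def)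
    then show ?thesis using \<eta> \<sigma> by (simp add: field_simps)
  qed
  have C2: "32 * q\<^sup>2 \<le> \<eta> * C"
  proof -
    have "32 * q\<^sup>2 / \<eta> \<le> C" by (simp add: C_def)
    then show ?thesis using \<eta> by (simp add: field_simps)
  qed
  have C: "0 < C"
  proof -
    have "0 < 32 * q\<^sup>2 / \<eta>" using q \<eta> by simp
    then show ?thesis unfolding C_def by linarith
  qed
  define \<mu> where "\<mu> = coord_prod \<beta>"
  have \<mu>: "norm \<mu> = 1" using \<beta> by (simp add: \<mu>_def norm_coord_prod_torus)
  define W where "W = (\<lambda>z :: complex ^ 'n. of_real C * (1 - cnj \<mu> * coord_prod z))"
  have W_hol: "sv_holomorphic_on W S" for S
    unfolding W_def by (intro sv_intros sv_holomorphic_on_coord_prod)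
  have W_\<beta>: "W \<beta> = 0" using unimodular_mult_cnj[OF \<mu>] by (simp add: W_def \<mu>_def mult.commute)
  have ReW: "Re (W z) \<ge> C * (1 - t)" if "norm (coord_prod z) \<le> t" for z t
  proof -
    have "Re (cnj \<mu> * coord_prod z) \<le> norm (cnj \<mu> * coord_prod z)" by (rule complex_Re_le_cmod)
    also have "\<dots> \<le> t" using that \<mu> by (simp add: norm_mult)
    finally show ?thesis using C by (simp add: W_def)
  qed
  have ReW0: "Re (W z) \<ge> 0" if "z \<in> closed_polydisk 1" for z
    using ReW[OF norm_coord_prod_le[OF that]] by simp
  have "\<exists>\<delta>>0. \<forall>z\<in>closed_polydisk 1. dist z \<beta> < \<delta> \<longrightarrow> dist (g z) (g \<beta>) < d"
    if "continuous_on (closed_polydisk 1) g" "0 < d" for g :: "complex ^ 'n \<Rightarrow> complex" and d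
    using that \<beta> torus_subset_closed unfolding continuous_on_iff by blast
  from this[OF sv_holomorphic_on_continuous[OF W_hol], of "e / 4"] this[OF Y(1), of e]
  obtain \<delta>1 \<delta>2 where \<delta>: "0 < \<delta>1" "0 < \<delta>2"
    "\<And>z. z \<in> closed_polydisk 1 \<Longrightarrow> dist z \<beta> < \<delta>1 \<Longrightarrow> dist (W z) (W \<beta>) < e / 4"
    "\<And>z. z \<in> closed_polydisk 1 \<Longrightarrow> dist z \<beta> < \<delta>2 \<Longrightarrow> dist (Y z) (Y \<beta>) < e"
    using e by auto
  obtain k where k: "\<And>z. z \<in> closed_polydisk \<rho> \<Longrightarrow> dist (\<phi> k z) \<beta> < min \<delta>1 \<delta>2"
    using conv[OF \<rho>, of "min \<delta>1 \<delta>2"] \<delta> by auto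
  have \<rho>1: "closed_polydisk \<rho> \<subseteq> closed_polydisk 1" using \<rho> by (intro closed_polydisk_mono) simp
  have \<phi>1: "\<phi> k z \<in> closed_polydisk 1" if "z \<in> closed_polydisk \<rho>" for z
    using that \<rho>1 \<alpha> polydisk_aut_closed unfolding \<phi> by blast
  have Wk: "norm (W (\<phi> k z)) \<le> e / 4" if "z \<in> closed_polydisk \<rho>" for z
    using \<delta>(3)[OF \<phi>1[OF that]] k[OF that] W_\<beta> by simp
  have Yk: "norm (Y (\<phi> k z) - 1) \<le> e" if "z \<in> closed_polydisk \<rho>" for z
    using \<delta>(4)[OF \<phi>1[OF that]] k[OF that] Y(2) by (simp add: dist_norm)
  obtain \<alpha>' \<theta>' p' where \<alpha>': "\<alpha>' \<in> polydisk"
    and inverse: "\<And>z. z \<in> closed_polydisk 1 \<Longrightarrow> polydisk_aut \<alpha>' \<theta>' p' (\<phi> k z) = z"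
    using polydisk_aut_inverse[OF \<alpha> p] unfolding \<phi> by metis
  define \<psi> where "\<psi> = polydisk_aut \<alpha>' \<theta>' p'"
  define w where "w = (\<lambda>z. v (\<psi> z))"
  have \<psi>: "\<psi> z \<in> closed_polydisk 1" if "z \<in> closed_polydisk 1" for z
    using polydisk_aut_closed[OF \<alpha>' that] by (simp add: \<psi>_def)
  have w1: "norm (w z) < 1" if "z \<in> closed_polydisk 1" for z
    using v(2)[OF \<psi>[OF that]] by (simp add: w_def)
  have w_hol: "sv_holomorphic_on w (closed_polydisk 1)"
    unfolding w_def
    by (rule sv_holomorphic_on_compose[OF v(1) \<psi>])
       (auto simp: \<psi>_def intro: polydisk_aut_holomorphic[OF \<alpha>'])
  define T where "T = (\<lambda>z. 2 / (1 - w z) + W z)"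
  have ReT: "1 + Re (W z) \<le> Re (T z)" if "z \<in> closed_polydisk 1" for z
    using Re_two_over_one_minus[OF w1[OF that]] by (simp add: T_def)
  have ReT1: "1 \<le> Re (T z)" if "z \<in> closed_polydisk 1" for z
    using ReT[OF that] ReW0[OF that] by simp
  define h where "h = (\<lambda>z. 1 - 2 / T z)"
  have h_hol: "sv_holomorphic_on h (closed_polydisk 1)"
    unfolding h_def
  proof (intro sv_intros)
    show "sv_holomorphic_on T (closed_polydisk 1)"
      unfolding T_def by (intro sv_intros w_hol W_hol) (use w1 in force)
    show "T z \<noteq> 0" if "z \<in> closed_polydisk 1" for z using ReT1[OF that] by auto
  qed
  have h1: "norm (h z) \<le> 1" if "z \<in> closed_polydisk 1" for z
    unfolding h_def using ReT1[OF that] by (rule norm_one_minus_two_over)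
  have h_near: "norm (h z - 1) \<le> \<eta>" if z: "z \<in> closed_polydisk 1" and "2 \<le> \<eta> * Re (W z)" for z
  proof -
    have pos: "0 < Re (T z)" using ReT1[OF z] by simp
    have "norm (h z - 1) = 2 / norm (T z)" by (simp add: h_def norm_divide)
    also have "\<dots> \<le> 2 / Re (T z)" using pos complex_Re_le_cmod[of "T z"] by (intro frac_le) auto
    also have "\<dots> \<le> \<eta>"
    proof -
      have "\<eta> * Re (W z) \<le> \<eta> * Re (T z)" using ReT[OF z] \<eta> by (intro mult_left_mono) auto
      then have "2 \<le> \<eta> * Re (T z)" using that(2) by simp
      then show ?thesis using pos by (simp add: field_simps)
    qed
    finally show ?thesis .
  qed
  have hk: "norm (h (\<phi> k z) - v z) \<le> e / 2" if z: "z \<in> closed_polydisk \<rho>" for z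
  proof -
    have z1: "z \<in> closed_polydisk 1" using z \<rho>1 by blast
    \<comment> \<open>In the half-plane the two functions differ by \<open>W\<close>, and \<open>T \<mapsto> 2 / T\<close> is \<open>2\<close>-Lipschitz there.\<close>
    define U where "U = 2 / (1 - v z)"
    have U: "1 \<le> Re U" unfolding U_def by (rule Re_two_over_one_minus[OF v(2)[OF z1]])
    have wz: "w (\<phi> k z) = v z" using inverse[OF z1] by (simp add: w_def \<psi>_def)
    then have Tz: "T (\<phi> k z) = U + W (\<phi> k z)" by (simp add: T_def U_def)
    have T1: "1 \<le> Re (U + W (\<phi> k z))" using ReT1[OF \<phi>1[OF z]] by (simp only: Tz)
    have nz: "U \<noteq> 0" "U + W (\<phi> k z) \<noteq> 0"
      using U T1 by (metis not_one_le_zero zero_complex.simps(1))+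
    have nv: "1 - v z \<noteq> 0" using v(2)[OF z1] by auto
    then have "v z = 1 - 2 / U" by (simp add: U_def diff_divide_distrib)
    then have "h (\<phi> k z) - v z = 2 / U - 2 / (U + W (\<phi> k z))" by (simp add: h_def Tz)
    also have "\<dots> = 2 * W (\<phi> k z) / (U * (U + W (\<phi> k z)))"
      using nz by (simp add: field_simps)
    finally have "norm (h (\<phi> k z) - v z) = 2 * norm (W (\<phi> k z)) / (norm U * norm (U + W (\<phi> k z)))"
      by (simp add: norm_divide norm_mult)
    also have "\<dots> \<le> 2 * norm (W (\<phi> k z)) / 1"
    proof (rule frac_le)
      have "1 \<le> norm U" "1 \<le> norm (U + W (\<phi> k z))"
        using U T1 complex_Re_le_cmod order_trans by blast+
      then show "1 \<le> norm U * norm (U + W (\<phi> k z))" using mult_mono[of 1 "norm U" 1] by simp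
    qed auto
    also have "\<dots> \<le> e / 2" using Wk[OF z] by simp
    finally show ?thesis .
  qed
  have "compact (\<phi> k ` closed_polydisk \<rho>)"
    unfolding \<phi>
    by (intro compact_continuous_image compact_closed_polydisk
        continuous_on_subset[OF polydisk_aut_continuous[OF \<alpha>] \<rho>1])
  moreover have "\<phi> k ` closed_polydisk \<rho> \<subseteq> polydisk"
    using closed_polydisk_subset_polydisk[OF \<rho>] polydisk_aut_open[OF \<alpha>] unfolding \<phi> by blast
  ultimately obtain s where s: "s < 1" "\<phi> k ` closed_polydisk \<rho> \<subseteq> closed_polydisk s"
    using compact_subset_polydisk by metis
  have "max \<sigma> s < 1" "0 < e / 2" "e / 2 \<le> 1" using \<sigma> s e by auto
  from inner_approximation[OF h_hol h1 \<beta> this q]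
  obtain x \<gamma> N where x: "closed_inner x" "x \<beta> = 1"
    "\<And>z. z \<in> closed_polydisk (max \<sigma> s) \<Longrightarrow> norm (x z - h z) \<le> e / 2"
    and \<gamma>: "norm \<gamma> = 1" "0 < N"
    and far: "\<And>\<zeta> r. \<lbrakk>\<zeta> \<in> torus; 1 / (2 * q) < norm (1 + \<gamma> * coord_prod \<zeta> ^ N);
       \<And>r. 0 \<le> r \<Longrightarrow> r \<le> 1 \<Longrightarrow> norm (h (r *\<^sub>R \<zeta>) - 1) \<le> e / 2 / (64 * q); 0 \<le> r; r \<le> 1\<rbrakk>
       \<Longrightarrow> norm (x (r *\<^sub>R \<zeta>) - 1) \<le> e / 2"
    by metis
  \<comment> \<open>The first set is where \<open>x\<close> may leave \<open>1\<close> although \<open>h\<close> does not, the second where \<open>h\<close> itself may leave \<open>1\<close>.\<close>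
  define E where "E = (resonant_set \<gamma> N m \<union> resonant_set (- cnj \<mu>) 1 m :: (complex ^ 'n) set)"
  show ?thesis
  proof
    show "closed_inner x" "x \<beta> = 1" by fact+
    show "norm (x z - 1) \<le> e" if z: "z \<in> closed_polydisk \<sigma>" for z
    proof -
      have "2 \<le> \<eta> * Re (W z)"
        using C1 mult_left_mono[OF ReW[OF norm_coord_prod_le[OF z]] less_imp_le[OF \<eta>]] \<sigma> by simp
      moreover have "z \<in> closed_polydisk 1" using z \<sigma> closed_polydisk_mono[of \<sigma> 1] by auto
      ultimately have "norm (h z - 1) \<le> e / 2" using h_near \<eta>e by fastforce
      moreover have "norm (x z - h z) \<le> e / 2"
        using z closed_polydisk_mono[of \<sigma> "max \<sigma> s"] by (intro x(3)) auto
      ultimately show ?thesis using norm_triangle_ineq[of "x z - h z" "h z - 1"] by simp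
    qed
    show "norm (x (\<phi> k z) - v z) \<le> e" if z: "z \<in> closed_polydisk \<rho>" for z
    proof -
      have "norm (x (\<phi> k z) - h (\<phi> k z)) \<le> e / 2"
        using z s(2) closed_polydisk_mono[of s "max \<sigma> s"] by (intro x(3)) auto
      then show ?thesis
        using hk[OF z] norm_triangle_ineq[of "x (\<phi> k z) - h (\<phi> k z)" "h (\<phi> k z) - v z"] by simp
    qed
    show "norm (Y (\<phi> k z) - 1) \<le> e" if "z \<in> closed_polydisk \<rho>" for z using Yk[OF that] .
    show "E \<in> sets torus_measure" unfolding E_def by (intro sets.Un resonant_set_measurable)
    show "emeasure torus_measure E < \<infinity>"
    proof -
      have "emeasure torus_measure E \<le> emeasure torus_measure (resonant_set \<gamma> N m :: (complex ^ 'n) set)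
          + emeasure torus_measure (resonant_set (- cnj \<mu>) 1 m :: (complex ^ 'n) set)"
        unfolding E_def by (intro emeasure_subadditive resonant_set_measurable)
      also have "\<dots> < \<infinity>"
        using emeasure_resonant_set_finite[where 'n = 'n]
        by (metis ennreal_add_less_top infinity_ennreal_def)
      finally show ?thesis .
    qed
    show "measure torus_measure E \<le> 8 / m"
    proof -
      have "measure torus_measure E \<le> measure torus_measure (resonant_set \<gamma> N m :: (complex ^ 'n) set)
          + measure torus_measure (resonant_set (- cnj \<mu>) 1 m :: (complex ^ 'n) set)"
        unfolding E_def by (intro measure_Un_le resonant_set_measurable)
      also have "\<dots> \<le> 4 / m + 4 / m"
        by (intro add_mono measure_resonant_set) (use \<gamma> \<mu> m in auto)
      finally show ?thesis by simp
    qed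
    fix \<zeta> :: "complex ^ 'n" and r :: real
    assume \<zeta>: "\<zeta> \<in> torus" "\<zeta> \<notin> E" and r: "0 \<le> r" "r \<le> 1"
    have "norm (h (t *\<^sub>R \<zeta>) - 1) \<le> e / 2 / (64 * q)" if t: "0 \<le> t" "t \<le> 1" for t
    proof -
      define u where "u = cnj \<mu> * coord_prod \<zeta>"
      define a where "a = t ^ CARD('n)"
      have a: "0 \<le> a" "a \<le> 1" using t by (auto simp: a_def power_le_one)
      have u1: "norm u = 1" using \<mu> \<zeta> by (simp add: u_def norm_mult norm_coord_prod_torus)
      have "1 / (2 * q) < norm (1 - u)"
        using \<zeta> by (simp add: E_def resonant_set_def u_def q_def)
      then have "(1 / (2 * q))\<^sup>2 \<le> (norm (1 - u))\<^sup>2" using q by (intro power_mono) auto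
      also have "(norm (1 - u))\<^sup>2 = 2 * (1 - Re u)"
      proof -
        have "(Re u)\<^sup>2 + (Im u)\<^sup>2 = 1" using u1 by (simp add: cmod_power2[symmetric])
        then show ?thesis unfolding cmod_power2 by (simp add: power2_eq_square algebra_simps)
      qed
      finally have far_u: "1 / (4 * q\<^sup>2) \<le> 2 * (1 - Re u)" by (simp add: power2_eq_square)
      have "(1 - Re u) / 2 \<le> 1 - a * Re u"
      proof (cases "0 \<le> Re u")
        case True
        then have "a * Re u \<le> 1 * Re u" using a by (intro mult_right_mono) auto
        moreover have "Re u \<le> 1" using complex_Re_le_cmod[of u] u1 by simp
        ultimately show ?thesis by (simp add: field_simps)
      next
        case False
        then have "a * Re u \<le> 0" using a by (simp add: mult_nonneg_nonpos)
        moreover have "- 1 \<le> Re u" using abs_Re_le_cmod[of u] u1 by simp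
        ultimately show ?thesis by (simp add: field_simps)
      qed
      then have "1 / (16 * q\<^sup>2) \<le> 1 - a * Re u" using far_u by simp
      moreover have "Re (W (t *\<^sub>R \<zeta>)) = C * (1 - a * Re u)"
      proof -
        have "cnj \<mu> * coord_prod (t *\<^sub>R \<zeta>) = of_real a * u"
          by (simp add: coord_prod_scaleR a_def u_def)
        then show ?thesis by (simp add: W_def)
      qed
      ultimately have "C * (1 / (16 * q\<^sup>2)) \<le> Re (W (t *\<^sub>R \<zeta>))"
        using C by (metis less_imp_le mult_left_mono)
      then have "\<eta> * (C * (1 / (16 * q\<^sup>2))) \<le> \<eta> * Re (W (t *\<^sub>R \<zeta>))" using \<eta> by (intro mult_left_mono) auto
      moreover have "2 \<le> \<eta> * (C * (1 / (16 * q\<^sup>2)))" using C2 q by (simp add: field_simps)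
      ultimately have "2 \<le> \<eta> * Re (W (t *\<^sub>R \<zeta>))" by simp
      moreover have "t *\<^sub>R \<zeta> \<in> closed_polydisk 1"
        using \<zeta> t by (auto simp: torus_def closed_polydisk_def)
      ultimately show ?thesis using h_near by (simp add: \<eta>_def)
    qed
    moreover have "1 / (2 * q) < norm (1 + \<gamma> * coord_prod \<zeta> ^ N)"
      using \<zeta> by (simp add: E_def resonant_set_def q_def)
    ultimately have "norm (x (r *\<^sub>R \<zeta>) - 1) \<le> e / 2" using \<zeta>(1) r by (intro far)
    then show "norm (x (r *\<^sub>R \<zeta>) - 1) \<le> e" using e by simp
  qed
qed

section \<open>Infinite products of inner functions\<close>

lemma tendsto_radial:
  fixes f :: "complex ^ 'n \<Rightarrow> complex"
  assumes f: "continuous_on (closed_polydisk 1) f" and \<zeta>: "\<zeta> \<in> torus"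
  shows "((\<lambda>r. f (r *\<^sub>R \<zeta>)) \<longlongrightarrow> f \<zeta>) (at_left 1)"
proof (rule tendstoI)
  fix e :: real assume "e > 0"
  then obtain r0 where r0: "0 < r0" "r0 < 1"
      "\<And>z r. z \<in> closed_polydisk 1 \<Longrightarrow> r0 \<le> r \<Longrightarrow> r \<le> 1 \<Longrightarrow> norm (f (r *\<^sub>R z) - f z) < e"
    using uniform_dilation[OF f] by metis
  have "\<forall>\<^sub>F r in at_left 1. r \<in> {r0<..<1}" by (rule eventually_at_left_real[OF r0(2)])
  then show "\<forall>\<^sub>F r in at_left 1. dist (f (r *\<^sub>R \<zeta>)) (f \<zeta>) < e"
    by eventually_elim (use r0(3)[of \<zeta>] \<zeta> torus_subset_closed in \<open>auto simp: dist_norm\<close>)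
qed

lemma closed_inner_continuous:
  "closed_inner x \<Longrightarrow> continuous_on (closed_polydisk 1) x"
  by (auto simp: closed_inner_def intro: sv_holomorphic_on_continuous)

lemma Hinf_ball_if_bounded_by_one:
  assumes "sv_holomorphic_on f polydisk" "\<And>z. z \<in> polydisk \<Longrightarrow> norm (f z) \<le> 1"
  shows "f \<in> Hinf_ball"
  using assms unfolding Hinf_ball_def Hinf_def by (auto intro!: boundedI)

lemma closed_inner_Hinf_ball:
  assumes "closed_inner x"
  shows "x \<in> Hinf_ball"
  using assms closed_inner_norm_le polydisk_subset_closed sv_holomorphic_on_subset
  by (intro Hinf_ball_if_bounded_by_one) (auto simp: closed_inner_def)

lemma closed_inner_imp_inner:
  assumes x: "closed_inner x"
  shows "inner_function x"
proof -
  have "((\<lambda>r. norm (x (r *\<^sub>R \<zeta>))) \<longlongrightarrow> 1) (at_left 1)" if "\<zeta> \<in> torus" for \<zeta>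
    using tendsto_norm[OF tendsto_radial[OF closed_inner_continuous[OF x] that]] x that
    by (simp add: closed_inner_def)
  then show ?thesis
    using closed_inner_Hinf_ball[OF x]
    by (auto simp: inner_function_def Hinf_ball_def space_torus_measure intro!: AE_I2)
qed

lemma closed_inner_imp_continuous_up_to_closure:
  assumes x: "closed_inner x"
  shows "continuous_up_to_closure x"
  unfolding continuous_up_to_closure_def
  by (rule exI[of _ x])
     (use continuous_on_subset[OF closed_inner_continuous[OF x] closure_polydisk_subset] in auto)

text \<open>As the factors have modulus at most one, the partial products change by at most \<open>\<bar>a\<^sub>i - 1\<bar>\<close> in
  each step. Only the tail has to be close to \<open>1\<close>.\<close>

lemma partial_products_geometric:
  fixes a :: "nat \<Rightarrow> complex"
  assumes a: "\<And>i. norm (a i) \<le> 1" and near: "\<And>i. M \<le> i \<Longrightarrow> norm (a i - 1) \<le> (1 / 2) ^ i"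
  shows "convergent (\<lambda>N. \<Prod>i<N. a i)"
    and "M \<le> K \<Longrightarrow> norm (lim (\<lambda>N. \<Prod>i<N. a i) - (\<Prod>i<K. a i)) \<le> 2 * (1 / 2) ^ K"
proof -
  define P where "P N = (\<Prod>i<N. a i)" for N
  have P1: "norm (P N) \<le> 1" for N
    unfolding P_def prod_norm[symmetric] by (intro prod_le_1) (auto simp: a)
  have step: "norm (P (K + d) - P K) \<le> 2 * (1 / 2) ^ K - 2 * (1 / 2) ^ (K + d)" if K: "M \<le> K" for K d
  proof (induction d)
    case (Suc d)
    have "P (K + Suc d) - P (K + d) = P (K + d) * (a (K + d) - 1)" by (simp add: P_def algebra_simps)
    also have "norm \<dots> \<le> 1 * (1 / 2) ^ (K + d)"
      unfolding norm_mult using K by (intro mult_mono P1 near) auto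
    finally have "norm (P (K + Suc d) - P (K + d)) \<le> (1 / 2) ^ (K + d)" by simp
    then show ?case
      using Suc norm_triangle_ineq[of "P (K + Suc d) - P (K + d)" "P (K + d) - P K"] by simp
  qed simp
  have bound: "norm (P N - P K) \<le> 2 * (1 / 2) ^ K" if MK: "M \<le> K" and KN: "K \<le> N" for K N
  proof -
    obtain d where "N = K + d" using le_Suc_ex[OF KN] by blast
    moreover have "0 \<le> (1 / 2 :: real) ^ (K + d)" by (rule zero_le_power) simp
    ultimately show ?thesis using step[OF MK, of d] by (simp only:)
  qed
  have "Cauchy P"
  proof (rule metric_CauchyI)
    fix e :: real assume e: "e > 0"
    obtain K0 where K0: "(1 / 2 :: real) ^ K0 < e / 4" using real_arch_pow_inv[of "e / 4" "1 / 2"] e by auto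
    define K where "K = max M K0"
    have "(1 / 2 :: real) ^ K \<le> (1 / 2) ^ K0" by (intro power_decreasing) (auto simp: K_def)
    then have K: "2 * (1 / 2) ^ K < e / 2" using K0 by linarith
    have "dist (P m) (P n) < e" if "K \<le> m" "K \<le> n" for m n
    proof -
      have "dist (P m) (P K) < e / 2" "dist (P n) (P K) < e / 2"
        unfolding dist_norm using bound[of K m] bound[of K n] that K by (auto simp: K_def)
      then show ?thesis by (metis dist_commute dist_triangle_half_r)
    qed
    then show "\<exists>K. \<forall>m\<ge>K. \<forall>n\<ge>K. dist (P m) (P n) < e" by blast
  qed
  then have conv: "convergent P" by (rule Cauchy_convergent)
  then show "convergent (\<lambda>N. \<Prod>i<N. a i)" by (simp add: P_def[abs_def])
  show "norm (lim (\<lambda>N. \<Prod>i<N. a i) - (\<Prod>i<K. a i)) \<le> 2 * (1 / 2) ^ K" if K: "M \<le> K"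
  proof -
    have "(\<lambda>N. norm (P N - P K)) \<longlonglongrightarrow> norm (lim P - P K)"
      using conv by (intro tendsto_intros) (simp add: convergent_LIMSEQ_iff)
    then have "norm (lim P - P K) \<le> 2 * (1 / 2) ^ K"
      by (rule LIMSEQ_le_const2) (use bound[OF K] in blast)
    then show ?thesis by (simp add: P_def[abs_def])
  qed
qed

text \<open>Approximation holds for functions holomorphic on the closed polydisk; a dilation brings \<open>f\<close> into
  that class and a further factor \<open>1 - \<eta>\<close> makes the inequality \<open>\<bar>p\<bar> < 1\<close> strict.\<close>

lemma polynomials_dense_Hinf_ball:
  fixes f :: "complex ^ 'n \<Rightarrow> complex"
  assumes f: "f \<in> Hinf_ball" and \<rho>: "0 < \<rho>" "\<rho> < 1" and e: "0 < e"
  obtains p where "\<And>z. z \<in> closed_polydisk 1 \<Longrightarrow> norm (eval_poly p z) < 1"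
    "\<And>z. z \<in> closed_polydisk \<rho> \<Longrightarrow> norm (eval_poly p z - f z) < e"
proof -
  have f_hol: "sv_holomorphic_on f polydisk" and f1: "\<And>z. z \<in> polydisk \<Longrightarrow> norm (f z) \<le> 1"
    using f by (auto simp: Hinf_ball_def Hinf_def)
  have scaled: "s *\<^sub>R z \<in> polydisk" if "z \<in> closed_polydisk 1" "0 \<le> s" "s < 1" for s and z :: "complex ^ 'n"
    using scaleR_in_closed_polydisk[OF that(1,2)] closed_polydisk_subset_polydisk[of s] that(3) by auto
  have "sv_holomorphic_on (\<lambda>z. f (\<rho> *\<^sub>R z)) (closed_polydisk 1)"
    using \<rho> by (intro sv_holomorphic_on_dilate[OF f_hol] scaled) auto
  then have "continuous_on (closed_polydisk 1) (\<lambda>z. f (\<rho> *\<^sub>R z))" by (rule sv_holomorphic_on_continuous)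
  then obtain r where r: "0 < r" "r < 1"
      "\<And>z. z \<in> closed_polydisk 1 \<Longrightarrow> norm (f (\<rho> *\<^sub>R r *\<^sub>R z) - f (\<rho> *\<^sub>R z)) < e / 2"
    using uniform_dilation[of "\<lambda>z. f (\<rho> *\<^sub>R z)" "e / 2"] e by (metis half_gt_zero less_imp_le order_refl)
  define g where "g = (\<lambda>z. f (r *\<^sub>R z))"
  have g_hol: "sv_holomorphic_on g (closed_polydisk 1)"
    unfolding g_def using r by (intro sv_holomorphic_on_dilate[OF f_hol] scaled) auto
  have g1: "norm (g z) \<le> 1" if "z \<in> closed_polydisk 1" for z
    unfolding g_def using r that by (intro f1 scaled) auto
  define \<eta> where "\<eta> = min (1 / 2) (e / 4)"
  have \<eta>: "0 < \<eta>" "\<eta> < 1" "\<eta> \<le> e / 4" using e by (auto simp: \<eta>_def)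
  have "sv_holomorphic_on (\<lambda>z. of_real (1 - \<eta>) * g z) (closed_polydisk 1)"
    by (intro sv_intros g_hol)
  from poly_approximable_if_holomorphic[OF this] \<eta>(1)
  obtain p where p: "\<And>z. z \<in> closed_polydisk 1 \<Longrightarrow> norm (eval_poly p z - of_real (1 - \<eta>) * g z) < \<eta>"
    unfolding poly_approximable_def by metis
  show ?thesis
  proof
    fix z :: "complex ^ 'n" assume z: "z \<in> closed_polydisk 1"
    have "norm (of_real (1 - \<eta>) * g z) = (1 - \<eta>) * norm (g z)"
      unfolding norm_mult norm_of_real using \<eta> by simp
    also have "\<dots> \<le> (1 - \<eta>) * 1" using \<eta> g1[OF z] by (intro mult_left_mono) auto
    finally show "norm (eval_poly p z) < 1"
      using p[OF z] norm_triangle_ineq[of "eval_poly p z - of_real (1 - \<eta>) * g z" "of_real (1 - \<eta>) * g z"]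
      by simp
  next
    fix z :: "complex ^ 'n" assume z: "z \<in> closed_polydisk \<rho>"
    then have z1: "z \<in> closed_polydisk 1" using \<rho> closed_polydisk_mono[of \<rho> 1] by auto
    have "(1 / \<rho>) *\<^sub>R z \<in> closed_polydisk 1" using scaleR_in_closed_polydisk[OF z, of "1 / \<rho>"] \<rho> by simp
    from r(3)[OF this] have a: "norm (g z - f z) < e / 2" using \<rho> by (simp add: g_def)
    have "eval_poly p z - f z = (eval_poly p z - of_real (1 - \<eta>) * g z) - of_real \<eta> * g z + (g z - f z)"
      by (simp add: algebra_simps)
    also have "norm \<dots> \<le> norm (eval_poly p z - of_real (1 - \<eta>) * g z) + norm (of_real \<eta> * g z) + norm (g z - f z)"
      by (intro order_trans[OF norm_triangle_ineq] add_right_mono norm_triangle_ineq4)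
    also have "norm (of_real \<eta> * g z) \<le> \<eta>"
      unfolding norm_mult norm_of_real using \<eta> g1[OF z1] by (simp add: mult_left_le)
    finally show "norm (eval_poly p z - f z) < e" using p[OF z1] a \<eta>(3) by linarith
  qed
qed

text \<open>Pairing with a second index repeats every polynomial infinitely often. A given target can thus be
  attacked at arbitrarily late steps, where the compact sets are large and the errors small.\<close>

lemma eval_poly_strict_ball_enumeration:
  obtains v :: "nat \<Rightarrow> complex ^ 'n \<Rightarrow> complex"
  where "\<And>j. sv_holomorphic_on (v j) (closed_polydisk 1)"
    "\<And>j z. z \<in> closed_polydisk 1 \<Longrightarrow> norm (v j z) < 1"
    "\<And>f \<rho> e J. f \<in> Hinf_ball \<Longrightarrow> 0 < \<rho> \<Longrightarrow> \<rho> < 1 \<Longrightarrow> 0 < e \<Longrightarrow>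
       \<exists>j\<ge>J. \<forall>z\<in>closed_polydisk \<rho>. norm (v j z - f z) < e"
proof -
  define T where "T = {p :: 'n poly_expr. \<forall>z\<in>closed_polydisk 1. norm (eval_poly p z) < 1}"
  have "Coeff 0 0 \<in> T" by (simp add: T_def zero_complex.code[symmetric])
  then have T: "T \<noteq> {}" "countable T" by auto
  define v where "v j = eval_poly (from_nat_into T (fst (prod_decode j)))" for j
  show ?thesis
  proof
    show "sv_holomorphic_on (v j) (closed_polydisk 1)" for j
      unfolding v_def by (rule sv_holomorphic_on_eval_poly)
    show "norm (v j z) < 1" if "z \<in> closed_polydisk 1" for j z
      using from_nat_into[OF T(1)] that unfolding T_def v_def by blast
    fix f :: "complex ^ 'n \<Rightarrow> complex" and \<rho> e :: real and J
    assume f: "f \<in> Hinf_ball" "0 < \<rho>" "\<rho> < 1" "0 < e"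
    obtain p where p1: "\<And>z. z \<in> closed_polydisk 1 \<Longrightarrow> norm (eval_poly p z) < 1"
      and p2: "\<And>z. z \<in> closed_polydisk \<rho> \<Longrightarrow> norm (eval_poly p z - f z) < e"
      using polynomials_dense_Hinf_ball[OF f] by blast
    have "p \<in> T" using p1 by (simp add: T_def)
    obtain i where i: "from_nat_into T i = p" using from_nat_into_surj[OF T(2) \<open>p \<in> T\<close>] by blast
    have "v (prod_encode (i, J)) = eval_poly p" by (simp add: v_def i)
    then show "\<exists>j\<ge>J. \<forall>z\<in>closed_polydisk \<rho>. norm (v j z - f z) < e"
      using p2 le_prod_encode_2[of J i] by (intro exI[of _ "prod_encode (i, J)"]) auto
  qed
qed

text \<open>Uniform closeness of the factors to \<open>1\<close> on compact sets makes the product converge; closeness on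
  entire radii, outside the sets \<open>E i\<close> of summable measure, makes the limit inner. Indeed, for almost
  every \<open>\<zeta>\<close> the partial products converge uniformly on the radius ending at \<open>\<zeta>\<close>, so the limits
  \<open>r \<longrightarrow> 1\<close> and \<open>N \<longrightarrow> \<infinity>\<close> may be interchanged.\<close>

lemma inner_function_infinite_product:
  fixes xs :: "nat \<Rightarrow> complex ^ 'n \<Rightarrow> complex"
  assumes xs: "\<And>j. closed_inner (xs j)"
    and near: "\<And>r. r < 1 \<Longrightarrow> \<exists>M. \<forall>i\<ge>M. \<forall>z\<in>closed_polydisk r. norm (xs i z - 1) \<le> (1 / 2) ^ i"
    and E: "\<And>i. E i \<in> sets torus_measure" "\<And>i. emeasure torus_measure (E i) < \<infinity>"
      "summable (\<lambda>i. measure torus_measure (E i))"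
    and off_E: "\<And>i \<zeta> r. \<zeta> \<in> torus \<Longrightarrow> \<zeta> \<notin> E i \<Longrightarrow> 0 \<le> r \<Longrightarrow> r \<le> 1 \<Longrightarrow> norm (xs i (r *\<^sub>R \<zeta>) - 1) \<le> (1 / 2) ^ i"
  defines "x \<equiv> \<lambda>z. lim (\<lambda>N. \<Prod>j<N. xs j z)"
  shows "inner_function x" "x \<in> Hinf_ball"
    "limitin Hinf_topology (\<lambda>N z. \<Prod>j<N. xs j z) x sequentially"
proof -
  have xs1: "norm (xs i z) \<le> 1" if "z \<in> closed_polydisk 1" for i z
    using closed_inner_norm_le[OF xs that] .
  have prod_inner: "closed_inner (\<lambda>z. \<Prod>j<N. xs j z)" for N
    unfolding closed_inner_def
  proof (intro conjI ballI)
    show "sv_holomorphic_on (\<lambda>z. \<Prod>j<N. xs j z) (closed_polydisk 1)"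
      using xs by (intro sv_intros) (auto simp: closed_inner_def)
    show "norm (\<Prod>j<N. xs j z) = 1" if "z \<in> torus" for z
      unfolding prod_norm[symmetric] using xs that by (simp add: closed_inner_def)
  qed
  have ulim: "uniform_limit (closed_polydisk r) (\<lambda>N z. \<Prod>j<N. xs j z) x sequentially" if r: "r < 1" for r
  proof (rule uniform_limitI)
    fix e :: real assume e: "e > 0"
    obtain M where M: "\<And>i z. M \<le> i \<Longrightarrow> z \<in> closed_polydisk r \<Longrightarrow> norm (xs i z - 1) \<le> (1 / 2) ^ i"
      using near[OF r] by blast
    have sub: "closed_polydisk r \<subseteq> closed_polydisk 1" using r by (intro closed_polydisk_mono) simp
    have "(\<lambda>N. 2 * (1 / 2 :: real) ^ N) \<longlonglongrightarrow> 2 * 0" by (intro tendsto_intros LIMSEQ_power_zero) simp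
    then have "\<forall>\<^sub>F N in sequentially. 2 * (1 / 2 :: real) ^ N < e" using e by (intro order_tendstoD) auto
    with eventually_ge_at_top[of M]
    show "\<forall>\<^sub>F N in sequentially. \<forall>z\<in>closed_polydisk r. dist (\<Prod>j<N. xs j z) (x z) < e"
    proof eventually_elim
      case (elim N)
      have "norm (x z - (\<Prod>j<N. xs j z)) \<le> 2 * (1 / 2) ^ N" if z: "z \<in> closed_polydisk r" for z
        unfolding x_def
        by (rule partial_products_geometric(2)[OF _ _ elim(1)]) (use xs1 sub z M in auto)
      then show ?case using elim(2) by (fastforce simp: dist_norm norm_minus_commute)
    qed
  qed
  have "sv_holomorphic_on (\<lambda>z. \<Prod>j<N. xs j z) polydisk" for N
    by (rule sv_holomorphic_on_subset[OF _ polydisk_subset_closed])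
       (use prod_inner[of N] in \<open>simp add: closed_inner_def\<close>)
  then have x_hol: "sv_holomorphic_on x polydisk"
    by (rule uniform_limit_sv_holomorphic[OF _ ulim])
  have x1: "norm (x z) \<le> 1" if z: "z \<in> polydisk" for z
  proof -
    obtain r where r: "r < 1" "{z} \<subseteq> closed_polydisk r"
      using z by (metis compact_sing compact_subset_polydisk empty_subsetI insert_subset)
    then have "(\<lambda>N. \<Prod>j<N. xs j z) \<longlonglongrightarrow> x z" using tendsto_uniform_limitI[OF ulim] by blast
    then have "(\<lambda>N. norm (\<Prod>j<N. xs j z)) \<longlonglongrightarrow> norm (x z)" by (rule tendsto_norm)
    moreover have "norm (\<Prod>j<N. xs j z) \<le> 1" for N
      using closed_inner_norm_le[OF prod_inner] z polydisk_subset_closed by blast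
    ultimately show ?thesis by (intro LIMSEQ_le_const2) auto
  qed
  show x_ball: "x \<in> Hinf_ball" using x_hol x1 by (rule Hinf_ball_if_bounded_by_one)
  show "limitin Hinf_topology (\<lambda>N z. \<Prod>j<N. xs j z) x sequentially"
  proof (subst limitin_Hinf_topology_iff)
    show "(\<lambda>z. \<Prod>j<N. xs j z) \<in> Hinf" for N
      using closed_inner_Hinf_ball[OF prod_inner] by (simp add: Hinf_ball_def)
    show "x \<in> Hinf \<and> (\<forall>K. compact K \<and> K \<subseteq> polydisk \<longrightarrow>
        uniform_limit K (\<lambda>N z. \<Prod>j<N. xs j z) x sequentially)"
      using x_ball ulim compact_subset_polydisk uniform_limit_on_subset unfolding Hinf_ball_def
      by (metis (no_types, lifting) mem_Collect_eq)
  qed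
  have "((\<lambda>r. norm (x (r *\<^sub>R \<zeta>))) \<longlongrightarrow> 1) (at_left 1)"
    if \<zeta>: "\<zeta> \<in> torus" and ev: "\<forall>\<^sub>F i in sequentially. \<zeta> \<in> space torus_measure - E i" for \<zeta>
  proof (rule tendstoI)
    fix e :: real assume e: "e > 0"
    obtain M where M: "\<And>i. M \<le> i \<Longrightarrow> \<zeta> \<notin> E i" using ev unfolding eventually_sequentially by blast
    obtain K0 where K0: "(1 / 2 :: real) ^ K0 < e / 4" using real_arch_pow_inv[of "e / 4" "1 / 2"] e by auto
    define K where "K = max M K0"
    have "(1 / 2 :: real) ^ K \<le> (1 / 2) ^ K0" by (intro power_decreasing) (auto simp: K_def)
    then have K: "2 * (1 / 2) ^ K < e / 2" using K0 by linarith
    have "((\<lambda>r. norm (\<Prod>j<K. xs j (r *\<^sub>R \<zeta>))) \<longlongrightarrow> 1) (at_left 1)"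
      using tendsto_norm[OF tendsto_radial[OF closed_inner_continuous[OF prod_inner[of K]] \<zeta>]]
        prod_inner[of K] \<zeta> by (simp add: closed_inner_def)
    then have "\<forall>\<^sub>F r in at_left 1. dist (norm (\<Prod>j<K. xs j (r *\<^sub>R \<zeta>))) 1 < e / 2"
      using e by (intro tendstoD) auto
    moreover have "\<forall>\<^sub>F r in at_left 1. r \<in> {0<..<1::real}" by (rule eventually_at_left_real) simp
    ultimately show "\<forall>\<^sub>F r in at_left 1. dist (norm (x (r *\<^sub>R \<zeta>))) 1 < e"
    proof eventually_elim
      case (elim r)
      have in1: "r *\<^sub>R \<zeta> \<in> closed_polydisk 1"
        using elim(2) \<zeta> by (auto simp: torus_def closed_polydisk_def)
      have "norm (x (r *\<^sub>R \<zeta>) - (\<Prod>j<K. xs j (r *\<^sub>R \<zeta>))) \<le> 2 * (1 / 2) ^ K"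
        unfolding x_def
        by (rule partial_products_geometric(2)[where M = K])
           (use xs1 in1 off_E[OF \<zeta> M] elim(2) in \<open>auto simp: K_def\<close>)
      then have "\<bar>norm (x (r *\<^sub>R \<zeta>)) - norm (\<Prod>j<K. xs j (r *\<^sub>R \<zeta>))\<bar> < e / 2"
        using K norm_triangle_ineq3[of "x (r *\<^sub>R \<zeta>)" "\<Prod>j<K. xs j (r *\<^sub>R \<zeta>)"] by linarith
      then show ?case using elim(1) by (simp add: dist_real_def abs_if split: if_splits)
    qed
  qed
  then have "AE \<zeta> in torus_measure. ((\<lambda>r. norm (x (r *\<^sub>R \<zeta>))) \<longlongrightarrow> 1) (at_left 1)"
    using borel_cantelli_AE1[OF E] AE_space[of torus_measure] by (auto simp: space_torus_measure)
  then show "inner_function x" using x_ball by (simp add: inner_function_def Hinf_ball_def)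
qed

section \<open>The universal inner function\<close>

theorem theorem4:
  fixes \<alpha> :: "nat \<Rightarrow> complex ^ 'n"
    and \<theta> :: "nat \<Rightarrow> real ^ 'n"
    and p :: "nat \<Rightarrow> 'n \<Rightarrow> 'n"
    and \<phi> :: "nat \<Rightarrow> complex ^ 'n \<Rightarrow> complex ^ 'n"
    and a :: "complex ^ 'n"
  assumes "\<And>k. \<alpha> k \<in> polydisk"
    and "\<And>k. p k permutes UNIV"
    and "\<And>k. \<phi> k = polydisk_aut (\<alpha> k) (\<theta> k) (p k)"
    and "\<alpha> \<longlonglongrightarrow> a"
    and "a \<in> torus"
  shows "\<exists>x :: complex ^ 'n \<Rightarrow> complex.
    inner_function x \<and>
    range (\<lambda>k. x \<circ> \<phi> k) \<subseteq> Hinf_ball \<and>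
    subtopology Hinf_topology Hinf_ball closure_of range (\<lambda>k. x \<circ> \<phi> k) = Hinf_ball \<and>
    (\<exists>xs :: nat \<Rightarrow> complex ^ 'n \<Rightarrow> complex.
       (\<forall>j. inner_function (xs j) \<and> continuous_up_to_closure (xs j)) \<and>
       limitin Hinf_topology (\<lambda>N z. \<Prod>j<N. xs j z) x sequentially)"
proof -
  note \<alpha> = assms(1) and p = assms(2) and \<phi> = assms(3)
  obtain \<beta> where \<beta>: "\<beta> \<in> torus"
    and conv: "\<And>\<rho> \<delta>. \<rho> < 1 \<Longrightarrow> 0 < \<delta> \<Longrightarrow> \<exists>k. \<forall>z\<in>closed_polydisk \<rho>. dist (\<phi> k z) \<beta> < \<delta>"
    using polydisk_aut_limit_point[OF \<alpha> assms(4,5), of \<theta> p] unfolding \<phi> by metis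
  obtain v :: "nat \<Rightarrow> complex ^ 'n \<Rightarrow> complex" where v: "\<And>j. sv_holomorphic_on (v j) (closed_polydisk 1)"
    "\<And>j z. z \<in> closed_polydisk 1 \<Longrightarrow> norm (v j z) < 1"
    and v_dense: "\<And>f \<rho> e J. f \<in> Hinf_ball \<Longrightarrow> 0 < \<rho> \<Longrightarrow> \<rho> < 1 \<Longrightarrow> 0 < e \<Longrightarrow>
       \<exists>j\<ge>J. \<forall>z\<in>closed_polydisk \<rho>. norm (v j z - f z) < e"
    using eval_poly_strict_ball_enumeration by metis
  define \<rho> where "\<rho> j = 1 - 1 / (real j + 2)" for j
  have \<rho>: "0 < \<rho> j" "\<rho> j < 1" for j by (auto simp: \<rho>_def field_simps)
  have \<rho>_mono: "\<rho> i \<le> \<rho> j" if "i \<le> j" for i j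
    using that by (simp add: \<rho>_def frac_le)
  have \<phi>_open: "\<phi> k z \<in> polydisk" if "z \<in> polydisk" for k z
    unfolding \<phi> by (rule polydisk_aut_open[OF \<alpha> that])
  \<comment> \<open>The factors are chosen by dependent choice. The state before step \<open>n\<close> is the pair of the partial
    product of the factors chosen so far and a radius \<open>\<sigma>\<close> such that \<open>closed_polydisk \<sigma>\<close> contains
    all images under earlier automorphisms on which later factors must stay close to \<open>1\<close>.\<close>
  define valid where "valid n s \<longleftrightarrow> continuous_on (closed_polydisk 1) (fst s) \<and> fst s \<beta> = 1 \<and>
      snd s < 1 \<and> (n = 0 \<longrightarrow> fst s = (\<lambda>z. 1))" for n :: nat and s :: "(complex ^ 'n \<Rightarrow> complex) \<times> real"
  define good where "good n s x k E s' \<longleftrightarrow>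
      closed_inner x \<and> (\<forall>z. fst s' z = fst s z * x z) \<and> snd s \<le> snd s' \<and> \<rho> n \<le> snd s' \<and>
      \<phi> k ` closed_polydisk (\<rho> n) \<subseteq> closed_polydisk (snd s') \<and>
      (\<forall>z\<in>closed_polydisk (snd s). norm (x z - 1) \<le> (1 / 2) ^ n) \<and>
      (\<forall>z\<in>closed_polydisk (\<rho> n). norm (x (\<phi> k z) - v n z) \<le> (1 / 2) ^ n) \<and>
      (\<forall>z\<in>closed_polydisk (\<rho> n). norm (fst s (\<phi> k z) - 1) \<le> (1 / 2) ^ n) \<and>
      E \<in> sets torus_measure \<and> emeasure torus_measure E < \<infinity> \<and> measure torus_measure E \<le> 8 * (1 / 2) ^ n \<and>
      (\<forall>\<zeta>\<in>torus - E. \<forall>r\<in>{0..1}. norm (x (r *\<^sub>R \<zeta>) - 1) \<le> (1 / 2) ^ n)"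
    for n and s s' :: "(complex ^ 'n \<Rightarrow> complex) \<times> real" and x k and E :: "(complex ^ 'n) set"
  have "\<exists>s. \<forall>n. valid n (s n) \<and> (\<exists>x k E. good n (s n) x k E (s (Suc n)))"
  proof (rule dependent_nat_choice)
    show "\<exists>s. valid 0 s"
      by (rule exI[of _ "(\<lambda>z. 1, 0)"]) (simp add: valid_def)
    fix s :: "(complex ^ 'n \<Rightarrow> complex) \<times> real" and n
    assume s: "valid n s"
    have e: "0 < (1 / 2 :: real) ^ n" "(1 / 2 :: real) ^ n \<le> 1" by (auto simp: power_le_one)
    have s': "continuous_on (closed_polydisk 1) (fst s)" "fst s \<beta> = 1" "snd s < 1"
      using s by (auto simp: valid_def)
    obtain x k E where x: "closed_inner x" "x \<beta> = 1"
      "\<And>z. z \<in> closed_polydisk (snd s) \<Longrightarrow> norm (x z - 1) \<le> (1 / 2) ^ n"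
      "\<And>z. z \<in> closed_polydisk (\<rho> n) \<Longrightarrow> norm (x (\<phi> k z) - v n z) \<le> (1 / 2) ^ n"
      "\<And>z. z \<in> closed_polydisk (\<rho> n) \<Longrightarrow> norm (fst s (\<phi> k z) - 1) \<le> (1 / 2) ^ n"
      and E: "E \<in> sets torus_measure" "emeasure torus_measure E < \<infinity>" "measure torus_measure E \<le> 8 / real (2 ^ n)"
      "\<And>\<zeta> r. \<zeta> \<in> torus \<Longrightarrow> \<zeta> \<notin> E \<Longrightarrow> 0 \<le> r \<Longrightarrow> r \<le> 1 \<Longrightarrow> norm (x (r *\<^sub>R \<zeta>) - 1) \<le> (1 / 2) ^ n"
      using universal_factor[where m = "2 ^ n", OF \<alpha> p \<phi> \<beta> conv s'(1,2) v(1)[of n] v(2) \<rho>(2)[of n] s'(3) e] by auto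
    have "compact (\<phi> k ` closed_polydisk (\<rho> n))"
      unfolding \<phi>
      by (intro compact_continuous_image compact_closed_polydisk
          continuous_on_subset[OF polydisk_aut_continuous[OF \<alpha>]] closed_polydisk_mono less_imp_le \<rho>(2))
    moreover have "\<phi> k ` closed_polydisk (\<rho> n) \<subseteq> polydisk"
      using closed_polydisk_subset_polydisk[OF \<rho>(2)] \<phi>_open by blast
    ultimately obtain t where t: "t < 1" "\<phi> k ` closed_polydisk (\<rho> n) \<subseteq> closed_polydisk t"
      using compact_subset_polydisk by metis
    define t' where "t' = max t (max (\<rho> n) (snd s))"
    have "closed_polydisk t \<subseteq> (closed_polydisk t' :: (complex ^ 'n) set)"
      by (rule closed_polydisk_mono) (simp add: t'_def)
    then have t': "t' < 1" "snd s \<le> t'" "\<rho> n \<le> t'" "\<phi> k ` closed_polydisk (\<rho> n) \<subseteq> closed_polydisk t'"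
      using t \<rho> s' by (auto simp: t'_def)
    have "valid (Suc n) (\<lambda>z. fst s z * x z, t')"
      using s' t' x(2) closed_inner_continuous[OF x(1)]
      by (auto simp: valid_def intro!: continuous_intros)
    moreover have "8 / real (2 ^ n) = 8 * (1 / 2) ^ n" by (simp add: power_one_over)
    with E(3) have "measure torus_measure E \<le> 8 * (1 / 2) ^ n" by (simp only:)
    then have "good n s x k E (\<lambda>z. fst s z * x z, t')"
      unfolding good_def fst_conv snd_conv
      by (intro conjI allI ballI refl x E(1,2,4) t') auto
    ultimately show "\<exists>s'. valid (Suc n) s' \<and> (\<exists>x k E. good n s x k E s')" by blast
  qed
  then obtain s where s: "\<And>n. valid n (s n)" "\<And>n. \<exists>x k E. good n (s n) x k E (s (Suc n))" by blast
  obtain xs k E where good: "\<And>n. good n (s n) (xs n) (k n) (E n) (s (Suc n))" using s(2) by metis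
  define X where "X n = fst (s n)" for n
  define \<sigma> where "\<sigma> n = snd (s n)" for n
  have xs: "closed_inner (xs n)" for n using good[of n] by (simp add: good_def)
  have X: "X n z = (\<Prod>j<n. xs j z)" for n z
  proof (induction n)
    case 0
    show ?case using s(1)[of 0] by (simp add: valid_def X_def)
  next
    case (Suc n)
    then show ?case using good[of n] by (simp add: good_def X_def)
  qed
  have \<sigma>: "\<sigma> i \<le> \<sigma> j" if "i \<le> j" for i j
    by (rule lift_Suc_mono_le[OF _ that]) (use good in \<open>auto simp: good_def \<sigma>_def\<close>)
  have \<rho>\<sigma>: "\<rho> j \<le> \<sigma> (Suc j)" for j using good[of j] by (simp add: good_def \<sigma>_def)
  have xs_near: "norm (xs i z - 1) \<le> (1 / 2) ^ i" if "z \<in> closed_polydisk (\<sigma> (Suc j))" "Suc j \<le> i" for i j z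
    using good[of i] that closed_polydisk_mono[OF \<sigma>[OF that(2)]] by (auto simp: good_def \<sigma>_def)
  define x where "x = (\<lambda>z. lim (\<lambda>N. \<Prod>j<N. xs j z))"
  have near: "\<exists>M. \<forall>i\<ge>M. \<forall>z\<in>closed_polydisk r. norm (xs i z - 1) \<le> (1 / 2) ^ i" if r: "r < 1" for r
  proof -
    obtain j where j: "1 / real (Suc j) < 1 - r" using reals_Archimedean[of "1 - r"] r by (auto simp: inverse_eq_divide)
    have "1 / (real j + 2) \<le> 1 / real (Suc j)" by (intro frac_le) auto
    then have "r \<le> \<rho> j" using j by (simp add: \<rho>_def)
    then have "closed_polydisk r \<subseteq> closed_polydisk (\<sigma> (Suc j))"
      using \<rho>\<sigma>[of j] by (intro closed_polydisk_mono) simp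
    then show ?thesis using xs_near by blast
  qed
  have "summable (\<lambda>i. measure torus_measure (E i))"
  proof (rule summable_comparison_test')
    show "summable (\<lambda>i. 8 * (1 / 2 :: real) ^ i)" by (intro summable_mult summable_geometric) simp
    show "norm (measure torus_measure (E i)) \<le> 8 * (1 / 2) ^ i" if "0 \<le> i" for i
      using good[of i] by (simp add: good_def)
  qed
  note product = inner_function_infinite_product[of xs E, OF xs near _ _ this, folded x_def]
  have x_props: "inner_function x" "x \<in> Hinf_ball"
    "limitin Hinf_topology (\<lambda>N z. \<Prod>j<N. xs j z) x sequentially"
    using good by (intro product; auto simp: good_def)+
  have x\<phi>: "x \<circ> \<phi> i \<in> Hinf_ball" for i
  proof -
    have "sv_holomorphic_on (\<lambda>z. x (\<phi> i z)) polydisk"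
    proof (rule sv_holomorphic_on_compose)
      show "sv_holomorphic_on x polydisk" using x_props(2) by (simp add: Hinf_ball_def Hinf_def)
      show "sv_holomorphic_on (\<lambda>z. \<phi> i z $ j) polydisk" for j
        unfolding \<phi> by (rule sv_holomorphic_on_subset[OF polydisk_aut_holomorphic[OF \<alpha>] polydisk_subset_closed])
    qed (rule \<phi>_open)
    then show ?thesis
      using x_props(2) \<phi>_open by (intro Hinf_ball_if_bounded_by_one) (auto simp: comp_def Hinf_ball_def)
  qed
  have approx: "norm (x (\<phi> (k j) z) - v j z) \<le> 3 * (1 / 2) ^ j" if z: "z \<in> closed_polydisk (\<rho> j)" for j z
  proof -
    define w where "w = \<phi> (k j) z"
    have w1: "w \<in> closed_polydisk 1"
      using z closed_polydisk_subset_polydisk[OF \<rho>(2)] \<phi>_open polydisk_subset_closed unfolding w_def by blast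
    have w\<sigma>: "w \<in> closed_polydisk (\<sigma> (Suc j))"
      using good[of j] z by (auto simp: good_def w_def \<sigma>_def)
    have "norm (x w - X (Suc j) w) \<le> 2 * (1 / 2) ^ Suc j"
      unfolding x_def X
      by (rule partial_products_geometric(2)[where M = "Suc j"])
         (use closed_inner_norm_le[OF xs w1] xs_near[OF w\<sigma>] in auto)
    moreover have "norm (X (Suc j) w - v j z) \<le> 2 * (1 / 2) ^ j"
    proof -
      have "X (Suc j) w - v j z = (X j w - 1) * xs j w + (xs j w - v j z)"
        by (simp add: X algebra_simps)
      also have "norm \<dots> \<le> (1 / 2) ^ j * 1 + (1 / 2) ^ j"
      proof (rule order_trans[OF norm_triangle_ineq add_mono])
        show "norm ((X j w - 1) * xs j w) \<le> (1 / 2) ^ j * 1"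
          unfolding norm_mult using good[of j] z closed_inner_norm_le[OF xs w1]
          by (intro mult_mono) (auto simp: good_def w_def X_def)
        show "norm (xs j w - v j z) \<le> (1 / 2) ^ j" using good[of j] z by (simp add: good_def w_def)
      qed
      finally show ?thesis by simp
    qed
    ultimately show ?thesis
      using norm_triangle_ineq[of "x w - X (Suc j) w" "X (Suc j) w - v j z"] by (simp add: w_def)
  qed
  have dense: "f \<in> subtopology Hinf_topology Hinf_ball closure_of range (\<lambda>k. x \<circ> \<phi> k)"
    if f: "f \<in> Hinf_ball" for f
    unfolding in_closure_of
  proof (intro conjI allI impI)
    show "f \<in> topspace (subtopology Hinf_topology Hinf_ball)"
      using f by (simp add: Hinf_ball_def)
    fix T assume T: "f \<in> T \<and> openin (subtopology Hinf_topology Hinf_ball) T"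
    then obtain U where U: "openin Hinf_topology U" "T = U \<inter> Hinf_ball"
      by (auto simp: openin_subtopology)
    then have "f \<in> U" using T by blast
    then obtain K e where K: "compact K" "K \<subseteq> polydisk" "e > 0"
      and in_U: "\<And>g. g \<in> Hinf \<Longrightarrow> \<forall>z\<in>K. dist (g z) (f z) < e \<Longrightarrow> g \<in> U"
      using Hinf_topology_uniform_nbhd[OF U(1)] by metis
    obtain r where r: "r < 1" "K \<subseteq> closed_polydisk r" using compact_subset_polydisk[OF K(1,2)] by metis
    obtain J1 where J1: "1 / real (Suc J1) < 1 - r" using reals_Archimedean[of "1 - r"] r by (auto simp: inverse_eq_divide)
    obtain J2 where J2: "(1 / 2 :: real) ^ J2 < e / 6" using real_arch_pow_inv[of "e / 6" "1 / 2"] K(3) by auto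
    \<comment> \<open>From step \<open>J\<close> on, the polydisk of radius \<open>\<rho> j\<close> contains \<open>K\<close> and the error \<open>3 / 2^j\<close> is below \<open>e / 2\<close>.\<close>
    define J where "J = max J1 J2"
    have "1 / (real J + 2) \<le> 1 / real (Suc J1)" by (intro frac_le) (auto simp: J_def)
    then have rJ: "r \<le> \<rho> J" using J1 by (simp add: \<rho>_def)
    obtain j where j: "J \<le> j" "\<And>z. z \<in> closed_polydisk (\<rho> J) \<Longrightarrow> norm (v j z - f z) < e / 2"
      using v_dense[OF f \<rho>, of "e / 2" J J] K(3) by auto
    have "(1 / 2 :: real) ^ j \<le> (1 / 2) ^ J2" using j(1) by (intro power_decreasing) (auto simp: J_def)
    then have small: "3 * (1 / 2 :: real) ^ j < e / 2" using J2 by linarith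
    have "dist ((x \<circ> \<phi> (k j)) z) (f z) < e" if "z \<in> K" for z
    proof -
      have zJ: "z \<in> closed_polydisk (\<rho> J)" using that r(2) closed_polydisk_mono[OF rJ] by blast
      then have zj: "z \<in> closed_polydisk (\<rho> j)" using closed_polydisk_mono[OF \<rho>_mono[OF j(1)]] by blast
      show ?thesis
        using approx[OF zj] j(2)[OF zJ] small norm_triangle_ineq[of "x (\<phi> (k j) z) - v j z" "v j z - f z"]
        unfolding dist_norm comp_def by (simp only: diff_add_cancel add_diff_eq)
    qed
    then have "x \<circ> \<phi> (k j) \<in> U" using x\<phi> in_U by (simp add: Hinf_ball_def)
    then show "\<exists>y. y \<in> range (\<lambda>k. x \<circ> \<phi> k) \<and> y \<in> T" using x\<phi> U(2) by blast
  qed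
  have "subtopology Hinf_topology Hinf_ball closure_of range (\<lambda>k. x \<circ> \<phi> k) = Hinf_ball"
  proof
    show "subtopology Hinf_topology Hinf_ball closure_of range (\<lambda>k. x \<circ> \<phi> k) \<subseteq> Hinf_ball"
      using closure_of_subset_topspace[of "subtopology Hinf_topology Hinf_ball"] by fastforce
  qed (use dense in blast)
  then show ?thesis
    using x_props x\<phi> closed_inner_imp_inner[OF xs] closed_inner_imp_continuous_up_to_closure[OF xs]
    by (intro exI[of _ x] conjI exI[of _ xs]) auto
qed

end
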